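(* For all $k,n\in\mathbb N$, the category $\mathrm{Op}_U^{k,n}(\mathbf{DL})$ of $(k,n)$-ary $U$-operators of distributive lattices, where $U\colon\mathbf{DL}\to\mathbf{JSL}$ is the forgetful functor, is dually equivalent to the category of $(n,k)$-ary relational Priestley spaces and relational morphisms.
   Context: $\mathbf{DL}$ is the category of bounded distributive lattices and bounded lattice homomorphisms; $\mathbf{JSL}$ is the category of join-semilattices with bottom and maps preserving finite joins (including bottom). $\mathbf{JSL}$ is monoidal with the tensor product $\otimes$ representing maps preserving finite joins in each argument, with unit the two-element semilattice $2$. $U$-operators: a $(k,n)$-ary $U$-operator is a bounded distributive lattice $A$ with a $\mathbf{JSL}$-morphism $a\colon(UA)^{\otimes k}\to(UA)^{\otimes n}$. A morphism $(A,a)\to(B,b)$ is a $\mathbf{JSL}$-morphism $h\colon UA\to UB$ with $h^{\otimes n}\cdot a=b\cdot h^{\otimes k}$. A Priestley space is a compact topological space with a partial order such that for every $x\not\le y$ there is a clopen upset containing $x$ but not $y$. For a Priestley space $X$, $\mathbb V_\downarrow X$ is the set of closed downsets of $X$, ordered by inclusion, with the topology generated by the sets $\{A\mid A\cap W\ne\emptyset\}$, for clopen upsets $W$ of $X$, and their complements; it is a Priestley space. A Priestley relation from $X$ to $Y$ is a continuous monotone map $\rho\colon X\to\mathbb V_\downarrow Y$; write $x\mathrel\rho y$ for $y\in\rho(x)$. An $(n,k)$-ary relational Priestley space is a Priestley space $X$ with a Priestley relation $\rho\colon X^n\to\mathbb V_\downarrow X^k$. A relational morphism $(X,\rho)\to(X',\rho')$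 is a Priestley relation $\beta\colon X\to\mathbb V_\downarrow X'$ such that for all $\mathbf x\in X^n$, $\mathbf y\in X^k$, $\mathbf y'\in X'^k$: $$\mathbf x\mathrel\rho\mathbf y\ \wedge\ (\forall i\colon y_i\mathrel\beta y_i')\ \Rightarrow\ \exists\mathbf x'\in X'^n\colon(\forall i\colon x_i\mathrel\beta x_i')\ \wedge\ \mathbf x'\mathrel{\rho'}\mathbf y',$$ and for all $\mathbf x\in X^n$, $\mathbf x'\in X'^n$, $\mathbf y'\in X'^k$: $$(\forall i\colon x_i\mathrel\beta x_i')\ \wedge\ \mathbf x'\mathrel{\rho'}\mathbf y'\ \Rightarrow\ \exists\mathbf y\in X^k\colon\mathbf x\mathrel\rho\mathbf y\ \wedge\ (\forall i\colon y_i\mathrel\beta y_i').$$ Composition of relational morphisms is composition of relations; the identity on $X$ is $x\mapsto{\downarrow}x$. *)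

theory Defs
  imports "HOL-Algebra.Lattice" "HOL-Analysis.Function_Topology" "HOL-Library.Equipollence"
begin

section \<open>Categories and dual equivalence\<close>

text \<open>Hom-sets of different pairs of objects need not be disjoint, so operations on morphisms
  take the objects as arguments: \<open>Comp C A B D g f\<close> is the composite of \<open>f : A \<rightarrow> B\<close> and
  \<open>g : B \<rightarrow> D\<close>.\<close>

record ('o, 'm) category =
  Obj :: "'o set"
  Hom :: "'o \<Rightarrow> 'o \<Rightarrow> 'm set"
  Ident :: "'o \<Rightarrow> 'm"
  Comp :: "'o \<Rightarrow> 'o \<Rightarrow> 'o \<Rightarrow> 'm \<Rightarrow> 'm \<Rightarrow> 'm"

definition is_category :: "('o, 'm) category \<Rightarrow> bool" where
  "is_category C \<longleftrightarrow>
    (\<forall>A\<in>Obj C. Ident C A \<in> Hom C A A) \<and>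
    (\<forall>A\<in>Obj C. \<forall>B\<in>Obj C. \<forall>D\<in>Obj C. \<forall>f\<in>Hom C A B. \<forall>g\<in>Hom C B D.
      Comp C A B D g f \<in> Hom C A D) \<and>
    (\<forall>A\<in>Obj C. \<forall>B\<in>Obj C. \<forall>f\<in>Hom C A B.
      Comp C A A B f (Ident C A) = f \<and> Comp C A B B (Ident C B) f = f) \<and>
    (\<forall>A\<in>Obj C. \<forall>B\<in>Obj C. \<forall>D\<in>Obj C. \<forall>E\<in>Obj C.
      \<forall>f\<in>Hom C A B. \<forall>g\<in>Hom C B D. \<forall>h\<in>Hom C D E.
      Comp C A D E h (Comp C A B D g f) = Comp C A B E (Comp C B D E h g) f)"

definition opposite :: "('o, 'm) category \<Rightarrow> ('o, 'm) category" where
  "opposite C = \<lparr>Obj = Obj C, Hom = (\<lambda>A B. Hom C B A), Ident = Ident C,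
    Comp = (\<lambda>A B D g f. Comp C D B A f g)\<rparr>"

definition full_subcategory :: "('o, 'm) category \<Rightarrow> ('o \<Rightarrow> bool) \<Rightarrow> ('o, 'm) category" where
  "full_subcategory C P = C\<lparr>Obj := {A \<in> Obj C. P A}\<rparr>"

definition is_iso :: "('o, 'm) category \<Rightarrow> 'o \<Rightarrow> 'o \<Rightarrow> 'm \<Rightarrow> bool" where
  "is_iso C A B f \<longleftrightarrow> f \<in> Hom C A B \<and>
    (\<exists>g\<in>Hom C B A. Comp C A B A g f = Ident C A \<and> Comp C B A B f g = Ident C B)"

record ('o, 'm, 'p, 'n) functor_data =
  fobj :: "'o \<Rightarrow> 'p"
  fmor :: "'o \<Rightarrow> 'o \<Rightarrow> 'm \<Rightarrow> 'n"

definition is_functor ::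
    "('o, 'm) category \<Rightarrow> ('p, 'n) category \<Rightarrow> ('o, 'm, 'p, 'n) functor_data \<Rightarrow> bool" where
  "is_functor C D F \<longleftrightarrow>
    (\<forall>A\<in>Obj C. fobj F A \<in> Obj D) \<and>
    (\<forall>A\<in>Obj C. \<forall>B\<in>Obj C. \<forall>f\<in>Hom C A B. fmor F A B f \<in> Hom D (fobj F A) (fobj F B)) \<and>
    (\<forall>A\<in>Obj C. fmor F A A (Ident C A) = Ident D (fobj F A)) \<and>
    (\<forall>A\<in>Obj C. \<forall>B\<in>Obj C. \<forall>E\<in>Obj C. \<forall>f\<in>Hom C A B. \<forall>g\<in>Hom C B E.
      fmor F A E (Comp C A B E g f) =
      Comp D (fobj F A) (fobj F B) (fobj F E) (fmor F B E g) (fmor F A B f))"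

definition id_functor :: "('o, 'm, 'o, 'm) functor_data" where
  "id_functor = \<lparr>fobj = (\<lambda>A. A), fmor = (\<lambda>A B f. f)\<rparr>"

definition comp_functor ::
    "('p, 'n, 'q, 'l) functor_data \<Rightarrow> ('o, 'm, 'p, 'n) functor_data \<Rightarrow> ('o, 'm, 'q, 'l) functor_data" where
  "comp_functor G F = \<lparr>fobj = (\<lambda>A. fobj G (fobj F A)),
    fmor = (\<lambda>A B f. fmor G (fobj F A) (fobj F B) (fmor F A B f))\<rparr>"

definition natural_iso ::
    "('o, 'm) category \<Rightarrow> ('p, 'n) category \<Rightarrow> ('o, 'm, 'p, 'n) functor_data
      \<Rightarrow> ('o, 'm, 'p, 'n) functor_data \<Rightarrow> ('o \<Rightarrow> 'n) \<Rightarrow> bool" where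
  "natural_iso C D F G \<eta> \<longleftrightarrow>
    (\<forall>A\<in>Obj C. is_iso D (fobj F A) (fobj G A) (\<eta> A)) \<and>
    (\<forall>A\<in>Obj C. \<forall>B\<in>Obj C. \<forall>f\<in>Hom C A B.
      Comp D (fobj F A) (fobj G A) (fobj G B) (fmor G A B f) (\<eta> A) =
      Comp D (fobj F A) (fobj F B) (fobj G B) (\<eta> B) (fmor F A B f))"

definition equivalent :: "('o, 'm) category \<Rightarrow> ('p, 'n) category \<Rightarrow> bool" where
  "equivalent C D \<longleftrightarrow> is_category C \<and> is_category D \<and>
    (\<exists>F G \<eta> \<epsilon>. is_functor C D F \<and> is_functor D C G \<and>
      natural_iso C C id_functor (comp_functor G F) \<eta> \<and>
      natural_iso D D (comp_functor F G) id_functor \<epsilon>)"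

definition dually_equivalent :: "('o, 'm) category \<Rightarrow> ('p, 'n) category \<Rightarrow> bool" where
  "dually_equivalent C D \<longleftrightarrow> equivalent (opposite C) D"


section \<open>Join-semilattices with bottom and distributive lattices\<close>

text \<open>Both kinds of structure are ordered sets in the sense of HOL-Algebra. Hence the forgetful
  functor from bounded distributive lattices to join-semilattices with bottom does not change
  the underlying record.\<close>

locale jsl = upper_semilattice L + weak_partial_order_bottom L for L :: "'a gorder" (structure)

locale bounded_distrib_lattice = bounded_lattice L for L :: "'a gorder" (structure) +
  assumes distrib: "\<lbrakk>x \<in> carrier L; y \<in> carrier L; z \<in> carrier L\<rbrakk> \<Longrightarrow>
    x \<sqinter> (y \<squnion> z) = (x \<sqinter> y) \<squnion> (x \<sqinter> z)"

sublocale bounded_distrib_lattice \<subseteq> jsl ..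

text \<open>Morphisms are extensional functions, so that they are equal as soon as they agree on the
  carrier.\<close>

definition jsl_hom :: "'a gorder \<Rightarrow> 'b gorder \<Rightarrow> ('a \<Rightarrow> 'b) set" where
  "jsl_hom A B = {h \<in> carrier A \<rightarrow>\<^sub>E carrier B. h \<bottom>\<^bsub>A\<^esub> = \<bottom>\<^bsub>B\<^esub> \<and>
    (\<forall>x\<in>carrier A. \<forall>y\<in>carrier A. h (x \<squnion>\<^bsub>A\<^esub> y) = h x \<squnion>\<^bsub>B\<^esub> h y)}"


section \<open>Tensor powers of join-semilattices\<close>

abbreviation tuples :: "'a set \<Rightarrow> nat \<Rightarrow> (nat \<Rightarrow> 'a) set" where
  "tuples S k \<equiv> {..<k} \<rightarrow>\<^sub>E S"

text \<open>The tensor power is presented by generators and relations: the free join-semilattice with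
  bottom on the \<open>k\<close>-tuples of elements of \<open>A\<close> is the semilattice of finite sets of such tuples
  under union, and one divides by the least congruence that makes the generators preserve finite
  joins in each argument.\<close>

inductive tensor_cong :: "'a gorder \<Rightarrow> nat \<Rightarrow> (nat \<Rightarrow> 'a) set \<Rightarrow> (nat \<Rightarrow> 'a) set \<Rightarrow> bool"
  for A k where
  refl: "S \<in> Fpow (tuples (carrier A) k) \<Longrightarrow> tensor_cong A k S S"
| sym: "tensor_cong A k S T \<Longrightarrow> tensor_cong A k T S"
| trans: "tensor_cong A k S T \<Longrightarrow> tensor_cong A k T R \<Longrightarrow> tensor_cong A k S R"
| union: "tensor_cong A k S T \<Longrightarrow> tensor_cong A k S' T' \<Longrightarrow> tensor_cong A k (S \<union> S') (T \<union> T')"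
| bottom: "t \<in> tuples (carrier A) k \<Longrightarrow> i < k \<Longrightarrow> tensor_cong A k {t(i := \<bottom>\<^bsub>A\<^esub>)} {}"
| join: "t \<in> tuples (carrier A) k \<Longrightarrow> i < k \<Longrightarrow> a \<in> carrier A \<Longrightarrow> b \<in> carrier A \<Longrightarrow>
    tensor_cong A k {t(i := a \<squnion>\<^bsub>A\<^esub> b)} {t(i := a), t(i := b)}"

type_synonym 'a tensor = "(nat \<Rightarrow> 'a) set set"

definition tensor_class :: "'a gorder \<Rightarrow> nat \<Rightarrow> (nat \<Rightarrow> 'a) set \<Rightarrow> 'a tensor" where
  "tensor_class A k S = {T. tensor_cong A k S T}"

definition tensor_power :: "'a gorder \<Rightarrow> nat \<Rightarrow> 'a tensor gorder" where
  "tensor_power A k = \<lparr>carrier = tensor_class A k ` Fpow (tuples (carrier A) k), eq = (=),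
    le = (\<lambda>c d. \<exists>S\<in>c. \<exists>T\<in>d. S \<union> T \<in> d)\<rparr>"

definition pure_tensor :: "'a gorder \<Rightarrow> nat \<Rightarrow> (nat \<Rightarrow> 'a) \<Rightarrow> 'a tensor" where
  "pure_tensor A k t = tensor_class A k {t}"

definition multi_hom :: "'a gorder \<Rightarrow> nat \<Rightarrow> 'b gorder \<Rightarrow> ((nat \<Rightarrow> 'a) \<Rightarrow> 'b) set" where
  "multi_hom A k B = {f \<in> tuples (carrier A) k \<rightarrow> carrier B.
    \<forall>t\<in>tuples (carrier A) k. \<forall>i<k. f (t(i := \<bottom>\<^bsub>A\<^esub>)) = \<bottom>\<^bsub>B\<^esub> \<and>
      (\<forall>a\<in>carrier A. \<forall>b\<in>carrier A. f (t(i := a \<squnion>\<^bsub>A\<^esub> b)) = f (t(i := a)) \<squnion>\<^bsub>B\<^esub> f (t(i := b)))}"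

text \<open>The map \<open>h\<^sup>\<otimes>\<^sup>k\<close> induced by a morphism \<open>h : A \<rightarrow> B\<close>. All classes in the union are equal.\<close>

definition tensor_map ::
    "'a gorder \<Rightarrow> 'b gorder \<Rightarrow> nat \<Rightarrow> ('a \<Rightarrow> 'b) \<Rightarrow> 'a tensor \<Rightarrow> 'b tensor" where
  "tensor_map A B k h = (\<lambda>c\<in>carrier (tensor_power A k).
    \<Union>S\<in>c. tensor_class B k ((\<lambda>t. \<lambda>i\<in>{..<k}. h (t i)) ` S))"

subsection \<open>The universal property of the tensor power\<close>

text \<open>No definition below depends on these facts. They confirm that the presentation above is
  the object representing maps that preserve finite joins in each argument, and that
  \<open>tensor_map\<close> is the map induced on it.\<close>

context jsl
begin

lemma tensor_cong_Fpow:
  assumes "tensor_cong L k S T"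
  shows "S \<in> Fpow (tuples (carrier L) k) \<and> T \<in> Fpow (tuples (carrier L) k)"
  using assms
proof induction
  case (bottom t i)
  then show ?case by (auto simp: Fpow_def PiE_iff extensional_def)
next
  case (join t i a b)
  then show ?case by (auto simp: Fpow_def PiE_iff extensional_def)
qed (auto simp: Fpow_def)

lemma tensor_class_eq_iff:
  assumes "S \<in> Fpow (tuples (carrier L) k)"
  shows "tensor_class L k S = tensor_class L k T \<longleftrightarrow> tensor_cong L k S T"
proof
  assume "tensor_class L k S = tensor_class L k T"
  moreover have "S \<in> tensor_class L k S"
    using assms by (simp add: tensor_class_def tensor_cong.refl)
  ultimately show "tensor_cong L k S T"
    by (auto simp: tensor_class_def intro: tensor_cong.sym)
next
  assume "tensor_cong L k S T"
  then show "tensor_class L k S = tensor_class L k T"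
    unfolding tensor_class_def by (blast intro: tensor_cong.sym tensor_cong.trans)
qed

lemma tensor_le_iff:
  assumes S: "S \<in> Fpow (tuples (carrier L) k)" and T: "T \<in> Fpow (tuples (carrier L) k)"
  shows "tensor_class L k S \<sqsubseteq>\<^bsub>tensor_power L k\<^esub> tensor_class L k T \<longleftrightarrow> tensor_cong L k (S \<union> T) T"
proof
  assume "tensor_class L k S \<sqsubseteq>\<^bsub>tensor_power L k\<^esub> tensor_class L k T"
  then obtain S' T' where "tensor_cong L k S S'" "tensor_cong L k T T'" "tensor_cong L k T (S' \<union> T')"
    by (auto simp: tensor_power_def tensor_class_def)
  then show "tensor_cong L k (S \<union> T) T"
    by (meson tensor_cong.sym tensor_cong.trans tensor_cong.union)
next
  assume "tensor_cong L k (S \<union> T) T"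
  then have "S \<in> tensor_class L k S" "T \<in> tensor_class L k T" "S \<union> T \<in> tensor_class L k T"
    using S T by (auto simp: tensor_class_def intro: tensor_cong.refl tensor_cong.sym)
  then show "tensor_class L k S \<sqsubseteq>\<^bsub>tensor_power L k\<^esub> tensor_class L k T"
    by (auto simp: tensor_power_def)
qed

lemma Fpow_Un: "S \<in> Fpow X \<Longrightarrow> T \<in> Fpow X \<Longrightarrow> S \<union> T \<in> Fpow X"
  by (auto simp: Fpow_def)

lemma tensor_class_carrier:
  "S \<in> Fpow (tuples (carrier L) k) \<Longrightarrow> tensor_class L k S \<in> carrier (tensor_power L k)"
  by (simp add: tensor_power_def)

lemma tensor_carrierE:
  assumes "c \<in> carrier (tensor_power L k)"
  obtains S where "S \<in> Fpow (tuples (carrier L) k)" "c = tensor_class L k S"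
  using assms by (auto simp: tensor_power_def)

lemma tensor_partial_order: "partial_order (tensor_power L k)"
proof
  fix x assume "x \<in> carrier (tensor_power L k)"
  then show "x \<sqsubseteq>\<^bsub>tensor_power L k\<^esub> x"
    by (elim tensor_carrierE) (simp add: tensor_le_iff tensor_cong.refl)
next
  fix x y assume "x \<sqsubseteq>\<^bsub>tensor_power L k\<^esub> y" "y \<sqsubseteq>\<^bsub>tensor_power L k\<^esub> x"
    "x \<in> carrier (tensor_power L k)" "y \<in> carrier (tensor_power L k)"
  then obtain S T where "S \<in> Fpow (tuples (carrier L) k)" "T \<in> Fpow (tuples (carrier L) k)"
    and xy: "x = tensor_class L k S" "y = tensor_class L k T"
    and "tensor_cong L k (S \<union> T) T" "tensor_cong L k (T \<union> S) S"
    by (metis tensor_carrierE tensor_le_iff)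
  then have "x = y"
    by (metis sup_commute tensor_class_eq_iff tensor_cong.sym tensor_cong.trans)
  then show "x .=\<^bsub>tensor_power L k\<^esub> y" by (simp add: tensor_power_def)
next
  fix x y z assume "x \<sqsubseteq>\<^bsub>tensor_power L k\<^esub> y" "y \<sqsubseteq>\<^bsub>tensor_power L k\<^esub> z"
    "x \<in> carrier (tensor_power L k)" "y \<in> carrier (tensor_power L k)" "z \<in> carrier (tensor_power L k)"
  then obtain S T R where F: "S \<in> Fpow (tuples (carrier L) k)" "T \<in> Fpow (tuples (carrier L) k)"
      "R \<in> Fpow (tuples (carrier L) k)"
    and xy: "x = tensor_class L k S" "z = tensor_class L k R"
    and ST: "tensor_cong L k (S \<union> T) T" and TR: "tensor_cong L k (T \<union> R) R"
    by (metis tensor_carrierE tensor_le_iff)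
  have "tensor_cong L k (S \<union> (T \<union> R)) (T \<union> R)"
    using tensor_cong.union[OF ST tensor_cong.refl[OF F(3)]] by (simp add: Un_assoc)
  moreover have "tensor_cong L k (S \<union> (T \<union> R)) (S \<union> R)"
    by (rule tensor_cong.union[OF tensor_cong.refl[OF F(1)] TR])
  ultimately have "tensor_cong L k (S \<union> R) R"
    using TR by (meson tensor_cong.sym tensor_cong.trans)
  then show "x \<sqsubseteq>\<^bsub>tensor_power L k\<^esub> z" using F xy by (simp add: tensor_le_iff)
qed (simp_all add: tensor_power_def)

lemma tensor_lub:
  assumes S: "S \<in> Fpow (tuples (carrier L) k)" and T: "T \<in> Fpow (tuples (carrier L) k)"
  shows "least (tensor_power L k) (tensor_class L k (S \<union> T))
    (Upper (tensor_power L k) {tensor_class L k S, tensor_class L k T})"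
proof -
  have ST: "S \<union> T \<in> Fpow (tuples (carrier L) k)" using S T by (rule Fpow_Un)
  have le: "tensor_class L k S \<sqsubseteq>\<^bsub>tensor_power L k\<^esub> tensor_class L k (S \<union> T)"
    "tensor_class L k T \<sqsubseteq>\<^bsub>tensor_power L k\<^esub> tensor_class L k (S \<union> T)"
    using ST S T by (simp_all add: tensor_le_iff tensor_cong.refl sup.left_commute sup.left_idem)
  have "tensor_class L k (S \<union> T) \<sqsubseteq>\<^bsub>tensor_power L k\<^esub> d"
    if d: "d \<in> carrier (tensor_power L k)" "tensor_class L k S \<sqsubseteq>\<^bsub>tensor_power L k\<^esub> d"
      "tensor_class L k T \<sqsubseteq>\<^bsub>tensor_power L k\<^esub> d" for d
  proof -
    obtain R where R: "R \<in> Fpow (tuples (carrier L) k)" "d = tensor_class L k R"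
      using tensor_carrierE[OF d(1)] by blast
    then have 1: "tensor_cong L k (S \<union> R) R" and 2: "tensor_cong L k (T \<union> R) R"
      using d S T by (simp_all add: tensor_le_iff)
    have "tensor_cong L k (S \<union> (T \<union> R)) (S \<union> R)"
      by (rule tensor_cong.union[OF tensor_cong.refl[OF S] 2])
    then have "tensor_cong L k (S \<union> T \<union> R) R"
      using 1 by (metis Un_assoc tensor_cong.trans)
    then show ?thesis using R ST by (simp add: tensor_le_iff)
  qed
  then show ?thesis
    using le ST S T by (auto simp: least_def Upper_def tensor_class_carrier)
qed

lemma tensor_least:
  "least (tensor_power L k) (tensor_class L k {}) (carrier (tensor_power L k))"
proof -
  have "{} \<in> Fpow (tuples (carrier L) k)" by (simp add: empty_in_Fpow)
  then show ?thesis
    by (auto simp: least_def tensor_class_carrier tensor_le_iff tensor_cong.refl elim!: tensor_carrierE)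
qed

lemma tensor_jsl: "jsl (tensor_power L k)"
proof -
  interpret T: partial_order "tensor_power L k" by (rule tensor_partial_order)
  show ?thesis
    by unfold_locales (metis tensor_carrierE tensor_lub, metis tensor_least)
qed

lemma tensor_join:
  assumes "S \<in> Fpow (tuples (carrier L) k)" "T \<in> Fpow (tuples (carrier L) k)"
  shows "tensor_class L k S \<squnion>\<^bsub>tensor_power L k\<^esub> tensor_class L k T = tensor_class L k (S \<union> T)"
proof -
  interpret T: jsl "tensor_power L k" by (rule tensor_jsl)
  show ?thesis
  proof (rule T.joinI)
    fix l assume "least (tensor_power L k) l
      (Upper (tensor_power L k) {tensor_class L k S, tensor_class L k T})"
    then show "l = tensor_class L k (S \<union> T)"
      by (rule T.least_unique[OF _ tensor_lub[OF assms]])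
  qed (use assms in \<open>auto intro: tensor_class_carrier\<close>)
qed

lemma tensor_bottom: "\<bottom>\<^bsub>tensor_power L k\<^esub> = tensor_class L k {}"
proof -
  interpret T: jsl "tensor_power L k" by (rule tensor_jsl)
  show ?thesis by (rule T.least_unique[OF T.bottom_least tensor_least])
qed

lemma pure_tensor_multi_hom: "pure_tensor L k \<in> multi_hom L k (tensor_power L k)"
proof -
  have upd: "t(i := a) \<in> tuples (carrier L) k"
    if "t \<in> tuples (carrier L) k" "i < k" "a \<in> carrier L" for t i a
    using that by (auto simp: PiE_iff extensional_def)
  have sing: "{t} \<in> Fpow (tuples (carrier L) k)" if "t \<in> tuples (carrier L) k" for t
    using that by (simp add: Fpow_def)
  have "tensor_class L k {t(i := \<bottom>)} = \<bottom>\<^bsub>tensor_power L k\<^esub>"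
    if "t \<in> tuples (carrier L) k" "i < k" for t i
    unfolding tensor_bottom using tensor_cong.bottom[OF that] sing[OF upd[OF that]]
    by (simp add: tensor_class_eq_iff)
  moreover have "tensor_class L k {t(i := a \<squnion> b)} =
      tensor_class L k {t(i := a)} \<squnion>\<^bsub>tensor_power L k\<^esub> tensor_class L k {t(i := b)}"
    if "t \<in> tuples (carrier L) k" "i < k" "a \<in> carrier L" "b \<in> carrier L" for t i a b
  proof -
    have "tensor_class L k {t(i := a \<squnion> b)} = tensor_class L k {t(i := a), t(i := b)}"
      using tensor_cong.join[OF that] tensor_cong_Fpow tensor_class_eq_iff by blast
    also have "{t(i := a), t(i := b)} = {t(i := a)} \<union> {t(i := b)}" by blast
    finally show ?thesis
      using sing[OF upd[OF that(1,2,3)]] sing[OF upd[OF that(1,2,4)]] by (simp only: tensor_join)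
  qed
  ultimately show ?thesis
    unfolding multi_hom_def pure_tensor_def by (auto intro: tensor_class_carrier sing)
qed

theorem tensor_power_universal:
  assumes B: "jsl B" and f: "f \<in> multi_hom L k B"
  shows "\<exists>!g. g \<in> jsl_hom (tensor_power L k) B \<and>
    (\<forall>t\<in>tuples (carrier L) k. g (pure_tensor L k t) = f t)"
proof -
  interpret B: jsl B by (rule B)
  have fB: "f t \<in> carrier B" if "t \<in> tuples (carrier L) k" for t
    using f that by (auto simp: multi_hom_def)
  have upd: "t(i := a) \<in> tuples (carrier L) k"
    if "t \<in> tuples (carrier L) k" "i < k" "a \<in> carrier L" for t i a
    using that by (auto simp: PiE_iff extensional_def)
  have B_join_iff: "x \<squnion>\<^bsub>B\<^esub> y \<sqsubseteq>\<^bsub>B\<^esub> b \<longleftrightarrow> x \<sqsubseteq>\<^bsub>B\<^esub> b \<and> y \<sqsubseteq>\<^bsub>B\<^esub> b"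
    if "x \<in> carrier B" "y \<in> carrier B" "b \<in> carrier B" for x y b
    using that B.join_le B.join_left B.join_right B.join_closed B.le_trans by metis
  have ub: "(\<forall>s\<in>S. f s \<sqsubseteq>\<^bsub>B\<^esub> b) \<longleftrightarrow> (\<forall>t\<in>T. f t \<sqsubseteq>\<^bsub>B\<^esub> b)"
    if "tensor_cong L k S T" "b \<in> carrier B" for S T b
    using that
  proof induction
    case (bottom t i)
    then have "f (t(i := \<bottom>)) = \<bottom>\<^bsub>B\<^esub>" using f by (simp add: multi_hom_def)
    then show ?case using bottom.prems by (simp del: fun_upd_apply)
  next
    case (join t i a c)
    then have *: "f (t(i := a \<squnion> c)) = f (t(i := a)) \<squnion>\<^bsub>B\<^esub> f (t(i := c))"
      using f by (simp add: multi_hom_def)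
    have "f (t(i := a)) \<in> carrier B" "f (t(i := c)) \<in> carrier B"
      using join.hyps by (simp_all only: fB upd)
    then show ?case
      using join.prems by (simp add: * B_join_iff del: fun_upd_apply)
  qed auto
  have lub: "\<exists>b. least B b (Upper B (f ` S))" if "S \<in> Fpow (tuples (carrier L) k)" for S
  proof -
    have fin: "finite (f ` S)" "f ` S \<subseteq> carrier B" using that fB by (auto simp: Fpow_def)
    show ?thesis
    proof (cases "S = {}")
      case True
      then show ?thesis using B.bottom_least by (auto simp: Upper_def least_def)
    next
      case False
      then show ?thesis using B.finite_sup_least[OF fin] by auto
    qed
  qed
  define G where "G S = \<Squnion>\<^bsub>B\<^esub> (f ` S)" for S
  have G: "least B (G S) (Upper B (f ` S))" if "S \<in> Fpow (tuples (carrier L) k)" for S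
    unfolding G_def Lattice.sup_def by (rule someI_ex[OF lub[OF that]])
  have Gc: "G S \<in> carrier B" if "S \<in> Fpow (tuples (carrier L) k)" for S
    using G[OF that] by (auto simp: least_def Upper_def)
  have Gle: "G S \<sqsubseteq>\<^bsub>B\<^esub> b \<longleftrightarrow> (\<forall>s\<in>S. f s \<sqsubseteq>\<^bsub>B\<^esub> b)"
    if S: "S \<in> Fpow (tuples (carrier L) k)" and b: "b \<in> carrier B" for S b
  proof
    assume "\<forall>s\<in>S. f s \<sqsubseteq>\<^bsub>B\<^esub> b"
    then show "G S \<sqsubseteq>\<^bsub>B\<^esub> b" using G[OF S] b by (auto simp: least_def Upper_def)
  next
    assume *: "G S \<sqsubseteq>\<^bsub>B\<^esub> b"
    show "\<forall>s\<in>S. f s \<sqsubseteq>\<^bsub>B\<^esub> b"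
    proof
      fix s assume s: "s \<in> S"
      then have fs: "f s \<in> carrier B" using S fB by (auto simp: Fpow_def)
      moreover from this have "f s \<sqsubseteq>\<^bsub>B\<^esub> G S" using G[OF S] s by (auto simp: least_def Upper_def)
      ultimately show "f s \<sqsubseteq>\<^bsub>B\<^esub> b" using * b Gc[OF S] B.le_trans by blast
    qed
  qed
  have Geq: "G S = x" if "S \<in> Fpow (tuples (carrier L) k)" "x \<in> carrier B"
    "\<And>b. b \<in> carrier B \<Longrightarrow> (\<forall>s\<in>S. f s \<sqsubseteq>\<^bsub>B\<^esub> b) \<longleftrightarrow> x \<sqsubseteq>\<^bsub>B\<^esub> b" for S x
    using that Gle Gc by (metis B.le_antisym B.le_refl)
  have Gcong: "G S = G T" if "tensor_cong L k S T" for S T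
    using that tensor_cong_Fpow[OF that] by (intro Geq) (auto simp: Gle Gc ub)
  define g where "g = (\<lambda>c\<in>carrier (tensor_power L k). G (SOME S. S \<in> c))"
  have gG: "g (tensor_class L k S) = G S" if S: "S \<in> Fpow (tuples (carrier L) k)" for S
  proof -
    have "S \<in> tensor_class L k S" using S by (simp add: tensor_class_def tensor_cong.refl)
    then have "(SOME T. T \<in> tensor_class L k S) \<in> tensor_class L k S" by (rule someI)
    then have "G S = G (SOME T. T \<in> tensor_class L k S)"
      by (intro Gcong) (simp add: tensor_class_def)
    then show ?thesis using S by (simp add: g_def tensor_class_carrier)
  qed
  have Gun: "G (S \<union> T) = G S \<squnion>\<^bsub>B\<^esub> G T"
    if S: "S \<in> Fpow (tuples (carrier L) k)" and T: "T \<in> Fpow (tuples (carrier L) k)" for S T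
  proof (rule Geq)
    fix b assume b: "b \<in> carrier B"
    show "(\<forall>s\<in>S \<union> T. f s \<sqsubseteq>\<^bsub>B\<^esub> b) \<longleftrightarrow> G S \<squnion>\<^bsub>B\<^esub> G T \<sqsubseteq>\<^bsub>B\<^esub> b"
      by (simp only: ball_Un B_join_iff[OF Gc[OF S] Gc[OF T] b] Gle[OF S b] Gle[OF T b])
  next
    show "S \<union> T \<in> Fpow (tuples (carrier L) k)" using S T by (rule Fpow_Un)
    show "G S \<squnion>\<^bsub>B\<^esub> G T \<in> carrier B" using Gc[OF S] Gc[OF T] by (rule B.join_closed)
  qed
  have Gpure: "G {t} = f t" if "t \<in> tuples (carrier L) k" for t
    using that fB by (intro Geq) (auto simp: Fpow_def)
  have Gbot: "G {} = \<bottom>\<^bsub>B\<^esub>"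
    by (intro Geq) (auto simp: empty_in_Fpow)
  have ghom: "g \<in> jsl_hom (tensor_power L k) B"
    unfolding jsl_hom_def mem_Collect_eq
  proof (intro conjI ballI)
    show "g \<in> carrier (tensor_power L k) \<rightarrow>\<^sub>E carrier B"
    proof (rule PiE_I)
      fix c assume "c \<in> carrier (tensor_power L k)"
      then show "g c \<in> carrier B" by (elim tensor_carrierE) (simp add: gG Gc)
    qed (simp add: g_def)
    show "g \<bottom>\<^bsub>tensor_power L k\<^esub> = \<bottom>\<^bsub>B\<^esub>"
      by (simp add: tensor_bottom gG Gbot empty_in_Fpow)
    fix c d assume "c \<in> carrier (tensor_power L k)" "d \<in> carrier (tensor_power L k)"
    then show "g (c \<squnion>\<^bsub>tensor_power L k\<^esub> d) = g c \<squnion>\<^bsub>B\<^esub> g d"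
      by (elim tensor_carrierE) (simp add: tensor_join gG Gun Fpow_Un)
  qed
  have gpure: "\<forall>t\<in>tuples (carrier L) k. g (pure_tensor L k t) = f t"
    using Gpure by (auto simp: pure_tensor_def gG Fpow_def)
  have uniq: "g' = g" if g': "g' \<in> jsl_hom (tensor_power L k) B"
    and p: "\<forall>t\<in>tuples (carrier L) k. g' (pure_tensor L k t) = f t" for g'
  proof -
    have "g' (tensor_class L k S) = G S" if "finite S" "S \<subseteq> tuples (carrier L) k" for S
      using that
    proof induction
      case empty
      then show ?case using g' by (simp add: jsl_hom_def tensor_bottom Gbot)
    next
      case (insert t S)
      then have F: "{t} \<in> Fpow (tuples (carrier L) k)" "S \<in> Fpow (tuples (carrier L) k)"
        by (auto simp: Fpow_def)
      have "g' (tensor_class L k {t} \<squnion>\<^bsub>tensor_power L k\<^esub> tensor_class L k S) =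
          g' (tensor_class L k {t}) \<squnion>\<^bsub>B\<^esub> g' (tensor_class L k S)"
        using g' F by (simp add: jsl_hom_def tensor_class_carrier)
      moreover have "g' (tensor_class L k {t}) = G {t}"
        using insert.prems p Gpure by (simp add: pure_tensor_def)
      ultimately have "g' (tensor_class L k ({t} \<union> S)) = G {t} \<squnion>\<^bsub>B\<^esub> G S"
        using insert F by (simp add: tensor_join)
      then show ?case using Gun[OF F] by simp
    qed
    then have "g' c = g c" if "c \<in> carrier (tensor_power L k)" for c
      using that by (elim tensor_carrierE) (auto simp: gG Fpow_def)
    moreover have "g \<in> extensional (carrier (tensor_power L k))"
      "g' \<in> extensional (carrier (tensor_power L k))"
      using g' ghom by (auto simp: jsl_hom_def PiE_iff)
    ultimately show ?thesis by (meson extensionalityI)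
  qed
  show ?thesis
    by (rule ex1I[of _ g], rule conjI[OF ghom gpure], elim conjE, rule uniq)
qed

lemma tensor_map_class:
  assumes B: "jsl B" and h: "h \<in> jsl_hom L B" and S: "S \<in> Fpow (tuples (carrier L) k)"
  shows "tensor_map L B k h (tensor_class L k S) =
    tensor_class B k ((\<lambda>t. \<lambda>i\<in>{..<k}. h (t i)) ` S)"
proof -
  interpret B: jsl B by (rule B)
  let ?h = "\<lambda>t. \<lambda>i\<in>{..<k}. h (t i)"
  have hc: "h x \<in> carrier B" if "x \<in> carrier L" for x using h that by (auto simp: jsl_hom_def)
  have upd: "?h (t(i := a)) = (?h t)(i := h a)" if "i < k" for t i a
    using that by (auto simp: fun_eq_iff)
  have tup: "?h t \<in> tuples (carrier B) k" if "t \<in> tuples (carrier L) k" for t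
    using that hc by (auto simp: PiE_iff)
  have cong: "tensor_cong B k (?h ` S) (?h ` T)" if "tensor_cong L k S T" for S T
    using that
  proof induction
    case (refl S)
    then have S: "S \<subseteq> tuples (carrier L) k" and "finite S" by (auto simp: Fpow_def)
    moreover have "?h ` S \<subseteq> tuples (carrier B) k"
      by (rule image_subsetI, rule tup, rule subsetD[OF S])
    ultimately show ?case by (intro tensor_cong.refl) (simp add: Fpow_def del: restrict_apply)
  next
    case (bottom t i)
    have "h \<bottom> = \<bottom>\<^bsub>B\<^esub>" using h by (simp add: jsl_hom_def)
    then show ?case
      using tensor_cong.bottom[OF tup[OF bottom(1)] bottom(2)]
      by (simp only: image_insert image_empty upd[OF bottom(2)])
  next
    case (join t i a b)
    have "h (a \<squnion> b) = h a \<squnion>\<^bsub>B\<^esub> h b" using h join by (simp add: jsl_hom_def)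
    then show ?case
      using tensor_cong.join[OF tup[OF join(1)] join(2) hc[OF join(3)] hc[OF join(4)]]
      by (simp only: image_insert image_empty upd[OF join(2)])
  qed (simp_all only: image_Un, (blast intro: tensor_cong.sym tensor_cong.trans tensor_cong.union)+)
  have "S \<in> tensor_class L k S" using S by (simp add: tensor_class_def tensor_cong.refl)
  moreover have "tensor_class B k (?h ` T) = tensor_class B k (?h ` S)"
    if "T \<in> tensor_class L k S" for T
  proof -
    have "tensor_cong B k (?h ` S) (?h ` T)" using that cong by (simp add: tensor_class_def)
    moreover from this have "?h ` S \<in> Fpow (tuples (carrier B) k)" using B.tensor_cong_Fpow by blast
    ultimately show ?thesis using B.tensor_class_eq_iff by blast
  qed
  ultimately have "(\<Union>T\<in>tensor_class L k S. tensor_class B k (?h ` T)) = tensor_class B k (?h ` S)"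
    by blast
  then show ?thesis using S by (simp add: tensor_map_def tensor_class_carrier)
qed

end


section \<open>The category of U-operators\<close>

type_synonym 'a operator = "'a gorder \<times> ('a tensor \<Rightarrow> 'a tensor)"

definition U_operators :: "nat \<Rightarrow> nat \<Rightarrow> 'a operator set" where
  "U_operators k n = {(A, a). bounded_distrib_lattice A \<and>
    a \<in> jsl_hom (tensor_power A k) (tensor_power A n)}"

definition operator_hom :: "nat \<Rightarrow> nat \<Rightarrow> 'a operator \<Rightarrow> 'a operator \<Rightarrow> ('a \<Rightarrow> 'a) set" where
  "operator_hom k n = (\<lambda>(A, a) (B, b). {h \<in> jsl_hom A B.
    \<forall>c\<in>carrier (tensor_power A k). tensor_map A B n h (a c) = b (tensor_map A B k h c)})"

definition Op_U :: "nat \<Rightarrow> nat \<Rightarrow> ('a operator, 'a \<Rightarrow> 'a) category" where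
  "Op_U k n = \<lparr>Obj = U_operators k n, Hom = operator_hom k n,
    Ident = (\<lambda>(A, a). \<lambda>x\<in>carrier A. x),
    Comp = (\<lambda>(A, a) _ _ g f. compose (carrier A) g f)\<rparr>"


section \<open>Priestley spaces and Priestley relations\<close>

record 'a ordered_space =
  topo :: "'a topology"
  ord_rel :: "'a rel"

abbreviation points :: "'a ordered_space \<Rightarrow> 'a set" where
  "points X \<equiv> topspace (topo X)"

definition is_upset :: "'a ordered_space \<Rightarrow> 'a set \<Rightarrow> bool" where
  "is_upset X W \<longleftrightarrow> W \<subseteq> points X \<and> (\<forall>x\<in>W. \<forall>y\<in>points X. (x, y) \<in> ord_rel X \<longrightarrow> y \<in> W)"

definition is_downset :: "'a ordered_space \<Rightarrow> 'a set \<Rightarrow> bool" where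
  "is_downset X W \<longleftrightarrow> W \<subseteq> points X \<and> (\<forall>x\<in>W. \<forall>y\<in>points X. (y, x) \<in> ord_rel X \<longrightarrow> y \<in> W)"

definition clopen_upsets :: "'a ordered_space \<Rightarrow> 'a set set" where
  "clopen_upsets X = {W. openin (topo X) W \<and> closedin (topo X) W \<and> is_upset X W}"

definition priestley_space :: "'a ordered_space \<Rightarrow> bool" where
  "priestley_space X \<longleftrightarrow> compact_space (topo X) \<and>
    partial_order_on (points X) (ord_rel X) \<and>
    (\<forall>x\<in>points X. \<forall>y\<in>points X. (x, y) \<notin> ord_rel X \<longrightarrow> (\<exists>W\<in>clopen_upsets X. x \<in> W \<and> y \<notin> W))"

definition space_power :: "'a ordered_space \<Rightarrow> nat \<Rightarrow> (nat \<Rightarrow> 'a) ordered_space" where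
  "space_power X n = \<lparr>topo = product_topology (\<lambda>_. topo X) {..<n},
    ord_rel = {(x, y). x \<in> tuples (points X) n \<and> y \<in> tuples (points X) n \<and>
      (\<forall>i<n. (x i, y i) \<in> ord_rel X)}\<rparr>"

definition closed_downsets :: "'a ordered_space \<Rightarrow> 'a set set" where
  "closed_downsets X = {A. closedin (topo X) A \<and> is_downset X A}"

definition V_down :: "'a ordered_space \<Rightarrow> 'a set ordered_space" where
  "V_down X = \<lparr>topo = topology_generated_by
      ((\<lambda>W. {A \<in> closed_downsets X. A \<inter> W \<noteq> {}}) ` clopen_upsets X \<union>
       (\<lambda>W. {A \<in> closed_downsets X. A \<inter> W = {}}) ` clopen_upsets X),
    ord_rel = {(A, B). A \<in> closed_downsets X \<and> B \<in> closed_downsets X \<and> A \<subseteq> B}\<rparr>"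

lemma points_space_power: "points (space_power X n) = tuples (points X) n"
  by (simp add: space_power_def)

lemma points_V_down: "points (V_down X) = closed_downsets X"
proof -
  have "{} \<in> clopen_upsets X" by (simp add: clopen_upsets_def is_upset_def)
  then show ?thesis by (auto simp: V_down_def)
qed

definition priestley_relations :: "'a ordered_space \<Rightarrow> 'b ordered_space \<Rightarrow> ('a \<Rightarrow> 'b set) set" where
  "priestley_relations X Y = {\<rho> \<in> extensional (points X).
    continuous_map (topo X) (topo (V_down Y)) \<rho> \<and>
    (\<forall>x\<in>points X. \<forall>x'\<in>points X. (x, x') \<in> ord_rel X \<longrightarrow> (\<rho> x, \<rho> x') \<in> ord_rel (V_down Y))}"


section \<open>The category of relational Priestley spaces\<close>

type_synonym 'a relational_space = "'a ordered_space \<times> ((nat \<Rightarrow> 'a) \<Rightarrow> (nat \<Rightarrow> 'a) set)"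

definition relational_priestley_spaces :: "nat \<Rightarrow> nat \<Rightarrow> 'a relational_space set" where
  "relational_priestley_spaces n k = {(X, \<rho>). priestley_space X \<and>
    \<rho> \<in> priestley_relations (space_power X n) (space_power X k)}"

definition relational_morphisms ::
    "nat \<Rightarrow> nat \<Rightarrow> 'a relational_space \<Rightarrow> 'a relational_space \<Rightarrow> ('a \<Rightarrow> 'a set) set" where
  "relational_morphisms n k = (\<lambda>(X, \<rho>) (X', \<rho>'). {\<beta> \<in> priestley_relations X X'.
    (\<forall>x\<in>tuples (points X) n. \<forall>y\<in>tuples (points X) k. \<forall>y'\<in>tuples (points X') k.
      y \<in> \<rho> x \<and> (\<forall>i<k. y' i \<in> \<beta> (y i)) \<longrightarrow>
      (\<exists>x'\<in>tuples (points X') n. (\<forall>i<n. x' i \<in> \<beta> (x i)) \<and> y' \<in> \<rho>' x')) \<and>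
    (\<forall>x\<in>tuples (points X) n. \<forall>x'\<in>tuples (points X') n. \<forall>y'\<in>tuples (points X') k.
      (\<forall>i<n. x' i \<in> \<beta> (x i)) \<and> y' \<in> \<rho>' x' \<longrightarrow>
      (\<exists>y\<in>tuples (points X) k. y \<in> \<rho> x \<and> (\<forall>i<k. y' i \<in> \<beta> (y i))))})"

definition Rel_Priestley :: "nat \<Rightarrow> nat \<Rightarrow> ('a relational_space, 'a \<Rightarrow> 'a set) category" where
  "Rel_Priestley n k = \<lparr>Obj = relational_priestley_spaces n k, Hom = relational_morphisms n k,
    Ident = (\<lambda>(X, \<rho>). \<lambda>x\<in>points X. {y \<in> points X. (y, x) \<in> ord_rel X}),
    Comp = (\<lambda>(X, \<rho>) _ _ \<gamma> \<beta>. \<lambda>x\<in>points X. \<Union>y\<in>\<beta> x. \<gamma> y)\<rparr>"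


section \<open>Prime filters\<close>

text \<open>Prime filters only serve to bound the size of the dual space of a lattice.
  A type cannot contain all bounded distributive lattices together with all Priestley spaces: the
  dual space of a lattice over \<open>'a\<close> has points in \<open>'a set\<close>, and the dual lattice of a space over
  \<open>'a\<close> has elements in \<open>'a set\<close>. Therefore the categories above are taken over an arbitrary type
  of points, and a duality between them has to say which objects fit into the type on the other
  side: spaces over \<open>'a set\<close> with at most \<open>|'a|\<close> clopen upsets, when all lattices over \<open>'a\<close> are
  considered, and lattices over \<open>'a set\<close> with at most \<open>|'a|\<close> prime filters, when all spaces
  over \<open>'a\<close> are considered. If the cardinality of \<open>'a\<close> is a strong limit, then the sets of
  smaller cardinality are closed under power sets, and the small structures over \<open>'a\<close> on both
  sides correspond to each other.\<close>

definition prime_filters :: "'a gorder \<Rightarrow> 'a set set" where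
  "prime_filters A = {F. F \<subseteq> carrier A \<and> \<top>\<^bsub>A\<^esub> \<in> F \<and> \<bottom>\<^bsub>A\<^esub> \<notin> F \<and>
    (\<forall>x\<in>carrier A. \<forall>y\<in>carrier A. (x \<sqinter>\<^bsub>A\<^esub> y \<in> F \<longleftrightarrow> x \<in> F \<and> y \<in> F) \<and>
      (x \<squnion>\<^bsub>A\<^esub> y \<in> F \<longleftrightarrow> x \<in> F \<or> y \<in> F))}"

end

theory Submission
  imports Defs
begin

text \<open>A distributive lattice is the lattice of clopen upsets of a Priestley space \<open>X\<close>, and join-preserving
  maps \<open>h : A \<rightarrow> B\<close> correspond to Priestley relations \<open>\<beta> : Y \<rightarrow> V\<down> X\<close> through
  \<open>\<psi> (h a) = {y. \<beta> y \<inter> \<phi> a \<noteq> {}}\<close>. The tensor power \<open>A\<^sup>\<otimes>\<^sup>k\<close> is again such a lattice: its elements are the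
  finite unions of boxes of clopen upsets, which are exactly the clopen upsets of \<open>X\<^sup>k\<close>. Hence the
  operations \<open>A\<^sup>\<otimes>\<^sup>k \<rightarrow> A\<^sup>\<otimes>\<^sup>n\<close> correspond to the Priestley relations \<open>X\<^sup>n \<rightarrow> V\<down> X\<^sup>k\<close>, \<open>h\<^sup>\<otimes>\<^sup>k\<close> corresponds to
  the product relation \<open>\<beta>\<^sup>k\<close>, and the homomorphism equation says that two composites of
  relations agree; its two inclusions are the two conditions on a relational morphism.\<close>

section \<open>Equivalences from correspondences\<close>

text \<open>The tensor power is presented by a congruence, so the hard point is that two finite sets
  of tuples with the same union of boxes are congruent: an inclusion of sets has to yield a
  derivation from the bottom and join relations. It is obtained contrapositively: if no derivation
  exists, a point of the smaller set is constructed that the larger set misses. After that, a tensor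
  power with a power of the space is one more instance of the pairing of \<open>A\<close> with
  \<open>X\<close>, and the correspondence proved for \<open>h\<close> also serves the operators.
  Statements about morphisms are phrased by \<open>represents\<close> and settled by uniqueness:
  identities, composites and the homomorphism equation are compared through the relations that
  represent them. No dual space is fixed in this part; a lattice is paired with any space through
  any suitable \<open>\<phi>\<close>. Size enters only when such partners have to exist, as the
  prime filter space of a lattice or as a coded lattice of clopen upsets of a space.\<close>

lemma is_categoryD:
  assumes C: "is_category C"
  shows "A \<in> Obj C \<Longrightarrow> Ident C A \<in> Hom C A A"
    and "A \<in> Obj C \<Longrightarrow> B \<in> Obj C \<Longrightarrow> E \<in> Obj C \<Longrightarrow> f \<in> Hom C A B \<Longrightarrow> g \<in> Hom C B E \<Longrightarrow>
      Comp C A B E g f \<in> Hom C A E"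
    and "A \<in> Obj C \<Longrightarrow> B \<in> Obj C \<Longrightarrow> f \<in> Hom C A B \<Longrightarrow> Comp C A A B f (Ident C A) = f"
    and "A \<in> Obj C \<Longrightarrow> B \<in> Obj C \<Longrightarrow> f \<in> Hom C A B \<Longrightarrow> Comp C A B B (Ident C B) f = f"
    and "A \<in> Obj C \<Longrightarrow> B \<in> Obj C \<Longrightarrow> E \<in> Obj C \<Longrightarrow> F \<in> Obj C \<Longrightarrow>
      f \<in> Hom C A B \<Longrightarrow> g \<in> Hom C B E \<Longrightarrow> h \<in> Hom C E F \<Longrightarrow>
      Comp C A E F h (Comp C A B E g f) = Comp C A B F (Comp C B E F h g) f"
proof -
  note C = C[unfolded is_category_def]
  note C2 = C[THEN conjunct2] note C3 = C2[THEN conjunct2] note C4 = C3[THEN conjunct2]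
  note R = C[THEN conjunct1, rule_format] C2[THEN conjunct1, rule_format]
    C3[THEN conjunct1, rule_format] C4[rule_format]
  show "A \<in> Obj C \<Longrightarrow> Ident C A \<in> Hom C A A" by (rule R)
  show "A \<in> Obj C \<Longrightarrow> B \<in> Obj C \<Longrightarrow> E \<in> Obj C \<Longrightarrow> f \<in> Hom C A B \<Longrightarrow> g \<in> Hom C B E \<Longrightarrow>
      Comp C A B E g f \<in> Hom C A E" by (rule R)
  show "A \<in> Obj C \<Longrightarrow> B \<in> Obj C \<Longrightarrow> f \<in> Hom C A B \<Longrightarrow> Comp C A A B f (Ident C A) = f"
    by (rule R(3)[THEN conjunct1])
  show "A \<in> Obj C \<Longrightarrow> B \<in> Obj C \<Longrightarrow> f \<in> Hom C A B \<Longrightarrow> Comp C A B B (Ident C B) f = f"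
    by (rule R(3)[THEN conjunct2])
  show "A \<in> Obj C \<Longrightarrow> B \<in> Obj C \<Longrightarrow> E \<in> Obj C \<Longrightarrow> F \<in> Obj C \<Longrightarrow>
      f \<in> Hom C A B \<Longrightarrow> g \<in> Hom C B E \<Longrightarrow> h \<in> Hom C E F \<Longrightarrow>
      Comp C A E F h (Comp C A B E g f) = Comp C A B F (Comp C B E F h g) f"
    by (rule R(4))
qed

text \<open>The categories live over different types in each part of the theorem, so no single pair of
  functors serves all of them. The set \<open>W\<close> of matching pairs of objects does.\<close>

locale hom_correspondence =
  fixes C :: "('o, 'm) category" and D :: "('p, 'n) category"
    and W :: "'w set" and c :: "'w \<Rightarrow> 'o" and d :: "'w \<Rightarrow> 'p" and T :: "'w \<Rightarrow> 'w \<Rightarrow> 'm \<Rightarrow> 'n"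
  assumes C: "is_category C"
    and c_onto: "c ` W = Obj C" and d_onto: "d ` W = Obj D"
    and T_bij: "\<And>w w'. w \<in> W \<Longrightarrow> w' \<in> W \<Longrightarrow>
      bij_betw (T w w') (Hom C (c w) (c w')) (Hom D (d w) (d w'))"
    and T_ident: "\<And>w. w \<in> W \<Longrightarrow> T w w (Ident C (c w)) = Ident D (d w)"
    and T_comp: "\<And>w w' w'' f g. w \<in> W \<Longrightarrow> w' \<in> W \<Longrightarrow> w'' \<in> W \<Longrightarrow>
      f \<in> Hom C (c w) (c w') \<Longrightarrow> g \<in> Hom C (c w') (c w'') \<Longrightarrow>
      T w w'' (Comp C (c w) (c w') (c w'') g f) =
      Comp D (d w) (d w') (d w'') (T w' w'' g) (T w w' f)"
begin

definition Ti where "Ti w w' = inv_into (Hom C (c w) (c w')) (T w w')"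

lemma T_hom: "w \<in> W \<Longrightarrow> w' \<in> W \<Longrightarrow> f \<in> Hom C (c w) (c w') \<Longrightarrow> T w w' f \<in> Hom D (d w) (d w')"
  using T_bij by (auto simp: bij_betw_def)

lemma T_inj: "w \<in> W \<Longrightarrow> w' \<in> W \<Longrightarrow> f \<in> Hom C (c w) (c w') \<Longrightarrow> g \<in> Hom C (c w) (c w') \<Longrightarrow>
    T w w' f = T w w' g \<longleftrightarrow> f = g"
  using T_bij by (auto simp: bij_betw_def inj_on_def)

lemma Ti_hom: "w \<in> W \<Longrightarrow> w' \<in> W \<Longrightarrow> g \<in> Hom D (d w) (d w') \<Longrightarrow> Ti w w' g \<in> Hom C (c w) (c w')"
  unfolding Ti_def using T_bij[of w w'] by (metis bij_betw_def inv_into_into)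

lemma T_Ti: "w \<in> W \<Longrightarrow> w' \<in> W \<Longrightarrow> g \<in> Hom D (d w) (d w') \<Longrightarrow> T w w' (Ti w w' g) = g"
  unfolding Ti_def using T_bij[of w w'] by (metis bij_betw_inv_into_right)

lemma C_obj: "w \<in> W \<Longrightarrow> c w \<in> Obj C"
  using c_onto by blast

lemma dO: "w \<in> W \<Longrightarrow> d w \<in> Obj D"
  using d_onto by blast

lemma C_ident: "w \<in> W \<Longrightarrow> Ident C (c w) \<in> Hom C (c w) (c w)"
  by (simp add: is_categoryD(1)[OF C] C_obj)

lemma C_comp: "w \<in> W \<Longrightarrow> w' \<in> W \<Longrightarrow> w'' \<in> W \<Longrightarrow> f \<in> Hom C (c w) (c w') \<Longrightarrow>
    g \<in> Hom C (c w') (c w'') \<Longrightarrow> Comp C (c w) (c w') (c w'') g f \<in> Hom C (c w) (c w'')"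
  by (simp add: is_categoryD(2)[OF C] C_obj)

lemma C_unit: "w \<in> W \<Longrightarrow> w' \<in> W \<Longrightarrow> f \<in> Hom C (c w) (c w') \<Longrightarrow>
    Comp C (c w) (c w) (c w') f (Ident C (c w)) = f \<and>
    Comp C (c w) (c w') (c w') (Ident C (c w')) f = f"
  by (simp add: is_categoryD(3,4)[OF C] C_obj)

lemma D_obtain:
  assumes "B \<in> Obj D" obtains w where "w \<in> W" "d w = B"
  using assms unfolding d_onto[symmetric] by (elim imageE) simp

lemma D_hom_obtain:
  assumes "w \<in> W" "w' \<in> W" "g \<in> Hom D (d w) (d w')"
  obtains f where "f \<in> Hom C (c w) (c w')" "g = T w w' f"
  by (rule that[OF Ti_hom[OF assms] T_Ti[OF assms, symmetric]])

text \<open>The laws are transported from \<open>C\<close>, because every object of \<open>D\<close>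
  is some \<open>d w\<close> and every morphism is a value of \<open>T\<close>. In the application
  this replaces a direct proof that relational morphisms compose.\<close>

lemma D: "is_category D"
proof -
  have "Ident D A \<in> Hom D A A" if "A \<in> Obj D" for A
    using that by (metis D_obtain T_ident T_hom C_ident)
  moreover have "Comp D A B E g f \<in> Hom D A E"
    if "A \<in> Obj D" "B \<in> Obj D" "E \<in> Obj D" and f: "f \<in> Hom D A B" and g: "g \<in> Hom D B E" for A B E f g
  proof -
    from that obtain u v w where w: "u \<in> W" "d u = A" "v \<in> W" "d v = B" "w \<in> W" "d w = E"
      by (metis D_obtain)
    with f g obtain f' g' where "f' \<in> Hom C (c u) (c v)" "f = T u v f'"
      "g' \<in> Hom C (c v) (c w)" "g = T v w g'"
      by (metis D_hom_obtain)
    then show ?thesis using w T_comp T_hom C_comp by metis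
  qed
  moreover have "Comp D A A B f (Ident D A) = f \<and> Comp D A B B (Ident D B) f = f"
    if "A \<in> Obj D" "B \<in> Obj D" and f: "f \<in> Hom D A B" for A B f
  proof -
    from that obtain u v where w: "u \<in> W" "d u = A" "v \<in> W" "d v = B"
      by (metis D_obtain)
    with f obtain f' where f': "f' \<in> Hom C (c u) (c v)" "f = T u v f'"
      by (metis D_hom_obtain)
    then have "Comp C (c u) (c u) (c v) f' (Ident C (c u)) = f'"
        "Comp C (c u) (c v) (c v) (Ident C (c v)) f' = f'"
      using w C_unit by simp_all
    then show ?thesis using w f' T_comp T_ident C_ident by metis
  qed
  moreover have "Comp D A B F h (Comp D A P B g f) = Comp D A P F (Comp D P B F h g) f"
    if "A \<in> Obj D" "P \<in> Obj D" "B \<in> Obj D" "F \<in> Obj D" and f: "f \<in> Hom D A P"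
      and g: "g \<in> Hom D P B" and h: "h \<in> Hom D B F" for A P B F f g h
  proof -
    from that obtain u v w x where w: "u \<in> W" "d u = A" "v \<in> W" "d v = P" "w \<in> W" "d w = B"
        "x \<in> W" "d x = F"
      by (metis D_obtain)
    with f g h obtain f' g' h' where f': "f' \<in> Hom C (c u) (c v)" "f = T u v f'"
        "g' \<in> Hom C (c v) (c w)" "g = T v w g'" "h' \<in> Hom C (c w) (c x)" "h = T w x h'"
      by (metis D_hom_obtain)
    have "Comp C (c u) (c w) (c x) h' (Comp C (c u) (c v) (c w) g' f') =
        Comp C (c u) (c v) (c x) (Comp C (c v) (c w) (c x) h' g') f'"
      using C_obj w f' by (simp add: is_categoryD(5)[OF C])
    then show ?thesis
      by (metis T_comp C_comp w f')
  qed
  ultimately show ?thesis unfolding is_category_def by (intro conjI ballI) metis+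
qed

lemma D_unit: "w \<in> W \<Longrightarrow> w' \<in> W \<Longrightarrow> f \<in> Hom D (d w) (d w') \<Longrightarrow>
    Comp D (d w) (d w) (d w') f (Ident D (d w)) = f \<and>
    Comp D (d w) (d w') (d w') (Ident D (d w')) f = f"
  by (simp add: is_categoryD(3,4)[OF D] dO)

lemma D_ident: "w \<in> W \<Longrightarrow> Ident D (d w) \<in> Hom D (d w) (d w)"
  by (simp add: is_categoryD(1)[OF D] dO)

text \<open>Different objects of \<open>C\<close> can be matched with one object of
  \<open>D\<close>. The preimage of its identity connects them and supplies the unit of the
  equivalence.\<close>

lemma T_iso:
  assumes "w \<in> W" "w' \<in> W" "d w = d w'"
  shows "is_iso C (c w) (c w') (Ti w w' (Ident D (d w)))"
proof -
  have I: "Ident D (d w) \<in> Hom D (d w) (d w')" "Ident D (d w') \<in> Hom D (d w') (d w)"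
    using T_ident T_hom C_ident assms by metis+
  let ?f = "Ti w w' (Ident D (d w))" and ?g = "Ti w' w (Ident D (d w'))"
  have f: "?f \<in> Hom C (c w) (c w')" "?g \<in> Hom C (c w') (c w)"
    using assms I by (simp_all add: Ti_hom)
  have II: "Comp D (d w) (d w) (d w) (Ident D (d w)) (Ident D (d w)) = Ident D (d w)"
    using D_unit[OF assms(1,1) D_ident] assms(1) by simp
  have "T w w (Comp C (c w) (c w') (c w) ?g ?f) = T w w (Ident C (c w))"
    using assms f I II by (simp add: T_comp T_Ti T_ident)
  moreover have "T w' w' (Comp C (c w') (c w) (c w') ?f ?g) = T w' w' (Ident C (c w'))"
    using assms f I II by (simp add: T_comp T_Ti T_ident)
  ultimately have "Comp C (c w) (c w') (c w) ?g ?f = Ident C (c w)"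
      "Comp C (c w') (c w) (c w') ?f ?g = Ident C (c w')"
    using T_inj assms f by (metis C_comp C_ident)+
  then show ?thesis using f unfolding is_iso_def by blast
qed

lemma T_is_iso:
  assumes "w \<in> W" "w' \<in> W" "is_iso C (c w) (c w') f"
  shows "is_iso D (d w) (d w') (T w w' f)"
proof -
  obtain g where g: "f \<in> Hom C (c w) (c w')" "g \<in> Hom C (c w') (c w)"
    "Comp C (c w) (c w') (c w) g f = Ident C (c w)" "Comp C (c w') (c w) (c w') f g = Ident C (c w')"
    using assms(3) by (auto simp: is_iso_def)
  then have "Comp D (d w) (d w') (d w) (T w' w g) (T w w' f) = Ident D (d w)"
      "Comp D (d w') (d w) (d w') (T w w' f) (T w' w g) = Ident D (d w')"
    using assms by (metis T_comp T_ident)+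
  then show ?thesis using assms g T_hom unfolding is_iso_def by blast
qed

theorem equivalent: "equivalent C D"
proof -
  have "\<forall>A\<in>Obj C. \<exists>w\<in>W. c w = A" "\<forall>B\<in>Obj D. \<exists>w\<in>W. d w = B"
    using c_onto d_onto by (metis imageE)+
  then obtain s r where s: "\<And>A. A \<in> Obj C \<Longrightarrow> s A \<in> W" "\<And>A. A \<in> Obj C \<Longrightarrow> c (s A) = A"
    and r: "\<And>B. B \<in> Obj D \<Longrightarrow> r B \<in> W" "\<And>B. B \<in> Obj D \<Longrightarrow> d (r B) = B"
    by metis
  define F where "F = \<lparr>fobj = (\<lambda>A. d (s A)), fmor = (\<lambda>A B. T (s A) (s B))\<rparr>"
  define G where "G = \<lparr>fobj = (\<lambda>A. c (r A)), fmor = (\<lambda>A B. Ti (r A) (r B))\<rparr>"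
  \<comment> \<open>The indices \<open>s A\<close> and \<open>r (d (s A))\<close> lie over the same
    object of \<open>D\<close>, whose identity is pulled back to \<open>C\<close>.\<close>
  define \<eta> where "\<eta> A = Ti (s A) (r (d (s A))) (Ident D (d (s A)))" for A
  \<comment> \<open>Here \<open>s (c (r B))\<close> and \<open>r B\<close> lie over the same object
    of \<open>C\<close>, whose identity is pushed to \<open>D\<close>.\<close>
  define \<epsilon> where "\<epsilon> B = T (s (c (r B))) (r B) (Ident C (c (r B)))" for B
  have cO: "c w \<in> Obj C" if "w \<in> W" for w using c_onto that by blast
  have F: "is_functor C D F"
    unfolding is_functor_def F_def
    using s dO T_hom[OF s(1) s(1)] T_ident[OF s(1)] T_comp[OF s(1) s(1) s(1)] by simp
  have Gcomp: "Ti (r A) (r E) (Comp D A B E g f) =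
      Comp C (c (r A)) (c (r B)) (c (r E)) (Ti (r B) (r E) g) (Ti (r A) (r B) f)"
    if "A \<in> Obj D" "B \<in> Obj D" "E \<in> Obj D" "f \<in> Hom D A B" "g \<in> Hom D B E" for A B E f g
  proof -
    have f: "Ti (r A) (r B) f \<in> Hom C (c (r A)) (c (r B))"
        "Ti (r B) (r E) g \<in> Hom C (c (r B)) (c (r E))"
      using that r by (simp_all add: Ti_hom)
    have gf: "Comp D A B E g f \<in> Hom D A E" using that by (simp add: is_categoryD(2)[OF D])
    have "T (r A) (r E) (Comp C (c (r A)) (c (r B)) (c (r E)) (Ti (r B) (r E) g) (Ti (r A) (r B) f))
        = Comp D A B E g f"
      using f that r by (simp add: T_comp T_Ti)
    also have "\<dots> = T (r A) (r E) (Ti (r A) (r E) (Comp D A B E g f))"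
      using that r gf by (simp add: T_Ti)
    finally have "T (r A) (r E) (Ti (r A) (r E) (Comp D A B E g f)) = T (r A) (r E) (Comp C (c (r A)) (c (r B)) (c (r E)) (Ti (r B) (r E) g) (Ti (r A) (r B) f))" by simp
    then show ?thesis
      by (subst (asm) T_inj) (use r that f gf in \<open>simp_all add: C_comp Ti_hom\<close>)
  qed
  have Gid: "Ti (r A) (r A) (Ident D A) = Ident C (c (r A))" if "A \<in> Obj D" for A
  proof -
    have I: "Ident D A \<in> Hom D A A" using that by (simp add: is_categoryD(1)[OF D])
    have "T (r A) (r A) (Ti (r A) (r A) (Ident D A)) = T (r A) (r A) (Ident C (c (r A)))"
      using that r I by (simp add: T_Ti T_ident)
    then show ?thesis
      by (subst (asm) T_inj) (use r that I in \<open>simp_all add: C_ident Ti_hom\<close>)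
  qed
  have G: "is_functor D C G"
    unfolding is_functor_def G_def
    using r cO Gcomp Gid Ti_hom by auto
  have \<eta>iso: "is_iso C A (c (r (d (s A)))) (\<eta> A)" if "A \<in> Obj C" for A
    using T_iso[of "s A" "r (d (s A))"] that s r dO by (simp add: \<eta>_def)
  have \<eta>nat: "Comp C A (c (r (d (s A)))) (c (r (d (s B))))
        (Ti (r (d (s A))) (r (d (s B))) (T (s A) (s B) f)) (\<eta> A)
      = Comp C A B (c (r (d (s B)))) (\<eta> B) f"
    if A: "A \<in> Obj C" and B: "B \<in> Obj C" and f: "f \<in> Hom C A B" for A B f
  proof -
    let ?A = "r (d (s A))" and ?B = "r (d (s B))"
    have W: "s A \<in> W" "s B \<in> W" "?A \<in> W" "?B \<in> W" and e: "d ?A = d (s A)" "d ?B = d (s B)"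
        "c (s A) = A" "c (s B) = B"
      using A B s r dO by simp_all
    have Tf: "T (s A) (s B) f \<in> Hom D (d (s A)) (d (s B))"
      using T_hom[OF W(1,2)] f e by simp
    let ?f = "Ti ?A ?B (T (s A) (s B) f)"
    have f': "?f \<in> Hom C (c ?A) (c ?B)" "T ?A ?B ?f = T (s A) (s B) f"
      using Tf Ti_hom[OF W(3,4)] T_Ti[OF W(3,4)] by (simp_all add: e)
    have I: "Ident D (d (s A)) \<in> Hom D (d (s A)) (d (s A))" "Ident D (d (s B)) \<in> Hom D (d (s B)) (d (s B))"
      using D_ident W by blast+
    have eA: "\<eta> A \<in> Hom C A (c ?A)" "T (s A) ?A (\<eta> A) = Ident D (d (s A))"
      using Ti_hom[OF W(1,3)] T_Ti[OF W(1,3)] I e by (simp_all add: \<eta>_def)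
    have eB: "\<eta> B \<in> Hom C B (c ?B)" "T (s B) ?B (\<eta> B) = Ident D (d (s B))"
      using Ti_hom[OF W(2,4)] T_Ti[OF W(2,4)] I e by (simp_all add: \<eta>_def)
    \<comment> \<open>Naturality is tested after applying \<open>T\<close>, which is injective on
      hom-sets; both composites become the image of \<open>f\<close>.\<close>
    have 1: "T (s A) ?B (Comp C A (c ?A) (c ?B) ?f (\<eta> A)) = T (s A) (s B) f"
      using T_comp[OF W(1,3,4)] D_unit[OF W(1,4)] eA f' Tf e by simp
    have 2: "T (s A) ?B (Comp C A B (c ?B) (\<eta> B) f) = T (s A) (s B) f"
      using T_comp[OF W(1,2,4)] D_unit[OF W(1,2)] eB f Tf e by simp
    have "Comp C A (c ?A) (c ?B) ?f (\<eta> A) \<in> Hom C A (c ?B)" "Comp C A B (c ?B) (\<eta> B) f \<in> Hom C A (c ?B)"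
      using C_comp[OF W(1,3,4)] C_comp[OF W(1,2,4)] eA eB f f' e by simp_all
    then show ?thesis
      using T_inj[OF W(1,4), THEN iffD1] 1 2 e by metis
  qed
  have \<epsilon>iso: "is_iso D (d (s (c (r B)))) B (\<epsilon> B)" if B: "B \<in> Obj D" for B
  proof -
    have I: "Ident C (c (r B)) \<in> Hom C (c (r B)) (c (r B))"
        "Comp C (c (r B)) (c (r B)) (c (r B)) (Ident C (c (r B))) (Ident C (c (r B))) = Ident C (c (r B))"
      using C_ident[OF r(1)[OF B]] C_unit[OF r(1)[OF B] r(1)[OF B]] by simp_all
    then have "is_iso C (c (r B)) (c (r B)) (Ident C (c (r B)))"
      unfolding is_iso_def by blast
    then show ?thesis
      using T_is_iso[of "s (c (r B))" "r B"] B s r cO by (simp add: \<epsilon>_def)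
  qed
  have \<epsilon>nat: "Comp D (d (s (c (r A)))) A B f (\<epsilon> A)
      = Comp D (d (s (c (r A)))) (d (s (c (r B)))) B (\<epsilon> B) (T (s (c (r A))) (s (c (r B))) (Ti (r A) (r B) f))"
    if A: "A \<in> Obj D" and B: "B \<in> Obj D" and f: "f \<in> Hom D A B" for A B f
  proof -
    let ?A = "s (c (r A))" and ?B = "s (c (r B))"
    have W: "r A \<in> W" "r B \<in> W" "?A \<in> W" "?B \<in> W" and e: "c ?A = c (r A)" "c ?B = c (r B)"
        "d (r A) = A" "d (r B) = B"
      using A B s r cO by simp_all
    let ?f = "Ti (r A) (r B) f"
    have f': "?f \<in> Hom C (c (r A)) (c (r B))" "T (r A) (r B) ?f = f"
      using f W e by (simp_all add: Ti_hom T_Ti)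
    have I: "Ident C (c (r A)) \<in> Hom C (c (r A)) (c (r A))" "Ident C (c (r B)) \<in> Hom C (c (r B)) (c (r B))"
      using C_ident W by simp_all
    have 1: "Comp C (c (r A)) (c (r A)) (c (r B)) ?f (Ident C (c (r A))) = ?f"
        "Comp C (c (r A)) (c (r B)) (c (r B)) (Ident C (c (r B))) ?f = ?f"
      using C_unit[OF W(1,2)] f' by simp_all
    have "Comp D (d ?A) A B f (\<epsilon> A) = T ?A (r B) ?f"
      using T_comp[OF W(3,1,2), of "Ident C (c (r A))" ?f] I f' 1 e by (simp add: \<epsilon>_def)
    moreover have "Comp D (d ?A) (d ?B) B (\<epsilon> B) (T ?A ?B ?f) = T ?A (r B) ?f"
      using T_comp[OF W(3,4,2), of ?f "Ident C (c (r B))"] I f' 1 e by (simp add: \<epsilon>_def)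
    ultimately show ?thesis by simp
  qed
  have "natural_iso C C id_functor (comp_functor G F) \<eta>"
    using \<eta>iso \<eta>nat unfolding natural_iso_def id_functor_def comp_functor_def F_def G_def by simp
  moreover have "natural_iso D D (comp_functor F G) id_functor \<epsilon>"
    using \<epsilon>iso \<epsilon>nat unfolding natural_iso_def id_functor_def comp_functor_def F_def G_def by simp
  ultimately show ?thesis
    unfolding equivalent_def using C D F G by blast
qed

end

lemma opposite_simps [simp]:
  "Obj (opposite C) = Obj C" "Hom (opposite C) A B = Hom C B A" "Ident (opposite C) = Ident C"
  "Comp (opposite C) A B E g f = Comp C E B A f g"
  by (simp_all add: opposite_def)

lemma full_subcategory_simps [simp]:
  "Obj (full_subcategory C P) = {A \<in> Obj C. P A}" "Hom (full_subcategory C P) = Hom C"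
  "Ident (full_subcategory C P) = Ident C" "Comp (full_subcategory C P) = Comp C"
  by (simp_all add: full_subcategory_def)

lemma is_category_opposite:
  assumes C: "is_category C" shows "is_category (opposite C)"
  unfolding is_category_def opposite_simps
  by (intro conjI ballI; rule is_categoryD[OF C] is_categoryD(5)[OF C, symmetric]; assumption)

lemma is_category_full_subcategory:
  assumes C: "is_category C" shows "is_category (full_subcategory C P)"
  unfolding is_category_def full_subcategory_simps
  by (intro conjI ballI) (elim CollectE conjE, rule is_categoryD[OF C]; assumption)+

section \<open>Priestley spaces\<close>

lemma compact_space_cover:
  assumes "compact_space T" "closedin T C" "\<And>i. i \<in> I \<Longrightarrow> openin T (U i)" "C \<subseteq> (\<Union>i\<in>I. U i)"
  shows "\<exists>J. finite J \<and> J \<subseteq> I \<and> C \<subseteq> (\<Union>i\<in>J. U i)"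
proof -
  have "\<exists>\<F>. finite \<F> \<and> \<F> \<subseteq> U ` I \<and> C \<subseteq> \<Union>\<F>"
    using assms by (intro compactinD[OF closedin_compact_space[OF assms(1,2)]]) auto
  then obtain \<F> where F: "finite \<F>" "\<F> \<subseteq> U ` I" "C \<subseteq> \<Union>\<F>"
    by (elim exE conjE)
  obtain J where "J \<subseteq> I" "finite J" "\<F> = U ` J"
    using finite_subset_image[OF F(1,2)] by (elim exE conjE)
  then show ?thesis using F(3) by (intro exI[of _ J]) simp
qed

lemma clopen_upsets_sub: "W \<in> clopen_upsets X \<Longrightarrow> W \<subseteq> points X"
  by (simp add: clopen_upsets_def is_upset_def)

lemma clopen_upsets_empty: "{} \<in> clopen_upsets X"
  by (simp add: clopen_upsets_def is_upset_def)

lemma clopen_upsets_points: "points X \<in> clopen_upsets X"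
  by (simp add: clopen_upsets_def is_upset_def)

lemma clopen_upsets_Un: "V \<in> clopen_upsets X \<Longrightarrow> W \<in> clopen_upsets X \<Longrightarrow> V \<union> W \<in> clopen_upsets X"
  by (auto simp: clopen_upsets_def is_upset_def)

lemma clopen_upsets_Int: "V \<in> clopen_upsets X \<Longrightarrow> W \<in> clopen_upsets X \<Longrightarrow> V \<inter> W \<in> clopen_upsets X"
  by (auto simp: clopen_upsets_def is_upset_def)

lemma finite_Int_mem:
  assumes "finite J" "P \<in> \<B>" "\<And>V W. V \<in> \<B> \<Longrightarrow> W \<in> \<B> \<Longrightarrow> V \<inter> W \<in> \<B>" "\<And>i. i \<in> J \<Longrightarrow> B i \<in> \<B>"
  shows "P \<inter> (\<Inter>i\<in>J. B i) \<in> \<B>"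
  using assms(1,4)
proof (induction J)
  case empty
  then show ?case using assms(2) by simp
next
  case (insert i J)
  then have "B i \<inter> (P \<inter> (\<Inter>i\<in>J. B i)) \<in> \<B>" using assms(3) by simp
  moreover have "B i \<inter> (P \<inter> (\<Inter>i\<in>J. B i)) = P \<inter> (\<Inter>i\<in>insert i J. B i)" by blast
  ultimately show ?case by (simp only:)
qed

lemma finite_Un_mem:
  assumes "finite J" "{} \<in> \<B>" "\<And>V W. V \<in> \<B> \<Longrightarrow> W \<in> \<B> \<Longrightarrow> V \<union> W \<in> \<B>" "\<And>i. i \<in> J \<Longrightarrow> B i \<in> \<B>"
  shows "(\<Union>i\<in>J. B i) \<in> \<B>"
  using assms(1,4) by (induction J) (simp_all add: assms(2,3))

text \<open>Compactness turns separation from single points of \<open>C\<close> into separation from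
  all of \<open>C\<close>: finitely many complements cover \<open>C\<close>, and the corresponding
  members of \<open>\<B>\<close> are intersected. The family is kept general so that the argument
  serves both all clopen upsets and a sublattice of them.\<close>

lemma separate_point_closed:
  assumes comp: "compact_space (topo X)" and B: "\<B> \<subseteq> clopen_upsets X" "points X \<in> \<B>"
      "\<And>V W. V \<in> \<B> \<Longrightarrow> W \<in> \<B> \<Longrightarrow> V \<inter> W \<in> \<B>"
    and C: "closedin (topo X) C" and x: "x \<in> points X"
    and sep: "\<And>y. y \<in> C \<Longrightarrow> \<exists>B\<in>\<B>. x \<in> B \<and> y \<notin> B"
  shows "\<exists>B\<in>\<B>. x \<in> B \<and> B \<inter> C = {}"
proof -
  obtain B where B': "\<And>y. y \<in> C \<Longrightarrow> B y \<in> \<B> \<and> x \<in> B y \<and> y \<notin> B y" using sep by metis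
  have "openin (topo X) (points X - B y)" if "y \<in> C" for y
    using B'[OF that] B(1) by (auto simp: clopen_upsets_def)
  moreover have "C \<subseteq> (\<Union>y\<in>C. points X - B y)"
    using B' closedin_subset[OF C] by blast
  ultimately have "\<exists>J. finite J \<and> J \<subseteq> C \<and> C \<subseteq> (\<Union>y\<in>J. points X - B y)"
    by (rule compact_space_cover[OF comp C])
  then obtain J where J: "finite J" "J \<subseteq> C" "C \<subseteq> (\<Union>y\<in>J. points X - B y)"
    by (elim exE conjE)
  \<comment> \<open>The factor \<open>points X\<close> takes care of an empty
    \<open>J\<close>.\<close>
  have "points X \<inter> (\<Inter>i\<in>J. B i) \<in> \<B>"
    using J B' B by (intro finite_Int_mem) auto
  moreover have "x \<in> points X \<inter> (\<Inter>i\<in>J. B i)" using x J(2) B' by blast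
  moreover have "points X \<inter> (\<Inter>i\<in>J. B i) \<inter> C = {}" using J(3) by blast
  ultimately show ?thesis by (intro bexI[of _ "points X \<inter> (\<Inter>i\<in>J. B i)"] conjI)
qed

text \<open>A bounded sublattice of clopen upsets that separates the order exhausts them: each point
  of a clopen upset \<open>W\<close> is separated from the closed complement of \<open>W\<close> by
  a member inside \<open>W\<close>, and compactness of \<open>W\<close> makes a finite union
  suffice. This identifies the clopen upsets of powers and of prime filter spaces.\<close>

lemma priestley_space_by_sublattice:
  assumes comp: "compact_space (topo X)" and po: "partial_order_on (points X) (ord_rel X)"
    and B: "\<B> \<subseteq> clopen_upsets X" "points X \<in> \<B>" "{} \<in> \<B>"
      "\<And>V W. V \<in> \<B> \<Longrightarrow> W \<in> \<B> \<Longrightarrow> V \<inter> W \<in> \<B>" "\<And>V W. V \<in> \<B> \<Longrightarrow> W \<in> \<B> \<Longrightarrow> V \<union> W \<in> \<B>"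
    and sep: "\<And>x y. x \<in> points X \<Longrightarrow> y \<in> points X \<Longrightarrow> (x, y) \<notin> ord_rel X \<Longrightarrow> \<exists>B\<in>\<B>. x \<in> B \<and> y \<notin> B"
  shows "priestley_space X" "clopen_upsets X = \<B>"
proof -
  show "priestley_space X"
    unfolding priestley_space_def using comp po sep B(1) by blast
  have "W \<in> \<B>" if W: "W \<in> clopen_upsets X" for W
  proof -
    have W': "openin (topo X) W" "closedin (topo X) W" "is_upset X W" "W \<subseteq> points X"
      using W by (auto simp: clopen_upsets_def is_upset_def)
    have "\<exists>B\<in>\<B>. x \<in> B \<and> B \<subseteq> W" if x: "x \<in> W" for x
    proof -
      have cl: "closedin (topo X) (points X - W)" and xX: "x \<in> points X" using W' x by auto
      have sep':  "\<exists>B\<in>\<B>. x \<in> B \<and> y \<notin> B" if "y \<in> points X - W" for y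
        using that x W' by (intro sep) (auto simp: is_upset_def)
      have "\<exists>B\<in>\<B>. x \<in> B \<and> B \<inter> (points X - W) = {}"
        by (rule separate_point_closed[OF comp B(1,2)]) (fact B(4) cl xX sep')+
      then obtain B where "B \<in> \<B>" "x \<in> B" "B \<inter> (points X - W) = {}" by metis
      moreover from this have "B \<subseteq> points X" using B(1) clopen_upsets_sub by blast
      ultimately show ?thesis by blast
    qed
    then obtain B' where B': "\<And>x. x \<in> W \<Longrightarrow> B' x \<in> \<B> \<and> x \<in> B' x \<and> B' x \<subseteq> W" by metis
    have "openin (topo X) (B' x)" if "x \<in> W" for x
      using B'[OF that] B(1) by (auto simp: clopen_upsets_def)
    moreover have "W \<subseteq> (\<Union>x\<in>W. B' x)" using B' by blast
    ultimately have "\<exists>J. finite J \<and> J \<subseteq> W \<and> W \<subseteq> (\<Union>x\<in>J. B' x)"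
      by (rule compact_space_cover[OF comp W'(2)])
    then obtain J where J: "finite J" "J \<subseteq> W" "W \<subseteq> (\<Union>x\<in>J. B' x)"
      by (elim exE conjE)
    have "(\<Union>x\<in>J. B' x) \<in> \<B>" using J B' B by (intro finite_Un_mem) auto
    moreover have "(\<Union>x\<in>J. B' x) = W" using J B' by blast
    ultimately show ?thesis by simp
  qed
  then show "clopen_upsets X = \<B>" using B(1) by blast
qed

lemma separate_point_closed_downset:
  assumes X: "priestley_space X" and C: "C \<in> closed_downsets X" and x: "x \<in> points X" "x \<notin> C"
  shows "\<exists>W\<in>clopen_upsets X. x \<in> W \<and> W \<inter> C = {}"
proof -
  have C': "closedin (topo X) C" "is_downset X C" "C \<subseteq> points X"
    using C by (auto simp: closed_downsets_def is_downset_def)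
  have "\<exists>B\<in>clopen_upsets X. x \<in> B \<and> y \<notin> B" if "y \<in> C" for y
  proof -
    have "y \<in> points X" "(x, y) \<notin> ord_rel X" using that C' x by (auto simp: is_downset_def)
    then show ?thesis using X x by (simp add: priestley_space_def)
  qed
  then show ?thesis
    using X C' x
    by (intro separate_point_closed)
      (auto simp: priestley_space_def clopen_upsets_points intro: clopen_upsets_Int)
qed

text \<open>Clopen upsets separate a closed downset from each point outside it. This is the source
  of the uniqueness of the relation dual to a map.\<close>

lemma closed_downsets_eqI:
  assumes X: "priestley_space X" and C: "C \<in> closed_downsets X" and D: "D \<in> closed_downsets X"
    and eq: "\<And>W. W \<in> clopen_upsets X \<Longrightarrow> C \<inter> W \<noteq> {} \<longleftrightarrow> D \<inter> W \<noteq> {}"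
  shows "C = D"
proof -
  have "C \<subseteq> D" if C: "C \<in> closed_downsets X" and D: "D \<in> closed_downsets X"
    and eq: "\<And>W. W \<in> clopen_upsets X \<Longrightarrow> C \<inter> W \<noteq> {} \<longleftrightarrow> D \<inter> W \<noteq> {}" for C D
  proof
    fix x assume x: "x \<in> C"
    show "x \<in> D"
    proof (rule ccontr)
      assume "x \<notin> D"
      moreover have "x \<in> points X" using x C by (auto simp: closed_downsets_def is_downset_def)
      ultimately obtain W where "W \<in> clopen_upsets X" "x \<in> W" "W \<inter> D = {}"
        using separate_point_closed_downset[OF X D] by metis
      then show False using eq[of W] x by blast
    qed
  qed
  then show ?thesis using assms(2-4) by (meson subset_antisym)
qed

text \<open>Principal downsets, values of dual relations and values of composite relations are all
  recognized as closed downsets by being brought into this form.\<close>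

lemma closed_downset_complements:
  assumes "\<W> \<subseteq> clopen_upsets X"
  shows "{x \<in> points X. \<forall>W\<in>\<W>. x \<notin> W} \<in> closed_downsets X"
proof -
  have "closedin (topo X) (\<Inter>(insert (points X) ((\<lambda>W. points X - W) ` \<W>)))"
    using assms by (intro closedin_Inter) (auto simp: clopen_upsets_def)
  also have "\<Inter>(insert (points X) ((\<lambda>W. points X - W) ` \<W>)) = {x \<in> points X. \<forall>W\<in>\<W>. x \<notin> W}"
    by blast
  finally show ?thesis
    using assms unfolding closed_downsets_def is_downset_def clopen_upsets_def is_upset_def by blast
qed

section \<open>Priestley relations\<close>

lemma priestley_relation_closed_downset:
  assumes "\<beta> \<in> priestley_relations Y X" "y \<in> points Y"
  shows "\<beta> y \<in> closed_downsets X"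
proof -
  have "\<beta> \<in> points Y \<rightarrow> points (V_down X)"
    using assms(1) continuous_map_funspace by (auto simp: priestley_relations_def)
  then show ?thesis using assms(2) by (auto simp: points_V_down)
qed

lemma priestley_relation_points:
  assumes "\<beta> \<in> priestley_relations Y X" "y \<in> points Y" "x \<in> \<beta> y"
  shows "x \<in> points X"
  using priestley_relation_closed_downset[OF assms(1,2)] assms(3)
  by (auto simp: closed_downsets_def is_downset_def)

lemma priestley_relation_extensional:
  "\<beta> \<in> priestley_relations Y X \<Longrightarrow> \<beta> \<in> extensional (points Y)"
  by (simp add: priestley_relations_def)

text \<open>Continuity can be tested on the generating sets. They come in complementary pairs, and
  openness of the second preimage is closedness of the first.\<close>

lemma V_down_continuous_iff:
  "continuous_map T (topo (V_down X)) \<beta> \<longleftrightarrow> (\<forall>y\<in>topspace T. \<beta> y \<in> closed_downsets X) \<and>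
    (\<forall>W\<in>clopen_upsets X. openin T {y \<in> topspace T. \<beta> y \<inter> W \<noteq> {}} \<and>
      closedin T {y \<in> topspace T. \<beta> y \<inter> W \<noteq> {}})" (is "?L \<longleftrightarrow> ?C \<and> ?R")
proof -
  let ?S = "(\<lambda>W. {A \<in> closed_downsets X. A \<inter> W \<noteq> {}}) ` clopen_upsets X \<union>
       (\<lambda>W. {A \<in> closed_downsets X. A \<inter> W = {}}) ` clopen_upsets X"
  have "\<Union>?S = closed_downsets X"
    using points_V_down[of X] by (simp add: V_down_def)
  then have *: "?L \<longleftrightarrow> (\<forall>U. U \<in> ?S \<longrightarrow> openin T (\<beta> -` U \<inter> topspace T)) \<and>
      \<beta> ` topspace T \<subseteq> closed_downsets X"
    by (simp only: V_down_def ordered_space.simps continuous_on_generated_topo_iff)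
  show ?thesis
  proof (cases ?C)
    case True
    have "\<beta> -` {A \<in> closed_downsets X. A \<inter> W \<noteq> {}} \<inter> topspace T = {y \<in> topspace T. \<beta> y \<inter> W \<noteq> {}}"
      and "\<beta> -` {A \<in> closed_downsets X. A \<inter> W = {}} \<inter> topspace T =
        topspace T - {y \<in> topspace T. \<beta> y \<inter> W \<noteq> {}}" for W
      using True by auto
    moreover have "closedin T {y \<in> topspace T. \<beta> y \<inter> W \<noteq> {}} \<longleftrightarrow>
      openin T (topspace T - {y \<in> topspace T. \<beta> y \<inter> W \<noteq> {}})" for W
      by (simp add: closedin_def subset_iff)
    ultimately have "(\<forall>U. U \<in> ?S \<longrightarrow> openin T (\<beta> -` U \<inter> topspace T)) \<longleftrightarrow> ?R"
      by (simp add: all_conj_distrib ball_conj_distrib imp_disjL ball_Un flip: Ball_def) (simp add: Ball_def)?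
    then show ?thesis using * True by (simp add: image_subset_iff)
  next
    case False
    then have "\<not> \<beta> ` topspace T \<subseteq> closed_downsets X" by (simp add: image_subset_iff)
    then show ?thesis using * False by simp
  qed
qed

lemma priestley_relation_preimage:
  assumes \<beta>: "\<beta> \<in> priestley_relations Y X" and W: "W \<in> clopen_upsets X"
  shows "{y \<in> points Y. \<beta> y \<inter> W \<noteq> {}} \<in> clopen_upsets Y"
proof -
  have "\<beta> x \<subseteq> \<beta> y" if "x \<in> points Y" "y \<in> points Y" "(x, y) \<in> ord_rel Y" for x y
    using \<beta> that by (auto simp: priestley_relations_def V_down_def)
  then have "is_upset Y {y \<in> points Y. \<beta> y \<inter> W \<noteq> {}}"
    unfolding is_upset_def by blast
  then show ?thesis
    using \<beta> W by (simp add: clopen_upsets_def priestley_relations_def V_down_continuous_iff)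
qed

text \<open>Monotonicity follows from the preimages being upsets: if
  \<open>x \<in> \<beta> y\<close> lay outside \<open>\<beta> y'\<close>, a clopen upset around
  \<open>x\<close> missing \<open>\<beta> y'\<close> would have a preimage containing
  \<open>y\<close> but not the larger point \<open>y'\<close>.\<close>

lemma priestley_relationI:
  assumes "\<beta> \<in> extensional (points Y)" "\<And>y. y \<in> points Y \<Longrightarrow> \<beta> y \<in> closed_downsets X"
    and "\<And>W. W \<in> clopen_upsets X \<Longrightarrow> {y \<in> points Y. \<beta> y \<inter> W \<noteq> {}} \<in> clopen_upsets Y"
    and "priestley_space X"
  shows "\<beta> \<in> priestley_relations Y X"
proof -
  have "\<beta> y \<subseteq> \<beta> y'" if y: "y \<in> points Y" "y' \<in> points Y" "(y, y') \<in> ord_rel Y" for y y'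
  proof
    fix x assume x: "x \<in> \<beta> y"
    show "x \<in> \<beta> y'"
    proof (rule ccontr)
      assume "x \<notin> \<beta> y'"
      moreover have "x \<in> points X"
        using x assms(2)[OF y(1)] by (auto simp: closed_downsets_def is_downset_def)
      ultimately obtain W where W: "W \<in> clopen_upsets X" "x \<in> W" "W \<inter> \<beta> y' = {}"
        using separate_point_closed_downset[OF assms(4) assms(2)[OF y(2)]] by metis
      then show False
        using assms(3)[OF W(1)] x y unfolding clopen_upsets_def is_upset_def by blast
    qed
  qed
  moreover have "continuous_map (topo Y) (topo (V_down X)) \<beta>"
    using assms(2,3) unfolding V_down_continuous_iff by (simp add: clopen_upsets_def)
  ultimately show ?thesis
    using assms(1,2) by (simp add: priestley_relations_def) (simp add: V_down_def)
qed

text \<open>With \<open>C\<close> a value of another Priestley relation this makes the values of a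
  composite closed downsets. A point outside the union is separated from each
  \<open>\<beta> y\<close> by a clopen upset; compactness of \<open>C\<close> reduces these to
  finitely many, whose intersection misses the whole union.\<close>

lemma relation_comp_closed_downset:
  assumes X: "priestley_space X" and Y: "priestley_space Y"
    and \<beta>: "\<beta> \<in> priestley_relations Y X" and C: "C \<in> closed_downsets Y"
  shows "(\<Union>y\<in>C. \<beta> y) \<in> closed_downsets X"
proof -
  let ?D = "\<Union>y\<in>C. \<beta> y"
  have C': "closedin (topo Y) C" "C \<subseteq> points Y"
    using C by (auto simp: closed_downsets_def is_downset_def)
  have cd: "\<beta> y \<in> closed_downsets X" if "y \<in> C" for y
    using priestley_relation_closed_downset[OF \<beta>] that C'(2) by blast
  have sub: "?D \<subseteq> points X" using cd by (auto simp: closed_downsets_def is_downset_def)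
  have "\<exists>W\<in>clopen_upsets X. x \<in> W \<and> ?D \<inter> W = {}" if x: "x \<in> points X" "x \<notin> ?D" for x
  proof -
    have "\<exists>W\<in>clopen_upsets X. x \<in> W \<and> W \<inter> \<beta> y = {}" if "y \<in> C" for y
    proof -
      have "x \<notin> \<beta> y" using x(2) that by blast
      then show ?thesis by (rule separate_point_closed_downset[OF X cd[OF that] x(1)])
    qed
    then obtain W where W: "\<And>y. y \<in> C \<Longrightarrow> W y \<in> clopen_upsets X \<and> x \<in> W y \<and> W y \<inter> \<beta> y = {}"
      by metis
    \<comment> \<open>An open neighbourhood of \<open>y\<close> on which the one set
      \<open>W y\<close> still separates \<open>x\<close> from the values.\<close>
    let ?U = "\<lambda>y. points Y - {z \<in> points Y. \<beta> z \<inter> W y \<noteq> {}}"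
    have "openin (topo Y) (?U y)" if "y \<in> C" for y
      using priestley_relation_preimage[OF \<beta>, of "W y"] W[OF that]
      by (simp add: clopen_upsets_def openin_diff)
    moreover have "C \<subseteq> (\<Union>y\<in>C. ?U y)"
    proof
      fix y assume "y \<in> C"
      then show "y \<in> (\<Union>y\<in>C. ?U y)" using W[of y] C'(2) by (intro UN_I[of y]) auto
    qed
    moreover have "compact_space (topo Y)" using Y by (simp add: priestley_space_def)
    ultimately have "\<exists>J. finite J \<and> J \<subseteq> C \<and> C \<subseteq> (\<Union>y\<in>J. ?U y)"
      by (intro compact_space_cover[OF _ C'(1)])
    then obtain J where J: "finite J" "J \<subseteq> C" "C \<subseteq> (\<Union>y\<in>J. ?U y)"
      by (elim exE conjE)
    let ?W = "points X \<inter> (\<Inter>y\<in>J. W y)"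
    have "?W \<in> clopen_upsets X"
      using J W by (intro finite_Int_mem) (auto intro: clopen_upsets_points clopen_upsets_Int)
    moreover have "x \<in> ?W" using x W J(2) by blast
    moreover have "?D \<inter> ?W = {}"
    proof -
      have "\<beta> y \<inter> ?W = {}" if "y \<in> C" for y
      proof -
        have "\<exists>z\<in>J. \<beta> y \<inter> W z = {}" using subsetD[OF J(3) that] by auto
        then show ?thesis by blast
      qed
      then show ?thesis by blast
    qed
    ultimately show ?thesis by (intro bexI[of _ ?W] conjI)
  qed
  \<comment> \<open>The union is thus the complement of all clopen upsets that it misses.\<close>
  then have "?D = {x \<in> points X. \<forall>W\<in>{W \<in> clopen_upsets X. ?D \<inter> W = {}}. x \<notin> W}"
    using sub by (intro equalityI subsetI) (simp_all del: UN_iff, blast+)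
  moreover have "{x \<in> points X. \<forall>W\<in>{W \<in> clopen_upsets X. ?D \<inter> W = {}}. x \<notin> W} \<in> closed_downsets X"
    by (rule closed_downset_complements) simp
  ultimately show ?thesis by simp
qed

text \<open>Principal downsets are the values of the identity relation. The second claim will say
  that this relation represents the identity map.\<close>

lemma principal_downset:
  assumes X: "priestley_space X" and x: "x \<in> points X"
  shows "{y \<in> points X. (y, x) \<in> ord_rel X} \<in> closed_downsets X"
    and "W \<in> clopen_upsets X \<Longrightarrow> {y \<in> points X. (y, x) \<in> ord_rel X} \<inter> W \<noteq> {} \<longleftrightarrow> x \<in> W"
proof -
  have "(x, x) \<in> ord_rel X"
    using X x by (auto simp: priestley_space_def partial_order_on_def preorder_on_def refl_on_def)
  then show *: "W \<in> clopen_upsets X \<Longrightarrow> {y \<in> points X. (y, x) \<in> ord_rel X} \<inter> W \<noteq> {} \<longleftrightarrow> x \<in> W" for W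
    using x by (auto simp: clopen_upsets_def is_upset_def)
  have "(y, x) \<in> ord_rel X \<longleftrightarrow> (\<forall>W\<in>clopen_upsets X. x \<notin> W \<longrightarrow> y \<notin> W)" if y: "y \<in> points X" for y
  proof
    assume "(y, x) \<in> ord_rel X"
    then show "\<forall>W\<in>clopen_upsets X. x \<notin> W \<longrightarrow> y \<notin> W"
      using x by (auto simp: clopen_upsets_def is_upset_def)
  next
    assume "\<forall>W\<in>clopen_upsets X. x \<notin> W \<longrightarrow> y \<notin> W"
    moreover have "(y, x) \<in> ord_rel X \<or> (\<exists>W\<in>clopen_upsets X. y \<in> W \<and> x \<notin> W)"
      using X x y by (auto simp: priestley_space_def)
    ultimately show "(y, x) \<in> ord_rel X" by metis
  qed
  then have "{y \<in> points X. (y, x) \<in> ord_rel X} = {y \<in> points X. \<forall>W\<in>{W \<in> clopen_upsets X. x \<notin> W}. y \<notin> W}"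
    by auto
  moreover have "{y \<in> points X. \<forall>W\<in>{W \<in> clopen_upsets X. x \<notin> W}. y \<notin> W} \<in> closed_downsets X"
    by (rule closed_downset_complements) simp
  ultimately show "{y \<in> points X. (y, x) \<in> ord_rel X} \<in> closed_downsets X" by simp
qed

section \<open>Duality for join-preserving maps\<close>

text \<open>Only a join-semilattice is assumed. Meets and top are recovered from surjectivity of
  \<open>\<phi>\<close> onto the clopen upsets, and the order from joins. Hence a tensor power fits
  the locale without a separate proof that it is a lattice.\<close>

locale priestley_dual = jsl A for A :: "'a gorder" (structure) +
  fixes X :: "'b ordered_space" and \<phi> :: "'a \<Rightarrow> 'b set"
  assumes priestley: "priestley_space X"
    and bij: "bij_betw \<phi> (carrier A) (clopen_upsets X)"
    and rep_bottom: "\<phi> \<bottom> = {}"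
    and rep_join: "a \<in> carrier A \<Longrightarrow> b \<in> carrier A \<Longrightarrow> \<phi> (a \<squnion> b) = \<phi> a \<union> \<phi> b"
begin

lemma rep_clopen: "a \<in> carrier A \<Longrightarrow> \<phi> a \<in> clopen_upsets X"
  using bij by (auto simp: bij_betw_def)

lemma rep_inj: "a \<in> carrier A \<Longrightarrow> b \<in> carrier A \<Longrightarrow> \<phi> a = \<phi> b \<longleftrightarrow> a = b"
  using bij by (auto simp: bij_betw_def inj_on_def)

lemma rep_surj:
  assumes "W \<in> clopen_upsets X" obtains a where "a \<in> carrier A" "\<phi> a = W"
proof -
  have "W \<in> \<phi> ` carrier A" using assms bij by (simp add: bij_betw_def)
  then show thesis using that by (elim imageE) simp
qed

lemma rep_points: "a \<in> carrier A \<Longrightarrow> \<phi> a \<subseteq> points X"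
  using rep_clopen clopen_upsets_sub by blast

lemma rep_le_join: "a \<in> carrier A \<Longrightarrow> b \<in> carrier A \<Longrightarrow> \<phi> a \<subseteq> \<phi> b \<Longrightarrow> a \<squnion> b = b"
  using rep_inj[of "a \<squnion> b" b] rep_join[of a b] by auto

text \<open>A point-set form of the prime ideal theorem. If the sets \<open>\<phi> b\<close> with
  \<open>b \<in> J\<close> covered \<open>\<phi> a\<close>, finitely many would, and their join
  would put \<open>a\<close> into the ideal.\<close>

lemma ideal_avoiding_point:
  assumes J: "J \<subseteq> carrier A" "\<bottom> \<in> J" "\<And>a b. a \<in> J \<Longrightarrow> b \<in> J \<Longrightarrow> a \<squnion> b \<in> J"
      "\<And>a b. a \<in> J \<Longrightarrow> b \<in> carrier A \<Longrightarrow> \<phi> b \<subseteq> \<phi> a \<Longrightarrow> b \<in> J"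
    and a: "a \<in> carrier A" "a \<notin> J"
  shows "\<exists>x\<in>\<phi> a. \<forall>b\<in>J. x \<notin> \<phi> b"
proof (rule ccontr)
  assume "\<not> (\<exists>x\<in>\<phi> a. \<forall>b\<in>J. x \<notin> \<phi> b)"
  then have "\<phi> a \<subseteq> (\<Union>b\<in>J. \<phi> b)" by blast
  moreover have "openin (topo X) (\<phi> b)" if "b \<in> J" for b
    using rep_clopen J(1) that by (auto simp: clopen_upsets_def)
  moreover have "closedin (topo X) (\<phi> a)" using rep_clopen[OF a(1)] by (simp add: clopen_upsets_def)
  ultimately obtain K where K: "finite K" "K \<subseteq> J" "\<phi> a \<subseteq> (\<Union>b\<in>K. \<phi> b)"
    using compact_space_cover[of "topo X" "\<phi> a" J \<phi>] priestley by (auto simp: priestley_space_def)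
  have "\<exists>c\<in>J. (\<Union>b\<in>K. \<phi> b) = \<phi> c"
    using K(1,2)
  proof (induction K)
    case empty
    then show ?case using J(2) rep_bottom by auto
  next
    case (insert b K)
    then obtain c where "c \<in> J" "(\<Union>b\<in>K. \<phi> b) = \<phi> c" by auto
    then show ?case using insert J(1,3) rep_join[of b c] by (intro bexI[of _ "b \<squnion> c"]) auto
  qed
  then show False using K(3) J(4) a by auto
qed

end

locale priestley_dual_pair = A: priestley_dual A X \<phi> + B: priestley_dual B Y \<psi>
  for A :: "'a gorder" and X :: "'b ordered_space" and \<phi>
    and B :: "'c gorder" and Y :: "'d ordered_space" and \<psi>
begin

definition represents :: "('a \<Rightarrow> 'c) \<Rightarrow> ('d \<Rightarrow> 'b set) \<Rightarrow> bool" where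
  "represents h \<beta> \<longleftrightarrow> (\<forall>a\<in>carrier A. \<psi> (h a) = {y \<in> points Y. \<beta> y \<inter> \<phi> a \<noteq> {}})"

text \<open>Continuity and monotonicity are left out on purpose: closed-downset values already give
  uniqueness, and \<open>represents_priestley\<close> adds the rest once a join-preserving map is
  represented. A candidate relation can therefore be checked value by value.\<close>

definition closed_relations :: "('d \<Rightarrow> 'b set) set" where
  "closed_relations = {\<beta> \<in> extensional (points Y). \<forall>y\<in>points Y. \<beta> y \<in> closed_downsets X}"

lemma priestley_closed_relation: "\<beta> \<in> priestley_relations Y X \<Longrightarrow> \<beta> \<in> closed_relations"
  by (simp add: closed_relations_def priestley_relation_extensional priestley_relation_closed_downset)

lemma jsl_hom_carrier: "h \<in> jsl_hom A B \<Longrightarrow> a \<in> carrier A \<Longrightarrow> h a \<in> carrier B"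
  by (auto simp: jsl_hom_def)

text \<open>A clopen upset of \<open>X\<close> is some \<open>\<phi> a\<close>, and its preimage is
  \<open>\<psi> (h a)\<close>, again a clopen upset.\<close>

lemma represents_priestley:
  assumes \<beta>: "\<beta> \<in> closed_relations" and h: "h \<in> jsl_hom A B" and r: "represents h \<beta>"
  shows "\<beta> \<in> priestley_relations Y X"
proof (rule priestley_relationI)
  fix W assume "W \<in> clopen_upsets X"
  then obtain a where "a \<in> carrier A" "\<phi> a = W" by (rule A.rep_surj)
  then show "{y \<in> points Y. \<beta> y \<inter> W \<noteq> {}} \<in> clopen_upsets Y"
    using r h B.rep_clopen[of "h a"] jsl_hom_carrier[of h a] by (simp add: represents_def)
qed (use \<beta> A.priestley in \<open>simp_all add: closed_relations_def\<close>)

lemma represents_unique_relation: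
  assumes \<beta>: "\<beta> \<in> closed_relations" "\<beta>' \<in> closed_relations"
    and r: "represents h \<beta>" "represents h \<beta>'"
  shows "\<beta> = \<beta>'"
proof (rule extensionalityI[of _ "points Y"])
  fix y assume y: "y \<in> points Y"
  show "\<beta> y = \<beta>' y"
  proof (rule closed_downsets_eqI[OF A.priestley])
    fix W assume "W \<in> clopen_upsets X"
    then obtain a where a: "a \<in> carrier A" "\<phi> a = W" by (rule A.rep_surj)
    have "\<psi> (h a) = {y \<in> points Y. \<beta> y \<inter> \<phi> a \<noteq> {}}" "\<psi> (h a) = {y \<in> points Y. \<beta>' y \<inter> \<phi> a \<noteq> {}}"
      by (rule r(1)[unfolded represents_def, rule_format, OF a(1)],
        rule r(2)[unfolded represents_def, rule_format, OF a(1)])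
    then have "y \<in> {y \<in> points Y. \<beta> y \<inter> \<phi> a \<noteq> {}} \<longleftrightarrow> y \<in> {y \<in> points Y. \<beta>' y \<inter> \<phi> a \<noteq> {}}"
      by (simp only:)
    then show "\<beta> y \<inter> W \<noteq> {} \<longleftrightarrow> \<beta>' y \<inter> W \<noteq> {}" using y a(2) by simp
  qed (use \<beta> y in \<open>auto simp: closed_relations_def\<close>)
qed (use \<beta> in \<open>auto simp: closed_relations_def\<close>)

lemma represents_unique_hom:
  assumes h: "h \<in> carrier A \<rightarrow>\<^sub>E carrier B" "h' \<in> carrier A \<rightarrow>\<^sub>E carrier B"
    and r: "represents h \<beta>" "represents h' \<beta>"
  shows "h = h'"
proof (rule PiE_ext[OF h])
  fix a assume a: "a \<in> carrier A"
  then have "\<psi> (h a) = \<psi> (h' a)" using r by (simp add: represents_def)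
  moreover have "h a \<in> carrier B" "h' a \<in> carrier B" using h a by auto
  ultimately show "h a = h' a" by (simp add: B.rep_inj)
qed

text \<open>With points read as prime filters, \<open>x\<close> is related to \<open>y\<close> iff
  \<open>h\<close> maps the filter of \<open>x\<close> into that of \<open>y\<close>. It is the
  largest relation for which \<open>\<beta> y \<inter> \<phi> a \<noteq> {}\<close> forces
  \<open>y \<in> \<psi> (h a)\<close>.\<close>

definition dual_relation :: "('a \<Rightarrow> 'c) \<Rightarrow> 'd \<Rightarrow> 'b set" where
  "dual_relation h = (\<lambda>y\<in>points Y. {x \<in> points X. \<forall>a\<in>carrier A. x \<in> \<phi> a \<longrightarrow> y \<in> \<psi> (h a)})"

lemma dual_relation_represents:
  assumes h: "h \<in> jsl_hom A B"
  shows "represents h (dual_relation h)"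
  unfolding represents_def
proof (intro ballI equalityI subsetI)
  fix a y assume a: "a \<in> carrier A" and y: "y \<in> \<psi> (h a)"
  have yY: "y \<in> points Y" using B.rep_points[OF jsl_hom_carrier[OF h a]] y by blast
  \<comment> \<open>The preimage under \<open>h\<close> of the ideal of elements avoided by
    \<open>y\<close>; it is an ideal because \<open>h\<close> preserves joins. A point of
    \<open>\<phi> a\<close> that avoids it is related to \<open>y\<close>.\<close>
  let ?J = "{b \<in> carrier A. y \<notin> \<psi> (h b)}"
  have "\<exists>x\<in>\<phi> a. \<forall>b\<in>?J. x \<notin> \<phi> b"
  proof (rule A.ideal_avoiding_point)
    show "\<bottom>\<^bsub>A\<^esub> \<in> ?J" using h B.rep_bottom by (auto simp: jsl_hom_def)
    show "b \<squnion>\<^bsub>A\<^esub> c \<in> ?J" if "b \<in> ?J" "c \<in> ?J" for b c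
      using that h B.rep_join jsl_hom_carrier[OF h] by (simp add: jsl_hom_def)
    show "c \<in> ?J" if b: "b \<in> ?J" and c: "c \<in> carrier A" "\<phi> c \<subseteq> \<phi> b" for b c
    proof -
      have "c \<squnion>\<^bsub>A\<^esub> b = b" using A.rep_le_join b c by simp
      moreover have "h (c \<squnion>\<^bsub>A\<^esub> b) = h c \<squnion>\<^bsub>B\<^esub> h b" using h b c by (simp add: jsl_hom_def)
      ultimately have "h b = h c \<squnion>\<^bsub>B\<^esub> h b" by simp
      then have "\<psi> (h b) = \<psi> (h c) \<union> \<psi> (h b)"
        using B.rep_join[of "h c" "h b"] b c jsl_hom_carrier[OF h] by simp
      then show ?thesis using b c by blast
    qed
  qed (use a y in auto)
  then obtain x where x: "x \<in> \<phi> a" "\<forall>b\<in>?J. x \<notin> \<phi> b" by (elim bexE)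
  then have "x \<in> dual_relation h y"
    using A.rep_points[OF a] yY by (auto simp: dual_relation_def)
  then show "y \<in> {y \<in> points Y. dual_relation h y \<inter> \<phi> a \<noteq> {}}" using x yY by blast
next
  fix a y assume "a \<in> carrier A" "y \<in> {y \<in> points Y. dual_relation h y \<inter> \<phi> a \<noteq> {}}"
  then show "y \<in> \<psi> (h a)" by (auto simp: dual_relation_def)
qed

lemma dual_relation_closed:
  assumes h: "h \<in> jsl_hom A B"
  shows "dual_relation h \<in> closed_relations"
proof -
  have "dual_relation h y \<in> closed_downsets X" if "y \<in> points Y" for y
  proof -
    have "dual_relation h y = {x \<in> points X. \<forall>W\<in>\<phi> ` {a \<in> carrier A. y \<notin> \<psi> (h a)}. x \<notin> W}"
      using that by (auto simp: dual_relation_def)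
    then show ?thesis
      using A.rep_clopen closed_downset_complements[of "\<phi> ` {a \<in> carrier A. y \<notin> \<psi> (h a)}" X] by auto
  qed
  then show ?thesis by (simp add: closed_relations_def dual_relation_def)
qed

lemma dual_relation_priestley: "h \<in> jsl_hom A B \<Longrightarrow> dual_relation h \<in> priestley_relations Y X"
  by (rule represents_priestley[OF dual_relation_closed _ dual_relation_represents])

lemma dual_relation_eqI:
  "h \<in> jsl_hom A B \<Longrightarrow> \<beta> \<in> closed_relations \<Longrightarrow> represents h \<beta> \<Longrightarrow> dual_relation h = \<beta>"
  by (rule represents_unique_relation[OF dual_relation_closed _ dual_relation_represents])

text \<open>A set meets a union iff it meets one of the parts, so the preimage operation preserves
  finite joins; surjectivity of \<open>\<psi>\<close> turns preimages into elements of
  \<open>B\<close>.\<close>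

lemma hom_of_relation:
  assumes \<beta>: "\<beta> \<in> priestley_relations Y X"
  obtains h where "h \<in> jsl_hom A B" "represents h \<beta>"
proof -
  have "\<exists>b\<in>carrier B. \<psi> b = {y \<in> points Y. \<beta> y \<inter> \<phi> a \<noteq> {}}" if "a \<in> carrier A" for a
    using B.rep_surj[OF priestley_relation_preimage[OF \<beta> A.rep_clopen[OF that]]] by metis
  then obtain g where g: "\<And>a. a \<in> carrier A \<Longrightarrow> g a \<in> carrier B \<and> \<psi> (g a) = {y \<in> points Y. \<beta> y \<inter> \<phi> a \<noteq> {}}"
    by metis
  have "\<psi> (g \<bottom>\<^bsub>A\<^esub>) = \<psi> \<bottom>\<^bsub>B\<^esub>" using g[of "\<bottom>\<^bsub>A\<^esub>"] A.rep_bottom B.rep_bottom by simp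
  then have "g \<bottom>\<^bsub>A\<^esub> = \<bottom>\<^bsub>B\<^esub>" using B.rep_inj[of "g \<bottom>\<^bsub>A\<^esub>" "\<bottom>\<^bsub>B\<^esub>"] g[of "\<bottom>\<^bsub>A\<^esub>"] A.bottom_closed B.bottom_closed
    by metis
  moreover have "g (a \<squnion>\<^bsub>A\<^esub> b) = g a \<squnion>\<^bsub>B\<^esub> g b" if ab: "a \<in> carrier A" "b \<in> carrier A" for a b
  proof -
    have c: "g a \<in> carrier B" "g b \<in> carrier B" "g (a \<squnion>\<^bsub>A\<^esub> b) \<in> carrier B" using g ab by simp_all
    have "\<psi> (g (a \<squnion>\<^bsub>A\<^esub> b)) = \<psi> (g a \<squnion>\<^bsub>B\<^esub> g b)"
      unfolding B.rep_join[OF c(1,2)] using g ab A.rep_join[OF ab] by auto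
    then show ?thesis using c B.rep_inj by simp
  qed
  ultimately have "restrict g (carrier A) \<in> jsl_hom A B"
    using g by (simp add: jsl_hom_def)
  moreover have "represents (restrict g (carrier A)) \<beta>" using g by (simp add: represents_def)
  ultimately show thesis by (rule that)
qed

end

section \<open>Tensor powers and powers of the dual space\<close>

lemma Fpow_mem: "S \<in> Fpow X \<Longrightarrow> s \<in> S \<Longrightarrow> s \<in> X"
  by (auto simp: Fpow_def)

lemma UN_Int_UN: "(\<Union>s\<in>S. f s) \<inter> (\<Union>t\<in>T. g t) = (\<Union>p\<in>S \<times> T. f (fst p) \<inter> g (snd p))"
  by auto

lemma UN_Int_Collect: "(\<Union>t\<in>S. {y \<in> P. f y \<inter> g t \<noteq> {}}) = {y \<in> P. f y \<inter> (\<Union>t\<in>S. g t) \<noteq> {}}"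
  by auto

lemma tuple_upd: "t \<in> tuples S k \<Longrightarrow> i < k \<Longrightarrow> a \<in> S \<Longrightarrow> t(i := a) \<in> tuples S k"
  by (auto simp: PiE_iff extensional_def)

lemma partial_order_on_space_power:
  assumes po: "partial_order_on (points X) (ord_rel X)"
  shows "partial_order_on (points (space_power X k)) (ord_rel (space_power X k))"
proof -
  have r: "\<And>x. x \<in> points X \<Longrightarrow> (x, x) \<in> ord_rel X" and t: "trans (ord_rel X)"
    and a: "antisym (ord_rel X)"
    using po by (auto simp: partial_order_on_def preorder_on_def refl_on_def)
  have "refl_on (points (space_power X k)) (ord_rel (space_power X k))"
    using r by (auto simp: refl_on_def space_power_def)
  moreover have "ord_rel (space_power X k) \<subseteq> points (space_power X k) \<times> points (space_power X k)"
    by (auto simp: space_power_def)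
  moreover have "trans (ord_rel (space_power X k))"
    using t by (auto simp: trans_def space_power_def)
  moreover have "antisym (ord_rel (space_power X k))"
  proof (rule antisymI)
    fix x y assume "(x, y) \<in> ord_rel (space_power X k)" "(y, x) \<in> ord_rel (space_power X k)"
    then show "x = y"
      using a by (intro PiE_ext[of x "{..<k}" "\<lambda>_. points X" y]) (auto simp: space_power_def antisym_def)
  qed
  ultimately show ?thesis by (simp add: partial_order_on_def preorder_on_def)
qed

section \<open>Finite unions of boxes as clopen upsets of a power\<close>

context priestley_dual
begin

abbreviation box :: "nat \<Rightarrow> (nat \<Rightarrow> 'a) \<Rightarrow> (nat \<Rightarrow> 'b) set" where
  "box k t \<equiv> PiE {..<k} (\<lambda>i. \<phi> (t i))"

definition boxes :: "nat \<Rightarrow> (nat \<Rightarrow> 'a) set \<Rightarrow> (nat \<Rightarrow> 'b) set" where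
  "boxes k S = (\<Union>t\<in>S. box k t)"

lemma boxes_Un: "boxes k (S \<union> T) = boxes k S \<union> boxes k T"
  by (simp add: boxes_def)

text \<open>Isolating coordinate \<open>i\<close> reduces the bottom and join relations to a
  statement about one membership.\<close>

lemma box_upd:
  "i < k \<Longrightarrow> box k (t(i := a)) = {x \<in> extensional {..<k}. x i \<in> \<phi> a \<and> (\<forall>j<k. j \<noteq> i \<longrightarrow> x j \<in> \<phi> (t j))}"
  by (rule Set.set_eqI) (simp add: PiE_iff Ball_def, metis)

text \<open>Soundness of the tensor relations: a box with an empty side is empty, and a box is
  additive in each side.\<close>

lemma boxes_tensor_cong: "tensor_cong A k S T \<Longrightarrow> boxes k S = boxes k T"
proof (induction rule: tensor_cong.induct)
  case (bottom t i)
  have "boxes k {t(i := \<bottom>)} = box k (t(i := \<bottom>))" by (simp only: boxes_def UN_insert UN_empty Un_empty_right)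
  also have "\<dots> = {}" unfolding box_upd[OF bottom(2)] by (simp add: rep_bottom)
  finally show ?case by (simp add: boxes_def)
next
  case (join t i a b)
  have "boxes k {t(i := a \<squnion> b)} = box k (t(i := a \<squnion> b))"
    "boxes k {t(i := a), t(i := b)} = box k (t(i := a)) \<union> box k (t(i := b))"
    by (simp_all only: boxes_def UN_insert UN_empty Un_empty_right)
  moreover have "box k (t(i := a \<squnion> b)) = box k (t(i := a)) \<union> box k (t(i := b))"
    unfolding box_upd[OF join(2)] rep_join[OF join(3,4)] by blast
  ultimately show ?case by simp
qed (simp_all add: boxes_Un)

lemma rep_meet:
  assumes "a \<in> carrier A" "b \<in> carrier A"
  shows "\<exists>c\<in>carrier A. \<phi> c = \<phi> a \<inter> \<phi> b"
  by (rule rep_surj[OF clopen_upsets_Int[OF rep_clopen[OF assms(1)] rep_clopen[OF assms(2)]]]) auto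

lemma rep_top: "\<exists>c\<in>carrier A. \<phi> c = points X"
  by (rule rep_surj[OF clopen_upsets_points]) auto

lemma box_clopen_upset:
  assumes t: "t \<in> tuples (carrier A) k"
  shows "box k t \<in> clopen_upsets (space_power X k)"
proof -
  have ti: "\<phi> (t i) \<in> clopen_upsets X" if "i < k" for i
    using t that by (intro rep_clopen) auto
  have "openin (product_topology (\<lambda>_. topo X) {..<k}) (box k t)"
    using ti by (simp add: openin_PiE clopen_upsets_def)
  moreover have "closedin (product_topology (\<lambda>_. topo X) {..<k}) (box k t)"
    using ti by (simp add: closedin_product_topology clopen_upsets_def)
  moreover have "is_upset (space_power X k) (box k t)"
    unfolding is_upset_def
  proof (intro conjI ballI impI)
    show "box k t \<subseteq> points (space_power X k)"
      unfolding points_space_power using clopen_upsets_sub[OF ti] by (intro PiE_mono) auto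
    fix x y assume x: "x \<in> box k t" and y: "y \<in> points (space_power X k)"
      "(x, y) \<in> ord_rel (space_power X k)"
    show "y \<in> box k t"
    proof (rule PiE_I)
      fix i assume "i \<in> {..<k}"
      then have i: "i < k" by simp
      then have "x i \<in> \<phi> (t i)" "(x i, y i) \<in> ord_rel X" "y i \<in> points X"
        using x y by (auto simp: space_power_def)
      then show "y i \<in> \<phi> (t i)" using ti[OF i] by (auto simp: clopen_upsets_def is_upset_def)
    qed (use y in \<open>auto simp: space_power_def PiE_iff extensional_def\<close>)
  qed
  ultimately show ?thesis by (simp add: clopen_upsets_def space_power_def)
qed

text \<open>Two boxes intersect in the box of the coordinatewise meets, and intersection distributes
  over the two finite unions.\<close>

lemma boxes_Int:
  assumes S: "S \<in> Fpow (tuples (carrier A) k)" and T: "T \<in> Fpow (tuples (carrier A) k)"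
  shows "\<exists>R\<in>Fpow (tuples (carrier A) k). boxes k S \<inter> boxes k T = boxes k R"
proof -
  have "\<forall>a\<in>carrier A. \<forall>b\<in>carrier A. \<exists>c. c \<in> carrier A \<and> \<phi> c = \<phi> a \<inter> \<phi> b"
    using rep_meet by blast
  then obtain m where m: "\<And>a b. a \<in> carrier A \<Longrightarrow> b \<in> carrier A \<Longrightarrow> m a b \<in> carrier A \<and> \<phi> (m a b) = \<phi> a \<inter> \<phi> b"
    by metis
  define M where "M p = (\<lambda>i\<in>{..<k}. m (fst p i) (snd p i))" for p :: "(nat \<Rightarrow> 'a) \<times> (nat \<Rightarrow> 'a)"
  have st: "fst p \<in> tuples (carrier A) k" "snd p \<in> tuples (carrier A) k" if "p \<in> S \<times> T" for p
    using that by (simp_all add: mem_Times_iff Fpow_mem[OF S] Fpow_mem[OF T])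
  have "box k (fst p) \<inter> box k (snd p) = box k (M p)" if "p \<in> S \<times> T" for p
  proof -
    have "box k (fst p) \<inter> box k (snd p) = PiE {..<k} (\<lambda>i. \<phi> (fst p i) \<inter> \<phi> (snd p i))" by (rule PiE_Int)
    also have "\<dots> = box k (M p)"
      using st[OF that] m by (intro PiE_cong) (simp add: PiE_iff M_def)
    finally show ?thesis .
  qed
  then have "(\<Union>p\<in>S \<times> T. box k (fst p) \<inter> box k (snd p)) = boxes k (M ` (S \<times> T))"
    by (simp add: boxes_def)
  moreover have "boxes k S \<inter> boxes k T = (\<Union>p\<in>S \<times> T. box k (fst p) \<inter> box k (snd p))"
    unfolding boxes_def by (rule UN_Int_UN)
  moreover have "M ` (S \<times> T) \<in> Fpow (tuples (carrier A) k)"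
  proof -
    have "M p \<in> tuples (carrier A) k" if "p \<in> S \<times> T" for p
      using st[OF that] m by (simp add: PiE_iff M_def)
    then show ?thesis using S T by (auto simp: Fpow_def)
  qed
  ultimately show ?thesis by (intro bexI) simp_all
qed

text \<open>\<open>priestley_space_by_sublattice\<close> applies to the finite unions of boxes: they
  form a bounded sublattice, and a failure of the product order is visible in a single
  coordinate.\<close>

lemma power_space:
  shows priestley_power: "priestley_space (space_power X k)"
    and clopen_upsets_power: "clopen_upsets (space_power X k) = boxes k ` Fpow (tuples (carrier A) k)"
proof -
  let ?B = "boxes k ` Fpow (tuples (carrier A) k)"
  obtain u where u: "u \<in> carrier A" "\<phi> u = points X" using rep_top by auto
  have comp: "compact_space (topo (space_power X k))"
    using priestley by (simp add: space_power_def compact_space_product_topology priestley_space_def)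
  have po: "partial_order_on (points (space_power X k)) (ord_rel (space_power X k))"
    using priestley by (intro partial_order_on_space_power) (simp add: priestley_space_def)
  have B: "?B \<subseteq> clopen_upsets (space_power X k)"
  proof
    fix W assume "W \<in> ?B"
    then obtain S where S: "S \<in> Fpow (tuples (carrier A) k)" "W = boxes k S" by auto
    show "W \<in> clopen_upsets (space_power X k)"
      unfolding S(2) boxes_def
      using S(1) by (intro finite_Un_mem clopen_upsets_empty clopen_upsets_Un box_clopen_upset) (auto simp: Fpow_def)
  qed
  have "box k (\<lambda>i\<in>{..<k}. u) = points (space_power X k)"
    unfolding points_space_power using u by (intro PiE_cong) simp
  then have top: "points (space_power X k) \<in> ?B"
    using u by (intro image_eqI[of _ _ "{\<lambda>i\<in>{..<k}. u}"]) (auto simp: boxes_def Fpow_def)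
  have bot: "{} \<in> ?B" by (rule image_eqI[of _ _ "{}"]) (auto simp: boxes_def Fpow_def)
  have Int: "V \<inter> W \<in> ?B" if "V \<in> ?B" "W \<in> ?B" for V W
    using that boxes_Int[of _ k] by (elim imageE) (simp add: image_iff)
  have Un: "V \<union> W \<in> ?B" if VW: "V \<in> ?B" "W \<in> ?B" for V W
  proof -
    obtain S T where "S \<in> Fpow (tuples (carrier A) k)" "V = boxes k S"
        "T \<in> Fpow (tuples (carrier A) k)" "W = boxes k T"
      using VW by auto
    then show ?thesis by (intro image_eqI[of _ _ "S \<union> T"]) (simp_all add: boxes_Un Fpow_Un)
  qed
  have sep: "\<exists>B\<in>?B. x \<in> B \<and> y \<notin> B"
    if x: "x \<in> points (space_power X k)" and y: "y \<in> points (space_power X k)"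
      and n: "(x, y) \<notin> ord_rel (space_power X k)" for x y
  proof -
    have x': "x \<in> tuples (points X) k" and y': "y \<in> tuples (points X) k"
      using x y by (simp_all add: points_space_power)
    obtain i where i: "i < k" "(x i, y i) \<notin> ord_rel X"
      using n x' y' by (auto simp: space_power_def)
    have "x i \<in> points X" "y i \<in> points X" using x' y' i by auto
    then obtain W where W: "W \<in> clopen_upsets X" "x i \<in> W" "y i \<notin> W"
      using priestley i by (auto simp: priestley_space_def)
    obtain a where a: "a \<in> carrier A" "\<phi> a = W" by (rule rep_surj[OF W(1)])
    \<comment> \<open>A box constrained only in the coordinate \<open>i\<close> where the order
      fails; \<open>u\<close> stands for the whole space.\<close>
    let ?t = "\<lambda>j\<in>{..<k}. if j = i then a else u"
    have "?t \<in> tuples (carrier A) k" using a u by auto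
    moreover have "x \<in> box k ?t" using x' a u W by (auto simp: PiE_iff)
    moreover have "y \<notin> box k ?t" using i a W by (auto simp: PiE_iff)
    ultimately show ?thesis
      by (intro bexI[of _ "boxes k {?t}"] imageI) (auto simp: boxes_def Fpow_def)
  qed
  show "priestley_space (space_power X k)"
    by (rule priestley_space_by_sublattice[OF comp po B top bot]) (fact Int Un sep)+
  show "clopen_upsets (space_power X k) = ?B"
    by (rule priestley_space_by_sublattice[OF comp po B top bot]) (fact Int Un sep)+
qed

section \<open>Boxes determine tensors\<close>

context
  fixes k T assumes T: "T \<in> Fpow (tuples (carrier A) k)"
begin

text \<open>By \<open>tensor_le_iff\<close> this says that the pure tensor of the tuple
  \<open>u\<close> lies below the class of \<open>T\<close>, written on representatives.\<close>

definition below :: "(nat \<Rightarrow> 'a) \<Rightarrow> bool" where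
  "below u \<longleftrightarrow> tensor_cong A k (insert u T) T"

text \<open>Together with \<open>below_join\<close> and \<open>below_upd_mono\<close> this makes the
  entries admissible in one coordinate, with the other entries fixed, an ideal of
  \<open>A\<close>.\<close>

lemma below_bottom:
  assumes "u \<in> tuples (carrier A) k" "i < k"
  shows "below (u(i := \<bottom>))"
  using tensor_cong.union[OF tensor_cong.bottom[OF assms] tensor_cong.refl[OF T]]
  by (simp add: below_def)

lemma below_join:
  assumes u: "u \<in> tuples (carrier A) k" "i < k" and ab: "a \<in> carrier A" "b \<in> carrier A"
    and a: "below (u(i := a))" and b: "below (u(i := b))"
  shows "below (u(i := a \<squnion> b))"
proof -
  have 1: "tensor_cong A k ({u(i := a \<squnion> b)} \<union> T) ({u(i := a), u(i := b)} \<union> T)"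
    by (rule tensor_cong.union[OF tensor_cong.join[OF u ab] tensor_cong.refl[OF T]])
  have 2: "tensor_cong A k (insert (u(i := a)) T \<union> insert (u(i := b)) T) (T \<union> T)"
    using a b unfolding below_def by (rule tensor_cong.union)
  have "insert (u(i := a)) T \<union> insert (u(i := b)) T = {u(i := a), u(i := b)} \<union> T" by blast
  then have "tensor_cong A k ({u(i := a \<squnion> b)} \<union> T) (T \<union> T)"
    using 2 by (intro tensor_cong.trans[OF 1]) (simp only:)
  then show ?thesis by (simp only: below_def Un_absorb Un_insert_left Un_empty_left)
qed

text \<open>Since \<open>b \<squnion> u i = u i\<close>, the join relation in coordinate
  \<open>i\<close> identifies \<open>{u}\<close> with \<open>{u(i := b), u}\<close>. So
  \<open>u(i := b)\<close> lies below \<open>u\<close>, which lies below \<open>T\<close>.\<close>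

lemma below_upd_mono:
  assumes u: "u \<in> tuples (carrier A) k" "i < k" and b: "b \<in> carrier A" "\<phi> b \<subseteq> \<phi> (u i)"
    and bel: "below u"
  shows "below (u(i := b))"
proof -
  have ui: "u i \<in> carrier A" using u by auto
  have "tensor_cong A k {u(i := b \<squnion> u i)} {u(i := b), u(i := u i)}"
    by (rule tensor_cong.join[OF u b(1) ui])
  then have 1: "tensor_cong A k {u} {u(i := b), u}"
    by (simp only: rep_le_join[OF b(1) ui b(2)] fun_upd_triv)
  have 3: "tensor_cong A k ({u(i := b), u} \<union> T) ({u} \<union> T)"
    by (rule tensor_cong.sym[OF tensor_cong.union[OF 1 tensor_cong.refl[OF T]]])
  have 4: "{u(i := b), u} \<union> T = {u(i := b)} \<union> insert u T" by blast
  have "tensor_cong A k ({u} \<union> T) T" using bel by (simp add: below_def)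
  then have 2: "tensor_cong A k ({u(i := b)} \<union> insert u T) T"
    by (rule tensor_cong.trans[OF 3[unfolded 4]])
  have "{u(i := b)} \<in> Fpow (tuples (carrier A) k)"
    using tuple_upd[OF u b(1)] by (auto simp: Fpow_def)
  then have "tensor_cong A k ({u(i := b)} \<union> T) ({u(i := b)} \<union> insert u T)"
    using bel unfolding below_def by (rule tensor_cong.union[OF tensor_cong.refl tensor_cong.sym])
  then have "tensor_cong A k ({u(i := b)} \<union> T) T" using 2 by (rule tensor_cong.trans)
  then show ?thesis by (simp add: below_def)
qed

lemma below_mono:
  assumes u: "u \<in> tuples (carrier A) k" and v: "v \<in> tuples (carrier A) k"
    and le: "\<And>j. j < k \<Longrightarrow> \<phi> (v j) \<subseteq> \<phi> (u j)" and bel: "below u"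
  shows "below v"
proof -
  \<comment> \<open>The entries of \<open>u\<close> are lowered to those of \<open>v\<close> one
    coordinate at a time.\<close>
  have "below (\<lambda>j. if j < m then v j else u j)" if "m \<le> k" for m
    using that
  proof (induction m)
    case 0
    then show ?case using bel by simp
  next
    case (Suc m)
    let ?w = "\<lambda>j. if j < m then v j else u j"
    have "?w \<in> tuples (carrier A) k" using u v by (auto simp: PiE_iff extensional_def)
    then have "below (?w(m := v m))"
      using Suc v le by (intro below_upd_mono) auto
    moreover have "?w(m := v m) = (\<lambda>j. if j < Suc m then v j else u j)" by (auto simp: less_Suc_eq)
    ultimately show ?case by simp
  qed
  from this[of k] have "below (\<lambda>j. if j < k then v j else u j)" by simp
  moreover have "(\<lambda>j. if j < k then v j else u j) = v" using u v by (auto simp: PiE_iff extensional_def)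
  ultimately show ?thesis by simp
qed

text \<open>A point of the box of \<open>t\<close> outside the boxes of \<open>T\<close> is found one coordinate at a time: the
  elements which may replace \<open>t i\<close> without leaving the ideal generated by \<open>T\<close>, after the
  coordinates before \<open>i\<close> have been shrunk towards the points chosen so far, form an ideal.\<close>

lemma exists_point_not_below:
  assumes t: "t \<in> tuples (carrier A) k" and nb: "\<not> below t" and i: "i \<le> k"
  shows "\<exists>x. (\<forall>j<i. x j \<in> \<phi> (t j)) \<and> (\<forall>u\<in>tuples (carrier A) k.
    (\<forall>j<i. x j \<in> \<phi> (u j)) \<and> (\<forall>j. i \<le> j \<longrightarrow> u j = t j) \<longrightarrow> \<not> below u)"
  using i
proof (induction i)
  case 0
  have "u = t" if "\<forall>j. u j = t j" for u using that by auto
  then show ?case using nb by auto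
next
  case (Suc i)
  obtain x where x0: "\<forall>j<i. x j \<in> \<phi> (t j)" "\<forall>u\<in>tuples (carrier A) k.
    (\<forall>j<i. x j \<in> \<phi> (u j)) \<and> (\<forall>j. i \<le> j \<longrightarrow> u j = t j) \<longrightarrow> \<not> below u"
    using Suc.IH[OF Suc_leD[OF Suc.prems]] by (elim exE conjE)
  have x: "x j \<in> \<phi> (t j)" if "j < i" for j using x0(1) that by simp
  have nx: "\<not> below u" if "u \<in> tuples (carrier A) k" "\<forall>j<i. x j \<in> \<phi> (u j)" "\<forall>j. i \<le> j \<longrightarrow> u j = t j" for u
    using x0(2)[rule_format, OF that(1)] that by simp
  have ik: "i < k" using Suc by simp
  \<comment> \<open>The tuple \<open>u\<close> has shrunk entries around the chosen points before
    \<open>i\<close>, a free entry at \<open>i\<close>, and the entries of \<open>t\<close> after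
    \<open>i\<close>.\<close>
  let ?P = "\<lambda>u. u \<in> tuples (carrier A) k \<and> (\<forall>j<i. x j \<in> \<phi> (u j)) \<and> (\<forall>j. i < j \<longrightarrow> u j = t j) \<and> below u"
  let ?J = "{u i |u. ?P u}"
  have JC: "?J \<subseteq> carrier A" using ik by auto
  have Jb: "\<bottom> \<in> ?J"
  proof -
    have "?P (t(i := \<bottom>))" using x tuple_upd[OF t ik bottom_closed] below_bottom[OF t ik] by simp
    then show ?thesis by (intro CollectI exI[of _ "t(i := \<bottom>)"] conjI) simp_all
  qed
  have Jj: "a \<squnion> b \<in> ?J" if a: "a \<in> ?J" and b: "b \<in> ?J" for a b
  proof -
    obtain u where u: "?P u" "a = u i" using a by (elim CollectE exE conjE) simp
    obtain v where v: "?P v" "b = v i" using b by (elim CollectE exE conjE) simp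
    \<comment> \<open>The witnesses for \<open>a\<close> and \<open>b\<close> may shrink the earlier
      coordinates differently, whereas the join relation needs tuples that differ only at
      \<open>i\<close>. Both are pushed down to the meets of their earlier entries, which still
      contain the chosen points.\<close>
    have "\<exists>c. c \<in> carrier A \<and> \<phi> c = \<phi> (u j) \<inter> \<phi> (v j)" if "j < i" for j
    proof -
      have "u j \<in> carrier A" "v j \<in> carrier A"
        using u(1) v(1) that ik by (simp_all add: PiE_iff)
      then show ?thesis using rep_meet by blast
    qed
    then obtain m where m: "\<And>j. j < i \<Longrightarrow> m j \<in> carrier A \<and> \<phi> (m j) = \<phi> (u j) \<inter> \<phi> (v j)" by metis
    let ?w = "\<lambda>j. if j < i then m j else t j"
    have w: "?w \<in> tuples (carrier A) k" using t m ik by (simp add: PiE_iff extensional_def)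
    have ab: "a \<in> carrier A" "b \<in> carrier A" by (rule subsetD[OF JC a], rule subsetD[OF JC b])
    have le: "\<phi> ((?w(i := c)) j) \<subseteq> \<phi> (z j)" if "z \<in> {u, v}" "c = z i" for c z j
    proof (cases j i rule: linorder_cases)
      case less
      then show ?thesis using m that by auto
    next
      case equal
      then show ?thesis using that by simp
    next
      case greater
      then show ?thesis using u(1) v(1) that by auto
    qed
    have "below (?w(i := a))"
      by (rule below_mono[of u]) (use u tuple_upd[OF w ik ab(1)] le[of u a] in simp_all)
    moreover have "below (?w(i := b))"
      by (rule below_mono[of v]) (use v tuple_upd[OF w ik ab(2)] le[of v b] in simp_all)
    ultimately have "below (?w(i := a \<squnion> b))" by (rule below_join[OF w ik ab])
    then have "?P (?w(i := a \<squnion> b))"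
      using tuple_upd[OF w ik join_closed[OF ab]] m u(1) v(1) by simp
    then show ?thesis by (intro CollectI exI[of _ "?w(i := a \<squnion> b)"] conjI) simp_all
  qed
  have Jd: "b \<in> ?J" if a: "a \<in> ?J" and b: "b \<in> carrier A" "\<phi> b \<subseteq> \<phi> a" for a b
  proof -
    obtain u where u: "?P u" "a = u i" using a by (elim CollectE exE conjE) simp
    have uA: "u \<in> tuples (carrier A) k" using u(1) by simp
    have "below (u(i := b))"
      using below_upd_mono[OF uA ik b(1)] b(2) u by simp
    then have "?P (u(i := b))" using u(1) tuple_upd[OF uA ik b(1)] by simp
    then show ?thesis by (intro CollectI exI[of _ "u(i := b)"] conjI) simp_all
  qed
  \<comment> \<open>A witness would agree with \<open>t\<close> from \<open>i\<close> on, which the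
    choice of the earlier points excludes.\<close>
  have tJ: "t i \<notin> ?J"
  proof
    assume "t i \<in> ?J"
    then obtain u where u: "?P u" "t i = u i" by (elim CollectE exE conjE) simp
    have "u j = t j" if "i \<le> j" for j using u that by (cases "i = j") simp_all
    then show False using nx[of u] u(1) by simp
  qed
  have ti: "t i \<in> carrier A" using t ik by auto
  have "\<exists>y\<in>\<phi> (t i). \<forall>b\<in>?J. y \<notin> \<phi> b"
    by (rule ideal_avoiding_point) (fact JC Jb Jj Jd ti tJ)+
  then obtain y where y: "y \<in> \<phi> (t i)" "\<forall>b\<in>?J. y \<notin> \<phi> b" by (elim bexE)
  show ?case
  proof (intro exI[of _ "x(i := y)"] conjI allI impI ballI)
    fix j assume "j < Suc i"
    then show "(x(i := y)) j \<in> \<phi> (t j)" using x y(1) by (cases "j = i") simp_all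
  next
    fix u assume u: "u \<in> tuples (carrier A) k"
      "(\<forall>j<Suc i. (x(i := y)) j \<in> \<phi> (u j)) \<and> (\<forall>j. Suc i \<le> j \<longrightarrow> u j = t j)"
    show "\<not> below u"
    proof
      assume "below u"
      moreover have "\<forall>j<i. x j \<in> \<phi> (u j)"
      proof (intro allI impI)
        fix j assume "j < i" then show "x j \<in> \<phi> (u j)" using u(2)[THEN conjunct1, rule_format, of j] by simp
      qed
      moreover have "\<forall>j. i < j \<longrightarrow> u j = t j" using u(2) by (simp add: Suc_le_eq)
      ultimately have "?P u" using u(1) by blast
      then have "u i \<in> ?J" by blast
      then have "y \<notin> \<phi> (u i)" by (rule y(2)[THEN bspec])
      then show False using u(2)[THEN conjunct1, rule_format, of i] by simp
    qed
  qed
qed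

text \<open>For \<open>i = k\<close>, \<open>exists_point_not_below\<close> gives a point of the box
  of \<open>t\<close> that lies in no box of a tuple below \<open>T\<close>. But each member of
  \<open>T\<close> is below \<open>T\<close>, so the point escapes \<open>boxes k T\<close>.\<close>

lemma below_if_box_subset:
  assumes t: "t \<in> tuples (carrier A) k" and sub: "box k t \<subseteq> boxes k T"
  shows "below t"
proof (rule ccontr)
  assume "\<not> below t"
  then obtain x where x: "\<forall>j<k. x j \<in> \<phi> (t j)"
    and nx: "\<forall>u\<in>tuples (carrier A) k. (\<forall>j<k. x j \<in> \<phi> (u j)) \<and> (\<forall>j. k \<le> j \<longrightarrow> u j = t j) \<longrightarrow> \<not> below u"
    using exists_point_not_below[OF t, of k] by auto
  have "restrict x {..<k} \<in> box k t" using x by auto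
  then have "restrict x {..<k} \<in> boxes k T" by (rule subsetD[OF sub])
  then obtain s where s: "s \<in> T" "restrict x {..<k} \<in> box k s" unfolding boxes_def by (elim UN_E)
  have sA: "s \<in> tuples (carrier A) k" by (rule Fpow_mem[OF T s(1)])
  have "\<forall>j<k. x j \<in> \<phi> (s j)" using s(2) by (auto simp: PiE_iff)
  \<comment> \<open>Beyond \<open>k\<close> both tuples take the default value of extensional
    functions.\<close>
  moreover have "\<forall>j. k \<le> j \<longrightarrow> s j = t j" using sA t by (auto simp: PiE_iff extensional_def)
  ultimately have "\<not> below s" using nx sA by simp
  moreover have "below s" using s T by (simp add: below_def insert_absorb tensor_cong.refl)
  ultimately show False by simp
qed

lemma tensor_cong_if_boxes_subset:
  assumes S: "S \<in> Fpow (tuples (carrier A) k)" and sub: "boxes k S \<subseteq> boxes k T"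
  shows "tensor_cong A k (S \<union> T) T"
proof -
  have "finite S" "S \<subseteq> tuples (carrier A) k" using S by (auto simp: Fpow_def)
  then show ?thesis using sub
  proof (induction S)
    case empty
    then show ?case using T by (simp add: tensor_cong.refl)
  next
    case (insert s S)
    then have "tensor_cong A k (S \<union> T) T" "below s"
      using below_if_box_subset[of s] by (auto simp: boxes_def)
    then have "tensor_cong A k (insert s T \<union> (S \<union> T)) (T \<union> T)"
      unfolding below_def by (intro tensor_cong.union)
    moreover have "insert s T \<union> (S \<union> T) = insert s S \<union> T" by blast
    ultimately show ?case by simp
  qed
qed

end

lemma boxes_eq_iff:
  assumes S: "S \<in> Fpow (tuples (carrier A) k)" and T: "T \<in> Fpow (tuples (carrier A) k)"
  shows "boxes k S = boxes k T \<longleftrightarrow> tensor_class A k S = tensor_class A k T"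
proof
  assume eq: "boxes k S = boxes k T"
  have "tensor_cong A k (S \<union> T) T" "tensor_cong A k (T \<union> S) S"
    using eq by (simp_all add: tensor_cong_if_boxes_subset S T)
  then have "tensor_cong A k S T" by (metis sup_commute tensor_cong.sym tensor_cong.trans)
  then show "tensor_class A k S = tensor_class A k T" by (simp add: tensor_class_eq_iff S)
next
  assume "tensor_class A k S = tensor_class A k T"
  then show "boxes k S = boxes k T" using boxes_tensor_cong tensor_class_eq_iff[OF S] by simp
qed

text \<open>All representatives of a class have the same boxes, so the union avoids choosing
  one.\<close>

definition rep_tensor :: "nat \<Rightarrow> 'a tensor \<Rightarrow> (nat \<Rightarrow> 'b) set" where
  "rep_tensor k c = (\<Union>S\<in>c. boxes k S)"

lemma rep_tensor_class:
  assumes S: "S \<in> Fpow (tuples (carrier A) k)"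
  shows "rep_tensor k (tensor_class A k S) = boxes k S"
proof -
  have "S \<in> tensor_class A k S" using S by (simp add: tensor_class_def tensor_cong.refl)
  then show ?thesis
    unfolding rep_tensor_def
  proof (rule UN_constant_eq, intro ballI)
    fix T assume "T \<in> tensor_class A k S"
    then have "boxes k S = boxes k T" by (intro boxes_tensor_cong) (simp add: tensor_class_def)
    then show "boxes k T = boxes k S" by (rule HOL.sym)
  qed
qed

text \<open>With this, the duality for join-preserving maps applies to operators and to tensor
  powers of maps.\<close>

theorem tensor_dual: "priestley_dual (tensor_power A k) (space_power X k) (rep_tensor k)"
proof -
  interpret T: jsl "tensor_power A k" by (rule tensor_jsl)
  show ?thesis
  proof
    show "priestley_space (space_power X k)" by (rule priestley_power)
    show "bij_betw (rep_tensor k) (carrier (tensor_power A k)) (clopen_upsets (space_power X k))"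
      unfolding bij_betw_def
    proof
      show "inj_on (rep_tensor k) (carrier (tensor_power A k))"
      proof (rule inj_onI)
        fix c d assume "c \<in> carrier (tensor_power A k)" "d \<in> carrier (tensor_power A k)"
          "rep_tensor k c = rep_tensor k d"
        then show "c = d" by (elim tensor_carrierE) (simp add: rep_tensor_class boxes_eq_iff)
      qed
      show "rep_tensor k ` carrier (tensor_power A k) = clopen_upsets (space_power X k)"
        unfolding clopen_upsets_power tensor_power_def
        by (simp add: image_image rep_tensor_class cong: image_cong_simp)
    qed
    show "rep_tensor k \<bottom>\<^bsub>tensor_power A k\<^esub> = {}"
      unfolding tensor_bottom by (subst rep_tensor_class) (auto simp: Fpow_def boxes_def)
    fix c d assume "c \<in> carrier (tensor_power A k)" "d \<in> carrier (tensor_power A k)"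
    then show "rep_tensor k (c \<squnion>\<^bsub>tensor_power A k\<^esub> d) = rep_tensor k c \<union> rep_tensor k d"
      by (elim tensor_carrierE) (simp add: tensor_join rep_tensor_class Fpow_Un boxes_Un)
  qed
qed

end

section \<open>Product relations as duals of tensor powers of maps\<close>

lemma map_tuples_Fpow:
  assumes h: "h \<in> jsl_hom A B" and S: "S \<in> Fpow (tuples (carrier A) k)"
  shows "(\<lambda>t. \<lambda>i\<in>{..<k}. h (t i)) ` S \<in> Fpow (tuples (carrier B) k)"
proof -
  let ?h = "\<lambda>t. \<lambda>i\<in>{..<k}. h (t i)"
  have "?h t \<in> tuples (carrier B) k" if "t \<in> tuples (carrier A) k" for t
    using that h by (auto simp: jsl_hom_def PiE_iff)
  then have "?h ` S \<subseteq> tuples (carrier B) k"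
    using Fpow_mem[OF S] by (intro image_subsetI) simp
  moreover have "finite (?h ` S)" using S by (simp add: Fpow_def)
  ultimately show ?thesis by (simp add: Fpow_def del: restrict_apply)
qed

lemma tensor_map_hom:
  assumes A: "jsl A" and B: "jsl B" and h: "h \<in> jsl_hom A B"
  shows "tensor_map A B k h \<in> jsl_hom (tensor_power A k) (tensor_power B k)"
proof -
  interpret A: jsl A by (rule A)
  interpret B: jsl B by (rule B)
  let ?h = "\<lambda>t. \<lambda>i\<in>{..<k}. h (t i)"
  note im = map_tuples_Fpow[OF h, of _ k]
  note tm = A.tensor_map_class[OF B h]
  show ?thesis
    unfolding jsl_hom_def mem_Collect_eq
  proof (intro conjI ballI)
    show "tensor_map A B k h \<in> carrier (tensor_power A k) \<rightarrow>\<^sub>E carrier (tensor_power B k)"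
    proof (rule PiE_I)
      fix c assume "c \<in> carrier (tensor_power A k)"
      then show "tensor_map A B k h c \<in> carrier (tensor_power B k)"
        by (elim A.tensor_carrierE) (simp add: tm im B.tensor_class_carrier del: restrict_apply)
    qed (simp add: tensor_map_def)
    show "tensor_map A B k h \<bottom>\<^bsub>tensor_power A k\<^esub> = \<bottom>\<^bsub>tensor_power B k\<^esub>"
      unfolding A.tensor_bottom B.tensor_bottom by (subst tm) (auto simp: Fpow_def)
    fix c d assume "c \<in> carrier (tensor_power A k)" "d \<in> carrier (tensor_power A k)"
    then show "tensor_map A B k h (c \<squnion>\<^bsub>tensor_power A k\<^esub> d) =
        tensor_map A B k h c \<squnion>\<^bsub>tensor_power B k\<^esub> tensor_map A B k h d"
      by (elim A.tensor_carrierE)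
        (simp add: A.tensor_join tm im B.tensor_join A.Fpow_Un image_Un del: restrict_apply)
  qed
qed

context priestley_dual_pair
begin

lemma tensor_pair:
  "priestley_dual_pair (tensor_power A k) (space_power X k) (A.rep_tensor k)
    (tensor_power B k) (space_power Y k) (B.rep_tensor k)"
  by (intro priestley_dual_pair.intro A.tensor_dual B.tensor_dual)

definition power_relation :: "nat \<Rightarrow> ('d \<Rightarrow> 'b set) \<Rightarrow> (nat \<Rightarrow> 'd) \<Rightarrow> (nat \<Rightarrow> 'b) set" where
  "power_relation k \<beta> = (\<lambda>y\<in>tuples (points Y) k. PiE {..<k} (\<lambda>i. \<beta> (y i)))"

text \<open>The product of the sets \<open>\<beta> (y i) \<inter> \<phi> (t i)\<close> is nonempty
  iff every factor is. Hence the box of the image tuple consists of the \<open>y\<close> whose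
  product value meets the box of \<open>t\<close>, and unions extend this to all tensors. The values
  are closed downsets, so continuity then comes from \<open>represents_priestley\<close>.\<close>

lemma power_relation_priestley:
  assumes h: "h \<in> jsl_hom A B" and \<beta>: "\<beta> \<in> priestley_relations Y X" and r: "represents h \<beta>"
  shows "power_relation k \<beta> \<in> priestley_relations (space_power Y k) (space_power X k)"
    and "priestley_dual_pair.represents (tensor_power A k) (A.rep_tensor k) (space_power Y k)
      (B.rep_tensor k) (tensor_map A B k h) (power_relation k \<beta>)"
proof -
  interpret P: priestley_dual_pair "tensor_power A k" "space_power X k" "A.rep_tensor k"
    "tensor_power B k" "space_power Y k" "B.rep_tensor k"
    by (rule tensor_pair)
  have jA: "jsl A" and jB: "jsl B" by unfold_locales
  note th = tensor_map_hom[OF jA jB h, of k]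
  let ?h = "\<lambda>t. \<lambda>i\<in>{..<k}. h (t i)"
  note im = map_tuples_Fpow[OF h, of _ k]
  show rep: "P.represents (tensor_map A B k h) (power_relation k \<beta>)"
    unfolding P.represents_def
  proof
    fix c assume "c \<in> carrier (tensor_power A k)"
    then obtain S where S: "S \<in> Fpow (tuples (carrier A) k)" "c = tensor_class A k S"
      by (rule A.tensor_carrierE)
    have box: "B.box k (?h t) = {y \<in> tuples (points Y) k. power_relation k \<beta> y \<inter> A.box k t \<noteq> {}}"
      if "t \<in> S" for t
    proof -
      have t: "t \<in> tuples (carrier A) k" by (rule Fpow_mem[OF S(1) that])
      have ht: "\<psi> (?h t i) = {y \<in> points Y. \<beta> y \<inter> \<phi> (t i) \<noteq> {}}" if "i < k" for i
      proof -
        have "t i \<in> carrier A" using t that by (simp add: PiE_iff)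
        then show ?thesis using r that by (simp add: represents_def)
      qed
      have pr: "power_relation k \<beta> y \<inter> A.box k t \<noteq> {} \<longleftrightarrow> (\<forall>i<k. \<beta> (y i) \<inter> \<phi> (t i) \<noteq> {})"
        if "y \<in> tuples (points Y) k" for y
        using that by (simp add: power_relation_def PiE_Int PiE_eq_empty_iff Ball_def)
      have "B.box k (?h t) = PiE {..<k} (\<lambda>i. {y \<in> points Y. \<beta> y \<inter> \<phi> (t i) \<noteq> {}})"
        by (intro PiE_cong) (simp only: ht lessThan_iff)
      also have "\<dots> = {y \<in> tuples (points Y) k. \<forall>i<k. \<beta> (y i) \<inter> \<phi> (t i) \<noteq> {}}"
        by (rule Set.set_eqI) (simp add: PiE_iff, blast)
      also have "\<dots> = {y \<in> tuples (points Y) k. power_relation k \<beta> y \<inter> A.box k t \<noteq> {}}"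
        by (intro Collect_cong conj_cong HOL.refl) (simp only: pr)
      finally show ?thesis .
    qed
    have "B.rep_tensor k (tensor_map A B k h c) = (\<Union>t\<in>S. B.box k (?h t))"
      unfolding S(2) A.tensor_map_class[OF jB h S(1)] B.rep_tensor_class[OF im[OF S(1)]] B.boxes_def
      by simp
    also have "\<dots> = {y \<in> tuples (points Y) k. power_relation k \<beta> y \<inter> A.boxes k S \<noteq> {}}"
      by (simp only: box A.boxes_def UN_Int_Collect cong: SUP_cong)
    also have "A.boxes k S = A.rep_tensor k c"
      unfolding S(2) A.rep_tensor_class[OF S(1)] ..
    finally show "B.rep_tensor k (tensor_map A B k h c) =
        {y \<in> points (space_power Y k). power_relation k \<beta> y \<inter> A.rep_tensor k c \<noteq> {}}"
      by (simp add: points_space_power)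
  qed
  have "power_relation k \<beta> \<in> P.closed_relations"
  proof -
    have "power_relation k \<beta> y \<in> closed_downsets (space_power X k)" if y: "y \<in> tuples (points Y) k" for y
    proof -
      have d: "\<beta> (y i) \<in> closed_downsets X" if "i < k" for i
        using priestley_relation_closed_downset[OF \<beta>, of "y i"] y that by auto
      have "closedin (product_topology (\<lambda>_. topo X) {..<k}) (PiE {..<k} (\<lambda>i. \<beta> (y i)))"
        using d by (simp add: closedin_product_topology closed_downsets_def)
      moreover have "is_downset (space_power X k) (PiE {..<k} (\<lambda>i. \<beta> (y i)))"
        unfolding is_downset_def
      proof (intro conjI ballI impI)
        show "PiE {..<k} (\<lambda>i. \<beta> (y i)) \<subseteq> points (space_power X k)"
          unfolding points_space_power
          using d by (intro PiE_mono) (auto simp: closed_downsets_def is_downset_def)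
        fix x x' assume x: "x \<in> PiE {..<k} (\<lambda>i. \<beta> (y i))" "x' \<in> points (space_power X k)"
          "(x', x) \<in> ord_rel (space_power X k)"
        show "x' \<in> PiE {..<k} (\<lambda>i. \<beta> (y i))"
        proof (rule PiE_I)
          fix i assume "i \<in> {..<k}"
          then have i: "i < k" by simp
          then have "x i \<in> \<beta> (y i)" "(x' i, x i) \<in> ord_rel X" "x' i \<in> points X"
            using x by (auto simp: space_power_def)
          then show "x' i \<in> \<beta> (y i)" using d[OF i] by (auto simp: closed_downsets_def is_downset_def)
        qed (use x in \<open>auto simp: space_power_def PiE_iff extensional_def\<close>)
      qed
      ultimately show ?thesis using y by (simp add: closed_downsets_def power_relation_def space_power_def)
    qed
    then show ?thesis
      by (simp add: P.closed_relations_def points_space_power) (simp add: power_relation_def)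
  qed
  then show "power_relation k \<beta> \<in> priestley_relations (space_power Y k) (space_power X k)"
    by (rule P.represents_priestley[OF _ th rep])
qed

end

section \<open>Prime filters\<close>

context bounded_distrib_lattice
begin

lemma le_bottom: "x \<in> carrier L \<Longrightarrow> \<bottom> \<sqsubseteq> x" and le_top: "x \<in> carrier L \<Longrightarrow> x \<sqsubseteq> \<top>"
  by (rule bottom_lower, assumption) (rule top_higher, assumption)

definition lattice_filter :: "'a set \<Rightarrow> bool" where
  "lattice_filter F \<longleftrightarrow> F \<subseteq> carrier L \<and> \<top> \<in> F \<and> (\<forall>x\<in>F. \<forall>y\<in>F. x \<sqinter> y \<in> F) \<and>
    (\<forall>x\<in>F. \<forall>y\<in>carrier L. x \<sqsubseteq> y \<longrightarrow> y \<in> F)"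

definition lattice_ideal :: "'a set \<Rightarrow> bool" where
  "lattice_ideal J \<longleftrightarrow> J \<subseteq> carrier L \<and> \<bottom> \<in> J \<and> (\<forall>x\<in>J. \<forall>y\<in>J. x \<squnion> y \<in> J) \<and>
    (\<forall>x\<in>J. \<forall>y\<in>carrier L. y \<sqsubseteq> x \<longrightarrow> y \<in> J)"

lemma lattice_filterD:
  assumes "lattice_filter F"
  shows "x \<in> F \<Longrightarrow> x \<in> carrier L" "\<top> \<in> F" "x \<in> F \<Longrightarrow> y \<in> F \<Longrightarrow> x \<sqinter> y \<in> F"
    "x \<in> F \<Longrightarrow> y \<in> carrier L \<Longrightarrow> x \<sqsubseteq> y \<Longrightarrow> y \<in> F"
  using assms by (auto simp: lattice_filter_def)

lemma lattice_idealD: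
  assumes "lattice_ideal J"
  shows "x \<in> J \<Longrightarrow> x \<in> carrier L" "\<bottom> \<in> J" "x \<in> J \<Longrightarrow> y \<in> J \<Longrightarrow> x \<squnion> y \<in> J"
    "x \<in> J \<Longrightarrow> y \<in> carrier L \<Longrightarrow> y \<sqsubseteq> x \<Longrightarrow> y \<in> J"
  using assms by (auto simp: lattice_ideal_def)

lemma meet_mono_left: "x \<in> carrier L \<Longrightarrow> y \<in> carrier L \<Longrightarrow> z \<in> carrier L \<Longrightarrow> x \<sqsubseteq> y \<Longrightarrow> x \<sqinter> z \<sqsubseteq> y \<sqinter> z"
  by (rule meet_le) (simp_all add: meet_right le_trans[OF meet_left])

lemma lattice_filter_Union:
  assumes ne: "C \<noteq> {}" and ch: "subset.chain \<A> C" and F: "\<And>F. F \<in> C \<Longrightarrow> lattice_filter F"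
  shows "lattice_filter (\<Union>C)"
proof -
  have "x \<sqinter> y \<in> \<Union>C" if x: "x \<in> \<Union>C" and y: "y \<in> \<Union>C" for x y
  proof -
    obtain F G where FG: "F \<in> C" "x \<in> F" "G \<in> C" "y \<in> G" using x y by (elim UnionE)
    have "F \<subseteq> G \<or> G \<subseteq> F" using ch FG by (auto simp: subset_chain_def)
    then obtain K where "K \<in> C" "x \<in> K" "y \<in> K" using FG by (elim disjE) (blast+)
    then show ?thesis using lattice_filterD(3)[OF F] by blast
  qed
  moreover have "\<Union>C \<subseteq> carrier L" using lattice_filterD(1)[OF F] by blast
  moreover have "\<top> \<in> \<Union>C" using ne lattice_filterD(2)[OF F] by blast
  moreover have "y \<in> \<Union>C" if "x \<in> \<Union>C" "y \<in> carrier L" "x \<sqsubseteq> y" for x y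
    using that lattice_filterD(4)[OF F] by blast
  ultimately show ?thesis unfolding lattice_filter_def by simp
qed

text \<open>Zorn's lemma gives a filter \<open>M\<close> maximal among those that contain
  \<open>G\<close> and avoid \<open>J\<close>; distributivity makes it prime.\<close>

theorem prime_filter_theorem:
  assumes G: "lattice_filter G" and J: "lattice_ideal J" and dis: "G \<inter> J = {}"
  shows "\<exists>F\<in>prime_filters L. G \<subseteq> F \<and> F \<inter> J = {}"
proof -
  let ?A = "{F. lattice_filter F \<and> G \<subseteq> F \<and> F \<inter> J = {}}"
  have "\<exists>M\<in>?A. \<forall>X\<in>?A. M \<subseteq> X \<longrightarrow> X = M"
  proof (rule subset_Zorn_nonempty)
    show "?A \<noteq> {}" using G dis by blast
    fix C assume C: "C \<noteq> {}" "subset.chain ?A C"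
    then have C': "F \<in> C \<Longrightarrow> F \<in> ?A" for F by (auto simp: subset_chain_def)
    have "lattice_filter (\<Union>C)" using C C' by (intro lattice_filter_Union) auto
    moreover have "G \<subseteq> \<Union>C" using C(1) C' by blast
    moreover have "\<Union>C \<inter> J = {}" using C' by blast
    ultimately show "\<Union>C \<in> ?A" by simp
  qed
  then obtain M where "M \<in> ?A" and max: "\<forall>X\<in>?A. M \<subseteq> X \<longrightarrow> X = M" by (elim bexE)
  then have M: "lattice_filter M" and GM: "G \<subseteq> M" and MJ: "M \<inter> J = {}" by simp_all
  note Mc = lattice_filterD(1)[OF M] and Jc = lattice_idealD(1)[OF J]
  have ext: "\<exists>f\<in>M. f \<sqinter> a \<in> J" if a: "a \<in> carrier L" "a \<notin> M" for a
  proof (rule ccontr)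
    assume n: "\<not> (\<exists>f\<in>M. f \<sqinter> a \<in> J)"
    \<comment> \<open>The filter generated by \<open>M\<close> and \<open>a\<close>. If no
      \<open>f \<sqinter> a\<close> were in \<open>J\<close>, it would avoid \<open>J\<close> and
      contradict maximality.\<close>
    let ?N = "{c \<in> carrier L. \<exists>f\<in>M. f \<sqinter> a \<sqsubseteq> c}"
    have MN: "M \<subseteq> ?N"
    proof
      fix f assume "f \<in> M"
      then show "f \<in> ?N" using Mc meet_left[of f a] a(1) by auto
    qed
    have "x \<sqinter> y \<in> ?N" if x: "x \<in> ?N" and y: "y \<in> ?N" for x y
    proof -
      obtain f g where fg: "f \<in> M" "f \<sqinter> a \<sqsubseteq> x" "g \<in> M" "g \<sqinter> a \<sqsubseteq> y"
        using x y by (elim CollectE conjE bexE)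
      have xy: "x \<in> carrier L" "y \<in> carrier L" "f \<in> carrier L" "g \<in> carrier L"
        using x y fg Mc by simp_all
      have "(f \<sqinter> g) \<sqinter> a \<sqsubseteq> f \<sqinter> a" "(f \<sqinter> g) \<sqinter> a \<sqsubseteq> g \<sqinter> a"
        using xy a by (simp_all add: meet_mono_left meet_left meet_right)
      then have "(f \<sqinter> g) \<sqinter> a \<sqsubseteq> x" "(f \<sqinter> g) \<sqinter> a \<sqsubseteq> y"
        using fg xy a by (meson le_trans meet_closed)+
      then have "(f \<sqinter> g) \<sqinter> a \<sqsubseteq> x \<sqinter> y" using xy a by (intro meet_le) simp_all
      then show ?thesis using xy lattice_filterD(3)[OF M fg(1,3)] by (intro CollectI conjI bexI[of _ "f \<sqinter> g"]) simp_all
    qed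
    moreover have "y \<in> ?N" if x: "x \<in> ?N" and y: "y \<in> carrier L" "x \<sqsubseteq> y" for x y
    proof -
      obtain f where f: "f \<in> M" "f \<sqinter> a \<sqsubseteq> x" "x \<in> carrier L" using x by (elim CollectE conjE bexE)
      then have "f \<sqinter> a \<sqsubseteq> y" using y a Mc by (meson le_trans meet_closed)
      then show ?thesis using f y by (intro CollectI conjI bexI[of _ f])
    qed
    moreover have "\<top> \<in> ?N" using MN lattice_filterD(2)[OF M] by (rule subsetD)
    ultimately have N: "lattice_filter ?N" unfolding lattice_filter_def by simp
    have "c \<notin> J" if c: "c \<in> ?N" for c
    proof
      assume cJ: "c \<in> J"
      obtain f where f: "f \<in> M" "f \<sqinter> a \<sqsubseteq> c" using c by (elim CollectE conjE bexE)
      then have "f \<sqinter> a \<in> J" using lattice_idealD(4)[OF J cJ] a Mc by simp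
      then show False using n f by simp
    qed
    then have "?N \<in> ?A" using N GM MN by (auto simp: disjoint_iff)
    then have "?N = M" using max MN by simp
    moreover have "a \<in> ?N"
      using lattice_filterD(2)[OF M] meet_right[of \<top> a] a(1) by auto
    ultimately show False using a(2) by simp
  qed
  have meet_iff: "x \<sqinter> y \<in> M \<longleftrightarrow> x \<in> M \<and> y \<in> M" if xy: "x \<in> carrier L" "y \<in> carrier L" for x y
  proof
    assume "x \<sqinter> y \<in> M"
    then show "x \<in> M \<and> y \<in> M"
      using lattice_filterD(4)[OF M, of "x \<sqinter> y"] meet_left[OF xy] meet_right[OF xy] xy by simp
  qed (use lattice_filterD(3)[OF M] in simp)
  have join_iff: "x \<squnion> y \<in> M \<longleftrightarrow> x \<in> M \<or> y \<in> M" if xy: "x \<in> carrier L" "y \<in> carrier L" for x y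
  proof
    assume xyM: "x \<squnion> y \<in> M"
    show "x \<in> M \<or> y \<in> M"
    proof (rule ccontr)
      assume "\<not> (x \<in> M \<or> y \<in> M)"
      then obtain f g where fg: "f \<in> M" "f \<sqinter> x \<in> J" "g \<in> M" "g \<sqinter> y \<in> J"
        using ext[OF xy(1)] ext[OF xy(2)] by (simp add: Bex_def) metis
      \<comment> \<open>One element of \<open>M\<close> that works for both \<open>x\<close> and
        \<open>y\<close>: distributivity puts \<open>?e \<sqinter> (x \<squnion> y)\<close> into
        \<open>J\<close>, although it lies in \<open>M\<close>.\<close>
      let ?e = "f \<sqinter> g"
      have c: "f \<in> carrier L" "g \<in> carrier L" "?e \<in> carrier L" using fg Mc by simp_all
      have "?e \<sqinter> x \<sqsubseteq> f \<sqinter> x" "?e \<sqinter> y \<sqsubseteq> g \<sqinter> y"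
        using c xy by (simp_all add: meet_mono_left meet_left meet_right)
      then have "?e \<sqinter> x \<in> J" "?e \<sqinter> y \<in> J"
        using lattice_idealD(4)[OF J fg(2)] lattice_idealD(4)[OF J fg(4)] c xy by simp_all
      then have "(?e \<sqinter> x) \<squnion> (?e \<sqinter> y) \<in> J" by (rule lattice_idealD(3)[OF J])
      then have "?e \<sqinter> (x \<squnion> y) \<in> J" using distrib[OF c(3) xy] by simp
      moreover have "?e \<sqinter> (x \<squnion> y) \<in> M"
        using lattice_filterD(3)[OF M] fg xyM by simp
      ultimately show False using MJ by blast
    qed
  next
    assume "x \<in> M \<or> y \<in> M"
    then show "x \<squnion> y \<in> M"
      using lattice_filterD(4)[OF M, of x "x \<squnion> y"] lattice_filterD(4)[OF M, of y "x \<squnion> y"]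
        join_left[OF xy] join_right[OF xy] xy by (elim disjE) simp_all
  qed
  have "\<bottom> \<notin> M" using lattice_idealD(2)[OF J] MJ by blast
  moreover have "M \<subseteq> carrier L" using Mc by blast
  ultimately have "M \<in> prime_filters L"
    using lattice_filterD(2)[OF M] meet_iff join_iff by (simp add: prime_filters_def)
  then show ?thesis using GM MJ by (intro bexI[of _ M] conjI)
qed

lemma prime_filters_separate:
  assumes ab: "a \<in> carrier L" "b \<in> carrier L" and n: "\<not> a \<sqsubseteq> b"
  shows "\<exists>F\<in>prime_filters L. a \<in> F \<and> b \<notin> F"
proof -
  \<comment> \<open>Principal filter and principal ideal; a common element would give
    \<open>a \<sqsubseteq> b\<close>.\<close>
  let ?G = "{c \<in> carrier L. a \<sqsubseteq> c}" and ?J = "{c \<in> carrier L. c \<sqsubseteq> b}"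
  have "lattice_filter ?G"
    unfolding lattice_filter_def using ab by (auto intro: meet_le le_trans le_top)
  moreover have "lattice_ideal ?J"
    unfolding lattice_ideal_def using ab by (auto intro: join_le le_trans le_bottom)
  moreover have "?G \<inter> ?J = {}" using n ab le_trans by blast
  ultimately have "\<exists>F\<in>prime_filters L. ?G \<subseteq> F \<and> F \<inter> ?J = {}"
    by (rule prime_filter_theorem)
  then obtain F where "F \<in> prime_filters L" "?G \<subseteq> F" "F \<inter> ?J = {}"
    by (elim bexE conjE)
  moreover have "a \<in> ?G" "b \<in> ?J" using ab by simp_all
  ultimately show ?thesis by blast
qed

text \<open>The points are named by an arbitrary injection \<open>j\<close>, so the space can live
  in any type with room for the prime filters. Compactness is the prime filter theorem read through
  the Alexander subbase lemma; the order is defined by the sets \<open>\<phi> a\<close>, so these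
  separate it and exhaust the clopen upsets.\<close>

theorem prime_filter_space:
  fixes j :: "'a set \<Rightarrow> 'b"
  assumes inj: "inj_on j (prime_filters L)"
  shows "\<exists>X \<phi>. points X = j ` prime_filters L \<and> priestley_dual L X \<phi>"
proof -
  define P where "P = j ` prime_filters L"
  define \<phi> where "\<phi> a = j ` {F \<in> prime_filters L. a \<in> F}" for a
  have mem: "j F \<in> \<phi> a \<longleftrightarrow> a \<in> F" if "F \<in> prime_filters L" for F a
    using inj that by (auto simp: \<phi>_def inj_on_def)
  have sub: "\<phi> a \<subseteq> P" for a by (auto simp: \<phi>_def P_def)
  have PE: "\<exists>F\<in>prime_filters L. x = j F" if "x \<in> P" for x using that by (auto simp: P_def)
  have join: "\<phi> (a \<squnion> b) = \<phi> a \<union> \<phi> b" if "a \<in> carrier L" "b \<in> carrier L" for a b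
    using that by (auto simp: \<phi>_def prime_filters_def)
  have meet: "\<phi> (a \<sqinter> b) = \<phi> a \<inter> \<phi> b" if ab: "a \<in> carrier L" "b \<in> carrier L" for a b
  proof -
    have "x \<in> \<phi> (a \<sqinter> b) \<longleftrightarrow> x \<in> \<phi> a \<inter> \<phi> b" if x: "x \<in> P" for x
    proof -
      obtain F where F: "F \<in> prime_filters L" "x = j F" using PE[OF x] by (elim bexE)
      have "a \<sqinter> b \<in> F \<longleftrightarrow> a \<in> F \<and> b \<in> F" using F(1) ab by (simp add: prime_filters_def)
      then show ?thesis using F by (simp add: mem)
    qed
    then show ?thesis using sub by blast
  qed
  have bot: "\<phi> \<bottom> = {}" by (auto simp: \<phi>_def prime_filters_def)
  have top: "\<phi> \<top> = P" by (auto simp: \<phi>_def P_def prime_filters_def)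
  have le: "\<phi> a \<subseteq> \<phi> b \<longleftrightarrow> a \<sqsubseteq> b" if ab: "a \<in> carrier L" "b \<in> carrier L" for a b
  proof
    assume s: "\<phi> a \<subseteq> \<phi> b"
    show "a \<sqsubseteq> b"
    proof (rule ccontr)
      assume n: "\<not> a \<sqsubseteq> b"
      obtain F where F: "F \<in> prime_filters L" "a \<in> F" "b \<notin> F"
        using prime_filters_separate[OF ab n] by (elim bexE conjE)
      then have "j F \<in> \<phi> a" "j F \<notin> \<phi> b" by (simp_all add: mem)
      then show False using s by blast
    qed
  next
    assume "a \<sqsubseteq> b"
    then have "a \<squnion> b = b" using ab by (simp add: le_iff_meet)
    then have "\<phi> b = \<phi> a \<union> \<phi> b" using join[OF ab] by simp
    then show "\<phi> a \<subseteq> \<phi> b" by blast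
  qed
  define \<B> where "\<B> = \<phi> ` carrier L \<union> (\<lambda>a. P - \<phi> a) ` carrier L"
  define X where "X = \<lparr>topo = topology (arbitrary union_of (finite intersection_of (\<lambda>x. x \<in> \<B>) relative_to P)),
    ord_rel = {(x, y). x \<in> P \<and> y \<in> P \<and> (\<forall>a\<in>carrier L. x \<in> \<phi> a \<longrightarrow> y \<in> \<phi> a)}\<rparr>"
  have pX: "points X = P" by (simp add: X_def)
  have op: "openin (topo X) B" if B: "B \<in> \<B>" for B
  proof -
    have "(finite intersection_of (\<lambda>x. x \<in> \<B>)) B" using B by (rule finite_intersection_of_inc)
    then have "(finite intersection_of (\<lambda>x. x \<in> \<B>) relative_to P) (P \<inter> B)" by (rule relative_to_inc)
    moreover have "P \<inter> B = B" using B sub by (auto simp: \<B>_def)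
    ultimately show ?thesis by (simp add: X_def openin_subbase arbitrary_union_of_inc)
  qed
  have clopen: "\<phi> ` carrier L \<subseteq> clopen_upsets X"
  proof
    fix W assume "W \<in> \<phi> ` carrier L"
    then obtain a where a: "a \<in> carrier L" "W = \<phi> a" by auto
    then have "openin (topo X) (\<phi> a)" "openin (topo X) (P - \<phi> a)" by (auto intro!: op simp: \<B>_def)
    moreover have "is_upset X (\<phi> a)" using sub a(1) by (auto simp: is_upset_def pX) (simp add: X_def)
    ultimately show "W \<in> clopen_upsets X" using sub by (simp add: a(2) clopen_upsets_def closedin_def pX)
  qed
  have comp: "compact_space (topo X)"
  proof (rule Alexander_subbase_alt[of P \<B>])
    have "\<phi> \<top> \<in> \<B>" by (simp add: \<B>_def)
    then show "P \<subseteq> \<Union>\<B>" unfolding top by (rule Union_upper)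
    show "topology (arbitrary union_of (finite intersection_of (\<lambda>x. x \<in> \<B>) relative_to P)) = topo X"
      by (simp add: X_def)
    fix C assume C: "C \<subseteq> \<B>" "P \<subseteq> \<Union>C"
    define I where "I = {a \<in> carrier L. \<phi> a \<in> C}"
    define K where "K = {a \<in> carrier L. P - \<phi> a \<in> C}"
    \<comment> \<open>The ideal generated by \<open>I\<close> and, in the next line, the filter
      generated by \<open>K\<close>. Stating them through \<open>\<phi>\<close> avoids forming
      finite joins and meets in the lattice.\<close>
    define J where "J = {c \<in> carrier L. \<exists>S. finite S \<and> S \<subseteq> I \<and> \<phi> c \<subseteq> (\<Union>a\<in>S. \<phi> a)}"
    define G where "G = {c \<in> carrier L. \<exists>T. finite T \<and> T \<subseteq> K \<and> P \<inter> (\<Inter>a\<in>T. \<phi> a) \<subseteq> \<phi> c}"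
    have J: "lattice_ideal J"
    proof -
      have "x \<squnion> y \<in> J" if x: "x \<in> J" and y: "y \<in> J" for x y
      proof -
        obtain S T where "finite S" "S \<subseteq> I" "\<phi> x \<subseteq> (\<Union>a\<in>S. \<phi> a)" "x \<in> carrier L"
          "finite T" "T \<subseteq> I" "\<phi> y \<subseteq> (\<Union>a\<in>T. \<phi> a)" "y \<in> carrier L"
          using x y unfolding J_def by (elim CollectE conjE exE)
        then show ?thesis unfolding J_def
          by (intro CollectI conjI exI[of _ "S \<union> T"]) (simp_all add: join, blast)
      qed
      moreover have "y \<in> J" if x: "x \<in> J" and y: "y \<in> carrier L" "y \<sqsubseteq> x" for x y
      proof -
        obtain S where S: "finite S" "S \<subseteq> I" "\<phi> x \<subseteq> (\<Union>a\<in>S. \<phi> a)" "x \<in> carrier L"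
          using x unfolding J_def by (elim CollectE conjE exE)
        have "\<phi> y \<subseteq> \<phi> x" using le y S by simp
        then have "\<phi> y \<subseteq> (\<Union>a\<in>S. \<phi> a)" using S(3) by (rule order_trans)
        then show ?thesis using y(1) S(1,2) unfolding J_def by (intro CollectI conjI exI[of _ S])
      qed
      moreover have "\<bottom> \<in> J" unfolding J_def by (intro CollectI conjI exI[of _ "{}"]) (simp_all add: bot)
      moreover have "J \<subseteq> carrier L" by (simp add: J_def)
      ultimately show ?thesis unfolding lattice_ideal_def by simp
    qed
    have G: "lattice_filter G"
    proof -
      have "x \<sqinter> y \<in> G" if x: "x \<in> G" and y: "y \<in> G" for x y
      proof -
        obtain S T where "finite S" "S \<subseteq> K" "P \<inter> (\<Inter>a\<in>S. \<phi> a) \<subseteq> \<phi> x" "x \<in> carrier L"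
          "finite T" "T \<subseteq> K" "P \<inter> (\<Inter>a\<in>T. \<phi> a) \<subseteq> \<phi> y" "y \<in> carrier L"
          using x y unfolding G_def by (elim CollectE conjE exE)
        then show ?thesis unfolding G_def
          by (intro CollectI conjI exI[of _ "S \<union> T"]) (simp_all add: meet, blast+)
      qed
      moreover have "y \<in> G" if x: "x \<in> G" and y: "y \<in> carrier L" "x \<sqsubseteq> y" for x y
      proof -
        obtain S where S: "finite S" "S \<subseteq> K" "P \<inter> (\<Inter>a\<in>S. \<phi> a) \<subseteq> \<phi> x" "x \<in> carrier L"
          using x unfolding G_def by (elim CollectE conjE exE)
        have "\<phi> x \<subseteq> \<phi> y" using le y S by simp
        then have "P \<inter> (\<Inter>a\<in>S. \<phi> a) \<subseteq> \<phi> y" by (rule order_trans[OF S(3)])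
        then show ?thesis using y(1) S(1,2) unfolding G_def by (intro CollectI conjI exI[of _ S])
      qed
      moreover have "\<top> \<in> G" unfolding G_def by (intro CollectI conjI exI[of _ "{}"]) (simp_all add: top)
      moreover have "G \<subseteq> carrier L" by (simp add: G_def)
      ultimately show ?thesis unfolding lattice_filter_def by simp
    qed
    have IJ: "I \<subseteq> J"
    proof
      fix a assume "a \<in> I"
      then show "a \<in> J" unfolding J_def by (intro CollectI conjI exI[of _ "{a}"]) (simp_all add: I_def)
    qed
    have KG: "K \<subseteq> G"
    proof
      fix a assume "a \<in> K"
      then show "a \<in> G" unfolding G_def by (intro CollectI conjI exI[of _ "{a}"]) (simp_all add: K_def)
    qed
    \<comment> \<open>A prime filter that contains \<open>G\<close> and avoids \<open>J\<close>
      would be a point outside every member of \<open>C\<close>.\<close>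
    have "G \<inter> J \<noteq> {}"
    proof
      assume dis: "G \<inter> J = {}"
      obtain F where F: "F \<in> prime_filters L" "G \<subseteq> F" "F \<inter> J = {}"
        using prime_filter_theorem[OF G J dis] by (elim bexE conjE)
      then have "j F \<in> P" by (simp add: P_def)
      then obtain B where B: "B \<in> C" "j F \<in> B" using C(2) by blast
      then have "B \<in> \<B>" using C(1) by blast
      then consider a where "a \<in> carrier L" "B = \<phi> a" | a where "a \<in> carrier L" "B = P - \<phi> a"
        unfolding \<B>_def by auto
      then show False
      proof cases
        case 1
        then have "a \<in> I" "a \<in> F" using B F(1) by (simp_all add: I_def mem)
        then show False using IJ F(3) by blast
      next
        case 2
        then have "a \<in> K" "a \<notin> F" using B F(1) by (simp_all add: K_def mem)
        then show False using KG F(2) by blast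
      qed
    qed
    then obtain c where c: "c \<in> G" "c \<in> J" by blast
    obtain S where S: "finite S" "S \<subseteq> I" "\<phi> c \<subseteq> (\<Union>a\<in>S. \<phi> a)"
      using c(2) unfolding J_def by (elim CollectE conjE exE)
    obtain T where T: "finite T" "T \<subseteq> K" "P \<inter> (\<Inter>a\<in>T. \<phi> a) \<subseteq> \<phi> c"
      using c(1) unfolding G_def by (elim CollectE conjE exE)
    \<comment> \<open>A point in all \<open>\<phi> a\<close> with \<open>a \<in> T\<close> lies in
      \<open>\<phi> c\<close> and so in some \<open>\<phi> a\<close> with \<open>a \<in> S\<close>;
      any other point lies in one of the complements.\<close>
    have "P \<subseteq> \<Union>(\<phi> ` S \<union> (\<lambda>a. P - \<phi> a) ` T)"
    proof
      fix x assume x: "x \<in> P"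
      show "x \<in> \<Union>(\<phi> ` S \<union> (\<lambda>a. P - \<phi> a) ` T)"
      proof (cases "\<forall>a\<in>T. x \<in> \<phi> a")
        case True
        then have "x \<in> \<phi> c" using x T(3) by blast
        then show ?thesis using S(3) by blast
      next
        case False
        then show ?thesis using x by blast
      qed
    qed
    moreover have "\<phi> ` S \<union> (\<lambda>a. P - \<phi> a) ` T \<subseteq> C" using S(2) T(2) by (auto simp: I_def K_def)
    ultimately show "\<exists>C'. finite C' \<and> C' \<subseteq> C \<and> P \<subseteq> \<Union>C'"
      using S(1) T(1) by (intro exI[of _ "\<phi> ` S \<union> (\<lambda>a. P - \<phi> a) ` T"] conjI) simp_all
  qed
  have po: "partial_order_on (points X) (ord_rel X)"
  proof -
    have "x = y" if xy: "(x, y) \<in> ord_rel X" "(y, x) \<in> ord_rel X" for x y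
    proof -
      have "x \<in> P" "y \<in> P" using xy by (simp_all add: X_def)
      then obtain F H where FH: "F \<in> prime_filters L" "x = j F" "H \<in> prime_filters L" "y = j H"
        using PE by metis
      have "a \<in> F \<longleftrightarrow> a \<in> H" if "a \<in> carrier L" for a
        using xy FH that by (auto simp: X_def mem)
      moreover have "F \<subseteq> carrier L" "H \<subseteq> carrier L" using FH by (simp_all add: prime_filters_def)
      ultimately show ?thesis using FH by (metis subset_antisym subset_iff)
    qed
    then have "antisym (ord_rel X)" by (rule antisymI)
    moreover have "trans (ord_rel X)" by (rule transI) (simp add: X_def)
    moreover have "refl_on (points X) (ord_rel X)" by (simp add: refl_on_def X_def)
    moreover have "ord_rel X \<subseteq> points X \<times> points X" by (auto simp: X_def)
    ultimately show ?thesis by (simp add: partial_order_on_def preorder_on_def)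
  qed
  have topB: "points X \<in> \<phi> ` carrier L" using top by (simp add: pX image_iff) (metis top_closed)
  have botB: "{} \<in> \<phi> ` carrier L" using bot by (simp add: image_iff) (metis bottom_closed)
  have IntB: "V \<inter> W \<in> \<phi> ` carrier L" if "V \<in> \<phi> ` carrier L" "W \<in> \<phi> ` carrier L" for V W
    using that by (elim imageE) (simp add: meet[symmetric])
  have UnB: "V \<union> W \<in> \<phi> ` carrier L" if "V \<in> \<phi> ` carrier L" "W \<in> \<phi> ` carrier L" for V W
    using that by (elim imageE) (simp add: join[symmetric])
  have sep: "\<exists>B\<in>\<phi> ` carrier L. x \<in> B \<and> y \<notin> B"
    if "x \<in> points X" "y \<in> points X" "(x, y) \<notin> ord_rel X" for x y
    using that by (auto simp: X_def)
  have pr: "priestley_space X" and cl: "clopen_upsets X = \<phi> ` carrier L"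
    by (rule priestley_space_by_sublattice[OF comp po clopen topB botB]; fact IntB UnB sep)+
  have "inj_on \<phi> (carrier L)"
    by (rule inj_onI) (metis le le_antisym order_refl)
  then have "bij_betw \<phi> (carrier L) (clopen_upsets X)" by (simp add: bij_betw_def cl)
  then have "priestley_dual L X \<phi>"
    using pr bot join by unfold_locales
  then show ?thesis using pX by (auto simp: P_def)
qed

end

section \<open>The lattice of clopen upsets\<close>

text \<open>The lattice structure and distributivity are transported from union and intersection.
  The bijection \<open>\<phi>\<close> is there because the elements will be codes for clopen upsets
  rather than the sets themselves.\<close>

lemma set_lattice:
  fixes A :: "'a gorder" and \<phi> :: "'a \<Rightarrow> 'b set"
  assumes eq: "eq A = (=)" and bij: "bij_betw \<phi> (carrier A) \<B>"
    and le: "\<And>a b. a \<in> carrier A \<Longrightarrow> b \<in> carrier A \<Longrightarrow> a \<sqsubseteq>\<^bsub>A\<^esub> b \<longleftrightarrow> \<phi> a \<subseteq> \<phi> b"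
    and B: "{} \<in> \<B>" "P \<in> \<B>" "\<And>W. W \<in> \<B> \<Longrightarrow> W \<subseteq> P"
      "\<And>V W. V \<in> \<B> \<Longrightarrow> W \<in> \<B> \<Longrightarrow> V \<inter> W \<in> \<B>" "\<And>V W. V \<in> \<B> \<Longrightarrow> W \<in> \<B> \<Longrightarrow> V \<union> W \<in> \<B>"
  shows "bounded_distrib_lattice A" "\<phi> \<bottom>\<^bsub>A\<^esub> = {}"
    "\<And>a b. a \<in> carrier A \<Longrightarrow> b \<in> carrier A \<Longrightarrow> \<phi> (a \<squnion>\<^bsub>A\<^esub> b) = \<phi> a \<union> \<phi> b"
proof -
  have inj: "a = b" if "a \<in> carrier A" "b \<in> carrier A" "\<phi> a = \<phi> b" for a b
    using bij that by (auto simp: bij_betw_def inj_on_def)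
  have cl: "\<phi> a \<in> \<B>" if "a \<in> carrier A" for a using bij that by (auto simp: bij_betw_def)
  have ex: "\<exists>a\<in>carrier A. \<phi> a = W" if "W \<in> \<B>" for W
  proof -
    have "W \<in> \<phi> ` carrier A" using bij that by (simp add: bij_betw_def)
    then obtain a where "W = \<phi> a" "a \<in> carrier A" by (elim imageE)
    then show ?thesis by (intro bexI[of _ a]) simp_all
  qed
  interpret A: partial_order A
    by unfold_locales (auto simp: eq le dest: inj)
  have sup: "\<exists>s. least A s (Upper A {a, b})" and inf: "\<exists>s. greatest A s (Lower A {a, b})"
    if ab: "a \<in> carrier A" "b \<in> carrier A" for a b
  proof -
    obtain s where "s \<in> carrier A" "\<phi> s = \<phi> a \<union> \<phi> b" using ex[OF B(5)[OF cl[OF ab(1)] cl[OF ab(2)]]] by (elim bexE)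
    moreover have "Upper A {a, b} = {x \<in> carrier A. \<phi> a \<union> \<phi> b \<subseteq> \<phi> x}"
      by (rule Set.set_eqI) (use ab le in \<open>simp add: Upper_def all_conj_distrib, blast\<close>)
    ultimately have "least A s (Upper A {a, b})" using le by (simp add: least_def)
    then show "\<exists>s. least A s (Upper A {a, b})" by (rule exI)
    obtain s where "s \<in> carrier A" "\<phi> s = \<phi> a \<inter> \<phi> b" using ex[OF B(4)[OF cl[OF ab(1)] cl[OF ab(2)]]] by (elim bexE)
    moreover have "Lower A {a, b} = {x \<in> carrier A. \<phi> x \<subseteq> \<phi> a \<inter> \<phi> b}"
      by (rule Set.set_eqI) (use ab le in \<open>simp add: Lower_def all_conj_distrib, blast\<close>)
    ultimately have "greatest A s (Lower A {a, b})" using le by (simp add: greatest_def)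
    then show "\<exists>s. greatest A s (Lower A {a, b})" by (rule exI)
  qed
  have bot: "\<exists>x. least A x (carrier A)"
  proof -
    obtain x where "x \<in> carrier A" "\<phi> x = {}" using ex[OF B(1)] by (elim bexE)
    then show ?thesis by (intro exI[of _ x]) (auto simp: least_def le)
  qed
  have top: "\<exists>x. greatest A x (carrier A)"
  proof -
    obtain x where "x \<in> carrier A" "\<phi> x = P" using ex[OF B(2)] by (elim bexE)
    then show ?thesis using B(3)[OF cl] by (intro exI[of _ x]) (auto simp: greatest_def le)
  qed
  interpret A: bounded_lattice A
    by unfold_locales (fact sup inf bot top)+
  show join: "\<phi> (a \<squnion>\<^bsub>A\<^esub> b) = \<phi> a \<union> \<phi> b" if ab: "a \<in> carrier A" "b \<in> carrier A" for a b
  proof -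
    have c: "a \<squnion>\<^bsub>A\<^esub> b \<in> carrier A" using ab by simp
    obtain s where s: "s \<in> carrier A" "\<phi> s = \<phi> a \<union> \<phi> b" using ex[OF B(5)[OF cl[OF ab(1)] cl[OF ab(2)]]] by (elim bexE)
    have "a \<squnion>\<^bsub>A\<^esub> b \<sqsubseteq>\<^bsub>A\<^esub> s" using ab s by (intro A.join_le) (simp_all add: le)
    then have "\<phi> (a \<squnion>\<^bsub>A\<^esub> b) \<subseteq> \<phi> a \<union> \<phi> b" using le[OF c s(1)] s(2) by simp
    moreover have "\<phi> a \<subseteq> \<phi> (a \<squnion>\<^bsub>A\<^esub> b)" "\<phi> b \<subseteq> \<phi> (a \<squnion>\<^bsub>A\<^esub> b)"
      using A.join_left[OF ab] A.join_right[OF ab] le ab c by simp_all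
    ultimately show ?thesis by blast
  qed
  have meet: "\<phi> (a \<sqinter>\<^bsub>A\<^esub> b) = \<phi> a \<inter> \<phi> b" if ab: "a \<in> carrier A" "b \<in> carrier A" for a b
  proof -
    have c: "a \<sqinter>\<^bsub>A\<^esub> b \<in> carrier A" using ab by simp
    obtain s where s: "s \<in> carrier A" "\<phi> s = \<phi> a \<inter> \<phi> b" using ex[OF B(4)[OF cl[OF ab(1)] cl[OF ab(2)]]] by (elim bexE)
    have "s \<sqsubseteq>\<^bsub>A\<^esub> a \<sqinter>\<^bsub>A\<^esub> b" using ab s by (intro A.meet_le) (simp_all add: le)
    then have "\<phi> a \<inter> \<phi> b \<subseteq> \<phi> (a \<sqinter>\<^bsub>A\<^esub> b)" using le[OF s(1) c] s(2) by simp
    moreover have "\<phi> (a \<sqinter>\<^bsub>A\<^esub> b) \<subseteq> \<phi> a" "\<phi> (a \<sqinter>\<^bsub>A\<^esub> b) \<subseteq> \<phi> b"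
      using A.meet_left[OF ab] A.meet_right[OF ab] le ab c by simp_all
    ultimately show ?thesis by blast
  qed
  show "bounded_distrib_lattice A"
  proof
    fix x y z assume "x \<in> carrier A" "y \<in> carrier A" "z \<in> carrier A"
    then show "x \<sqinter>\<^bsub>A\<^esub> (y \<squnion>\<^bsub>A\<^esub> z) = (x \<sqinter>\<^bsub>A\<^esub> y) \<squnion>\<^bsub>A\<^esub> (x \<sqinter>\<^bsub>A\<^esub> z)"
      by (intro inj) (simp_all add: join meet Int_Un_distrib)
  qed
  obtain x where "x \<in> carrier A" "\<phi> x = {}" using ex[OF B(1)] by (elim bexE)
  then show "\<phi> \<bottom>\<^bsub>A\<^esub> = {}" using A.bottom_lower[of x] le[of "\<bottom>\<^bsub>A\<^esub>" x] by simp
qed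

theorem clopen_upset_lattice:
  fixes X :: "'b ordered_space"
  assumes X: "priestley_space X" and small: "clopen_upsets X \<lesssim> (UNIV :: 'a set)"
  shows "\<exists>(A :: 'a gorder) \<phi>. bounded_distrib_lattice A \<and> priestley_dual A X \<phi>"
proof -
  obtain i :: "'b set \<Rightarrow> 'a" where i: "inj_on i (clopen_upsets X)"
    using small by (auto simp: lepoll_def)
  define \<phi> where "\<phi> = inv_into (clopen_upsets X) i"
  \<comment> \<open>The elements are codes \<open>i W\<close> of clopen upsets, and
    \<open>\<phi>\<close> decodes them; this places the lattice in the given type.\<close>
  define A :: "'a gorder" where "A = \<lparr>carrier = i ` clopen_upsets X, eq = (=), le = (\<lambda>a b. \<phi> a \<subseteq> \<phi> b)\<rparr>"
  have bij: "bij_betw \<phi> (carrier A) (clopen_upsets X)"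
    unfolding \<phi>_def A_def using i by (simp add: bij_betw_inv_into inj_on_imp_bij_betw)
  have eq: "eq A = (=)" by (simp add: A_def)
  have le: "a \<sqsubseteq>\<^bsub>A\<^esub> b \<longleftrightarrow> \<phi> a \<subseteq> \<phi> b" for a b by (simp add: A_def)
  note L = set_lattice[OF eq bij le clopen_upsets_empty clopen_upsets_points clopen_upsets_sub
    clopen_upsets_Int clopen_upsets_Un]
  interpret bounded_distrib_lattice A by (rule L)
  have "priestley_dual A X \<phi>"
    using X bij L(2,3) by unfold_locales
  then show ?thesis using L(1) by (intro exI conjI)
qed

section \<open>Cardinality bounds for dual pairs\<close>

lemma (in priestley_dual) clopen_upsets_eqpoll: "clopen_upsets X \<approx> carrier A"
  using bij eqpoll_def eqpoll_sym by blast

text \<open>Every prime filter is \<open>{a \<in> carrier A. x \<in> \<phi> a}\<close> for some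
  point \<open>x\<close>, and the filter can be read off from \<open>x\<close>. This bounds the
  prime filters when the space is given and the lattice is constructed from it.\<close>

lemma (in priestley_dual) prime_filters_lepoll_points:
  assumes "bounded_distrib_lattice A"
  shows "prime_filters A \<lesssim> points X"
proof -
  interpret L: bounded_distrib_lattice A by (rule assms)
  have le: "a \<sqsubseteq> b \<longleftrightarrow> \<phi> a \<subseteq> \<phi> b" if ab: "a \<in> carrier A" "b \<in> carrier A" for a b
  proof
    assume "a \<sqsubseteq> b"
    then have "a \<squnion> b = b" using ab by (simp add: L.le_iff_meet)
    then have "\<phi> b = \<phi> a \<union> \<phi> b" using rep_join[OF ab] by simp
    then show "\<phi> a \<subseteq> \<phi> b" by blast
  next
    assume "\<phi> a \<subseteq> \<phi> b"
    then have "a \<squnion> b = b" by (rule rep_le_join[OF ab])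
    then show "a \<sqsubseteq> b" using ab by (simp add: L.le_iff_meet)
  qed
  have meet: "\<phi> (a \<sqinter> b) = \<phi> a \<inter> \<phi> b" if ab: "a \<in> carrier A" "b \<in> carrier A" for a b
  proof -
    have c: "a \<sqinter> b \<in> carrier A" using ab by simp
    obtain s where s: "s \<in> carrier A" "\<phi> s = \<phi> a \<inter> \<phi> b" using rep_meet[OF ab] by (elim bexE)
    have "s \<sqsubseteq> a \<sqinter> b" using ab s by (intro L.meet_le) (simp_all add: le)
    then have "\<phi> a \<inter> \<phi> b \<subseteq> \<phi> (a \<sqinter> b)" using le[OF s(1) c] s(2) by simp
    moreover have "\<phi> (a \<sqinter> b) \<subseteq> \<phi> a" "\<phi> (a \<sqinter> b) \<subseteq> \<phi> b"
      using L.meet_left[OF ab] L.meet_right[OF ab] le ab c by simp_all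
    ultimately show ?thesis by blast
  qed
  have "\<exists>x\<in>points X. \<forall>a\<in>carrier A. x \<in> \<phi> a \<longleftrightarrow> a \<in> F" if F: "F \<in> prime_filters A" for F
  proof (rule ccontr)
    assume n: "\<not> (\<exists>x\<in>points X. \<forall>a\<in>carrier A. x \<in> \<phi> a \<longleftrightarrow> a \<in> F)"
    have FA: "F \<subseteq> carrier A" "\<top> \<in> F" "\<bottom> \<notin> F"
      and Fm: "\<And>x y. x \<in> carrier A \<Longrightarrow> y \<in> carrier A \<Longrightarrow> x \<sqinter> y \<in> F \<longleftrightarrow> x \<in> F \<and> y \<in> F"
      and Fj: "\<And>x y. x \<in> carrier A \<Longrightarrow> y \<in> carrier A \<Longrightarrow> x \<squnion> y \<in> F \<longleftrightarrow> x \<in> F \<or> y \<in> F"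
      using F by (simp_all add: prime_filters_def)
    \<comment> \<open>The points whose filter lies inside \<open>F\<close>. If none of them realizes
      \<open>F\<close>, each misses some \<open>\<phi> a\<close> with \<open>a \<in> F\<close>, and
      by compactness finitely many such \<open>a\<close> suffice.\<close>
    let ?C = "{x \<in> points X. \<forall>W\<in>\<phi> ` (carrier A - F). x \<notin> W}"
    have "?C \<in> closed_downsets X"
      using rep_clopen by (intro closed_downset_complements) auto
    then have C: "closedin (topo X) ?C" by (simp add: closed_downsets_def)
    have "openin (topo X) (points X - \<phi> a)" if "a \<in> F" for a
      using rep_clopen[of a] that FA(1) by (auto simp: clopen_upsets_def)
    moreover have "?C \<subseteq> (\<Union>a\<in>F. points X - \<phi> a)" using n FA(1) by auto
    moreover have "compact_space (topo X)" using priestley by (simp add: priestley_space_def)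
    ultimately have "\<exists>K. finite K \<and> K \<subseteq> F \<and> ?C \<subseteq> (\<Union>a\<in>K. points X - \<phi> a)"
      by (intro compact_space_cover[OF _ C])
    then obtain K where K: "finite K" "K \<subseteq> F" "?C \<subseteq> (\<Union>a\<in>K. points X - \<phi> a)"
      by (elim exE conjE)
    have "\<exists>c\<in>F. \<forall>a\<in>K. \<phi> c \<subseteq> \<phi> a"
      using K(1,2)
    proof (induction K)
      case empty
      then show ?case using FA(2) by auto
    next
      case (insert a K)
      then obtain c where c: "c \<in> F" "\<forall>a\<in>K. \<phi> c \<subseteq> \<phi> a" by auto
      have ac: "a \<in> carrier A" "c \<in> carrier A" "a \<in> F" using insert.prems c FA(1) by auto
      have "a \<sqinter> c \<in> F" using Fm[OF ac(1,2)] ac c by simp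
      moreover have "\<forall>b\<in>insert a K. \<phi> (a \<sqinter> c) \<subseteq> \<phi> b" using c(2) meet[OF ac(1,2)] by auto
      ultimately show ?case by (intro bexI)
    qed
    then obtain c where c: "c \<in> F" "\<forall>a\<in>K. \<phi> c \<subseteq> \<phi> a" by (elim bexE)
    have cA: "c \<in> carrier A" using c FA by auto
    \<comment> \<open>The complement of a prime filter is an ideal. A point of
      \<open>\<phi> c\<close> avoiding it lies in \<open>?C\<close>, yet belongs to every
      \<open>\<phi> a\<close> with \<open>a \<in> K\<close>.\<close>
    have "\<exists>x\<in>\<phi> c. \<forall>b\<in>carrier A - F. x \<notin> \<phi> b"
    proof (rule ideal_avoiding_point)
      show "\<bottom> \<in> carrier A - F" using FA(3) by simp
      show "a \<squnion> b \<in> carrier A - F" if "a \<in> carrier A - F" "b \<in> carrier A - F" for a b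
        using that Fj[of a b] by simp
      show "b \<in> carrier A - F" if a: "a \<in> carrier A - F" and b: "b \<in> carrier A" "\<phi> b \<subseteq> \<phi> a" for a b
        using rep_le_join[OF b(1) _ b(2)] Fj[of b a] a b by auto
    qed (use c cA in auto)
    then obtain x where x: "x \<in> \<phi> c" "\<forall>b\<in>carrier A - F. x \<notin> \<phi> b" by (elim bexE)
    then have "x \<in> ?C" using rep_points[OF cA] by auto
    then have "x \<in> (\<Union>a\<in>K. points X - \<phi> a)" by (rule subsetD[OF K(3)])
    then show False using c(2) x(1) by auto
  qed
  then obtain f where f: "\<And>F. F \<in> prime_filters A \<Longrightarrow> f F \<in> points X \<and> (\<forall>a\<in>carrier A. f F \<in> \<phi> a \<longleftrightarrow> a \<in> F)"
    by metis
  have "inj_on f (prime_filters A)"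
  proof (rule inj_onI)
    fix F G assume FG: "F \<in> prime_filters A" "G \<in> prime_filters A" "f F = f G"
    have "F \<subseteq> carrier A" "G \<subseteq> carrier A" using FG by (simp_all add: prime_filters_def)
    moreover have "a \<in> F \<longleftrightarrow> a \<in> G" if "a \<in> carrier A" for a
      using f[OF FG(1)] f[OF FG(2)] FG(3) that by simp
    ultimately show "F = G" by (metis subset_antisym subset_iff)
  qed
  then show ?thesis using f unfolding lepoll_def by (intro exI[of _ f]) auto
qed

section \<open>The category of U-operators\<close>

lemma jsl_hom_compose:
  assumes "f \<in> jsl_hom A B" "g \<in> jsl_hom B D" "jsl A"
  shows "compose (carrier A) g f \<in> jsl_hom A D"
proof -
  interpret jsl A by (rule assms)
  have "f x \<in> carrier B" if "x \<in> carrier A" for x using assms(1) that by (auto simp: jsl_hom_def)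
  then show ?thesis
    using assms(1,2) by (simp add: jsl_hom_def compose_def PiE_iff)
qed

lemma tensor_map_ident:
  assumes A: "jsl A" and c: "c \<in> carrier (tensor_power A k)"
  shows "tensor_map A A k (\<lambda>x\<in>carrier A. x) c = c"
proof -
  interpret jsl A by (rule A)
  let ?I = "\<lambda>x\<in>carrier A. x"
  have I: "?I \<in> jsl_hom A A" by (simp add: jsl_hom_def)
  obtain S where S: "S \<in> Fpow (tuples (carrier A) k)" "c = tensor_class A k S"
    using c by (rule tensor_carrierE)
  have "(\<lambda>i\<in>{..<k}. ?I (t i)) = t" if "t \<in> S" for t
  proof (rule PiE_ext[of _ "{..<k}" "\<lambda>_. carrier A"])
    have t: "t \<in> tuples (carrier A) k" by (rule Fpow_mem[OF S(1) that])
    then have ti: "i < k \<Longrightarrow> t i \<in> carrier A" for i by (simp add: PiE_iff)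
    show "t \<in> tuples (carrier A) k" by (rule t)
    show "(\<lambda>i\<in>{..<k}. ?I (t i)) \<in> tuples (carrier A) k" using ti by simp
    show "(\<lambda>i\<in>{..<k}. ?I (t i)) i = t i" if "i \<in> {..<k}" for i using that ti by simp
  qed
  then have "(\<lambda>t. \<lambda>i\<in>{..<k}. ?I (t i)) ` S = (\<lambda>t. t) ` S" by (rule image_cong[OF HOL.refl])
  then show ?thesis unfolding S(2) tensor_map_class[OF A I S(1)] by (simp only: image_ident)
qed

lemma tensor_map_compose:
  assumes A: "jsl A" and B: "jsl B" and D: "jsl D"
    and f: "f \<in> jsl_hom A B" and g: "g \<in> jsl_hom B D" and c: "c \<in> carrier (tensor_power A k)"
  shows "tensor_map A D k (compose (carrier A) g f) c = tensor_map B D k g (tensor_map A B k f c)"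
proof -
  interpret A: jsl A by (rule A)
  interpret B: jsl B by (rule B)
  let ?f = "\<lambda>t. \<lambda>i\<in>{..<k}. f (t i)" and ?g = "\<lambda>t. \<lambda>i\<in>{..<k}. g (t i)"
    and ?h = "\<lambda>t. \<lambda>i\<in>{..<k}. compose (carrier A) g f (t i)"
  obtain S where S: "S \<in> Fpow (tuples (carrier A) k)" "c = tensor_class A k S"
    using c by (rule A.tensor_carrierE)
  have "?h t = ?g (?f t)" if "t \<in> S" for t
  proof -
    have "t \<in> tuples (carrier A) k" by (rule Fpow_mem[OF S(1) that])
    then have "i < k \<Longrightarrow> t i \<in> carrier A" for i by (simp add: PiE_iff)
    then show ?thesis by (intro restrict_ext) (simp add: compose_eq)
  qed
  then have "?h ` S = (\<lambda>t. ?g (?f t)) ` S" by (rule image_cong[OF HOL.refl])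
  also have "\<dots> = ?g ` (?f ` S)" by (simp only: image_image)
  finally show ?thesis
    unfolding S(2) A.tensor_map_class[OF D jsl_hom_compose[OF f g A] S(1)]
      A.tensor_map_class[OF B f S(1)] B.tensor_map_class[OF D g map_tuples_Fpow[OF f S(1)]]
    by (simp only:)
qed

lemma bounded_distrib_lattice_jsl: "bounded_distrib_lattice A \<Longrightarrow> jsl A"
proof -
  assume "bounded_distrib_lattice A"
  then interpret bounded_distrib_lattice A .
  show ?thesis by unfold_locales
qed

lemma Op_U_simps:
  "Obj (Op_U k n) = U_operators k n" "Hom (Op_U k n) = operator_hom k n"
  "Ident (Op_U k n) (A, a) = (\<lambda>x\<in>carrier A. x)"
  "Comp (Op_U k n) (A, a) B D g f = compose (carrier A) g f"
  by (simp_all add: Op_U_def)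

lemma operator_homD:
  assumes "h \<in> operator_hom k n (A, a) (B, b)"
  shows "h \<in> jsl_hom A B"
    "c \<in> carrier (tensor_power A k) \<Longrightarrow> tensor_map A B n h (a c) = b (tensor_map A B k h c)"
  using assms by (simp_all add: operator_hom_def)

lemma U_operatorD:
  assumes "(A, a) \<in> U_operators k n"
  shows "bounded_distrib_lattice A" "jsl A" "a \<in> jsl_hom (tensor_power A k) (tensor_power A n)"
    "c \<in> carrier (tensor_power A k) \<Longrightarrow> a c \<in> carrier (tensor_power A n)"
  using assms bounded_distrib_lattice_jsl by (auto simp: U_operators_def jsl_hom_def)

lemma tensor_map_closed:
  assumes "jsl A" "jsl B" "h \<in> jsl_hom A B" "c \<in> carrier (tensor_power A k)"
  shows "tensor_map A B k h c \<in> carrier (tensor_power B k)"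
  using tensor_map_hom[OF assms(1-3), of k] assms(4) by (auto simp: jsl_hom_def)

lemma operator_hom_compose:
  assumes A: "(A, a) \<in> U_operators k n" and B: "(B, b) \<in> U_operators k n" and D: "(D, d) \<in> U_operators k n"
    and f: "f \<in> operator_hom k n (A, a) (B, b)" and g: "g \<in> operator_hom k n (B, b) (D, d)"
  shows "compose (carrier A) g f \<in> operator_hom k n (A, a) (D, d)"
proof -
  note jA = U_operatorD(2)[OF A] and jB = U_operatorD(2)[OF B] and jD = U_operatorD(2)[OF D]
  note f' = operator_homD[OF f] and g' = operator_homD[OF g]
  have "tensor_map A D n (compose (carrier A) g f) (a c) = d (tensor_map A D k (compose (carrier A) g f) c)"
    if c: "c \<in> carrier (tensor_power A k)" for c
  proof -
    have "tensor_map A D n (compose (carrier A) g f) (a c) = tensor_map B D n g (tensor_map A B n f (a c))"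
      by (rule tensor_map_compose[OF jA jB jD f'(1) g'(1) U_operatorD(4)[OF A c]])
    also have "\<dots> = tensor_map B D n g (b (tensor_map A B k f c))" by (simp only: f'(2)[OF c])
    also have "\<dots> = d (tensor_map B D k g (tensor_map A B k f c))"
      by (rule g'(2)[OF tensor_map_closed[OF jA jB f'(1) c]])
    also have "\<dots> = d (tensor_map A D k (compose (carrier A) g f) c)"
      by (simp only: tensor_map_compose[OF jA jB jD f'(1) g'(1) c])
    finally show ?thesis .
  qed
  then show ?thesis using jsl_hom_compose[OF f'(1) g'(1) jA] by (simp add: operator_hom_def)
qed

lemma operator_hom_ident:
  assumes A: "(A, a) \<in> U_operators k n"
  shows "(\<lambda>x\<in>carrier A. x) \<in> operator_hom k n (A, a) (A, a)"
proof -
  interpret jsl A by (rule U_operatorD(2)[OF A])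
  have "(\<lambda>x\<in>carrier A. x) \<in> jsl_hom A A" by (simp add: jsl_hom_def)
  then show ?thesis
    using tensor_map_ident[OF U_operatorD(2)[OF A]] U_operatorD(4)[OF A] by (simp add: operator_hom_def)
qed

theorem Op_U_category: "is_category (Op_U k n)"
  unfolding is_category_def Op_U_simps(1,2)
proof (intro conjI ballI)
  fix A B D E :: "'a operator" and f g h :: "'a \<Rightarrow> 'a"
  obtain A' a B' b D' d where AB: "A = (A', a)" "B = (B', b)" "D = (D', d)" by (metis surj_pair)
  assume A: "A \<in> U_operators k n"
  show "Ident (Op_U k n) A \<in> operator_hom k n A A"
    using A operator_hom_ident by (simp add: AB Op_U_simps)
  assume B: "B \<in> U_operators k n"
  {
    assume f: "f \<in> operator_hom k n A B"
    have f': "f \<in> carrier A' \<rightarrow>\<^sub>E carrier B'" using f by (simp add: AB operator_hom_def jsl_hom_def)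
    show "Comp (Op_U k n) A A B f (Ident (Op_U k n) A) = f"
      unfolding AB Op_U_simps compose_def using f' by (intro PiE_ext[OF _ f']) auto
    show "Comp (Op_U k n) A B B (Ident (Op_U k n) B) f = f"
      unfolding AB Op_U_simps compose_def using f' by (intro PiE_ext[OF _ f']) auto
  }
  assume D: "D \<in> U_operators k n"
  {
    assume "f \<in> operator_hom k n A B" "g \<in> operator_hom k n B D"
    then show "Comp (Op_U k n) A B D g f \<in> operator_hom k n A D"
      using A B D unfolding AB Op_U_simps by (intro operator_hom_compose)
  }
  assume f: "f \<in> operator_hom k n A B"
  have "f \<in> carrier A' \<rightarrow> carrier B'"
    using operator_homD(1)[OF f[unfolded AB(1,2)]] by (auto simp: jsl_hom_def)
  then show "Comp (Op_U k n) A D E h (Comp (Op_U k n) A B D g f) =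
      Comp (Op_U k n) A B E (Comp (Op_U k n) B D E h g) f"
    unfolding AB Op_U_simps by (rule compose_assoc)
qed

section \<open>Duality of operators and relations\<close>

text \<open>The value \<open>\<gamma> z\<close> contains a \<open>y\<close> with
  \<open>\<beta> y\<close> meeting \<open>\<phi> a\<close> iff the union of these
  \<open>\<beta> y\<close> meets \<open>\<phi> a\<close>. The order of composition is reversed: the
  composite relation follows \<open>\<gamma>\<close> first, although \<open>g\<close> is applied
  last.\<close>

lemma represents_compose:
  assumes AB: "priestley_dual_pair A X \<phi> B Y \<psi>" and BD: "priestley_dual_pair B Y \<psi> D Z \<chi>"
    and h: "h \<in> jsl_hom A B" and \<beta>: "\<beta> \<in> priestley_relations Y X"
    and hr: "priestley_dual_pair.represents A \<phi> Y \<psi> h \<beta>"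
    and \<gamma>: "\<gamma> \<in> priestley_relations Z Y" and gr: "priestley_dual_pair.represents B \<psi> Z \<chi> g \<gamma>"
  shows "priestley_dual_pair.represents A \<phi> Z \<chi> (compose (carrier A) g h) (\<lambda>z\<in>points Z. \<Union>y\<in>\<gamma> z. \<beta> y)"
    and "(\<lambda>z\<in>points Z. \<Union>y\<in>\<gamma> z. \<beta> y) \<in> priestley_dual_pair.closed_relations X Z"
proof -
  interpret AB: priestley_dual_pair A X \<phi> B Y \<psi> by (rule AB)
  interpret BD: priestley_dual_pair B Y \<psi> D Z \<chi> by (rule BD)
  interpret AD: priestley_dual_pair A X \<phi> D Z \<chi> by unfold_locales
  show "AD.represents (compose (carrier A) g h) (\<lambda>z\<in>points Z. \<Union>y\<in>\<gamma> z. \<beta> y)"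
    unfolding AD.represents_def
  proof
    fix a assume a: "a \<in> carrier A"
    have "\<psi> (h a) = {y \<in> points Y. \<beta> y \<inter> \<phi> a \<noteq> {}}"
      using hr a by (simp add: AB.represents_def)
    moreover have "\<chi> (g (h a)) = {z \<in> points Z. \<gamma> z \<inter> \<psi> (h a) \<noteq> {}}"
      using gr AB.jsl_hom_carrier[OF h a] by (simp add: BD.represents_def)
    ultimately have "\<chi> (g (h a)) = {z \<in> points Z. \<gamma> z \<inter> {y \<in> points Y. \<beta> y \<inter> \<phi> a \<noteq> {}} \<noteq> {}}" by simp
    moreover have "\<gamma> z \<inter> {y \<in> points Y. \<beta> y \<inter> \<phi> a \<noteq> {}} \<noteq> {} \<longleftrightarrow> (\<Union>y\<in>\<gamma> z. \<beta> y) \<inter> \<phi> a \<noteq> {}"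
      if "z \<in> points Z" for z
      using priestley_relation_points[OF \<gamma> that] by auto
    ultimately show "\<chi> (compose (carrier A) g h a) =
        {z \<in> points Z. (\<lambda>z\<in>points Z. \<Union>y\<in>\<gamma> z. \<beta> y) z \<inter> \<phi> a \<noteq> {}}"
      using a by (simp add: compose_eq cong: conj_cong)
  qed
  show "(\<lambda>z\<in>points Z. \<Union>y\<in>\<gamma> z. \<beta> y) \<in> AD.closed_relations"
    unfolding AD.closed_relations_def
    using relation_comp_closed_downset[OF AB.A.priestley AB.B.priestley \<beta> priestley_relation_closed_downset[OF \<gamma>]]
    by simp
qed

lemma (in priestley_dual) represents_ident:
  shows "priestley_dual_pair.represents A \<phi> X \<phi> (\<lambda>x\<in>carrier A. x)
      (\<lambda>x\<in>points X. {y \<in> points X. (y, x) \<in> ord_rel X})"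
    and "(\<lambda>x\<in>points X. {y \<in> points X. (y, x) \<in> ord_rel X}) \<in> priestley_dual_pair.closed_relations X X"
proof -
  interpret P: priestley_dual_pair A X \<phi> A X \<phi> by unfold_locales
  show "P.represents (\<lambda>x\<in>carrier A. x) (\<lambda>x\<in>points X. {y \<in> points X. (y, x) \<in> ord_rel X})"
    unfolding P.represents_def
  proof
    fix a assume a: "a \<in> carrier A"
    have "{x \<in> points X. (\<lambda>x\<in>points X. {y \<in> points X. (y, x) \<in> ord_rel X}) x \<inter> \<phi> a \<noteq> {}} =
        {x \<in> points X. x \<in> \<phi> a}"
      using principal_downset(2)[OF priestley _ rep_clopen[OF a]] by (simp cong: conj_cong)
    also have "\<dots> = \<phi> a" using rep_points[OF a] by blast
    finally show "\<phi> ((\<lambda>x\<in>carrier A. x) a) =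
        {x \<in> points X. (\<lambda>x\<in>points X. {y \<in> points X. (y, x) \<in> ord_rel X}) x \<inter> \<phi> a \<noteq> {}}"
      using a by simp
  qed
  show "(\<lambda>x\<in>points X. {y \<in> points X. (y, x) \<in> ord_rel X}) \<in> P.closed_relations"
    unfolding P.closed_relations_def using principal_downset(1)[OF priestley] by simp
qed

section \<open>Operator homomorphisms as relational morphisms\<close>

abbreviation operator_represents ::
    "nat \<Rightarrow> nat \<Rightarrow> 'a gorder \<Rightarrow> 'b ordered_space \<Rightarrow> ('a \<Rightarrow> 'b set) \<Rightarrow> ('a tensor \<Rightarrow> 'a tensor) \<Rightarrow>
      ((nat \<Rightarrow> 'b) \<Rightarrow> (nat \<Rightarrow> 'b) set) \<Rightarrow> bool" where
  "operator_represents k n A X \<phi> \<equiv> priestley_dual_pair.represents (tensor_power A k)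
    (priestley_dual.rep_tensor \<phi> k) (space_power X n) (priestley_dual.rep_tensor \<phi> n)"

lemma (in priestley_dual) tensor_self_pair:
  "priestley_dual_pair (tensor_power A k) (space_power X k) (rep_tensor k)
    (tensor_power A n) (space_power X n) (rep_tensor n)"
  by (intro priestley_dual_pair.intro tensor_dual)

text \<open>The two inclusions are given the quantifier order of the two clauses of
  \<open>relational_morphisms\<close>, so that its definition matches after one
  substitution.\<close>

lemma ball_relation_eq_iff:
  "(\<forall>y\<in>N. \<forall>x\<in>K. (\<exists>x'\<in>M. p y x' \<and> q x' x) \<longleftrightarrow> (\<exists>v\<in>L. r y v \<and> s v x)) \<longleftrightarrow>
    (\<forall>y\<in>N. \<forall>v\<in>L. \<forall>x\<in>K. r y v \<and> s v x \<longrightarrow> (\<exists>x'\<in>M. p y x' \<and> q x' x)) \<and>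
    (\<forall>y\<in>N. \<forall>x'\<in>M. \<forall>x\<in>K. p y x' \<and> q x' x \<longrightarrow> (\<exists>v\<in>L. r y v \<and> s v x))"
  by blast

lemma operator_hom_iff_relational_morphism:
  fixes A B :: "'a gorder" and X Y :: "'b ordered_space"
  assumes pair: "priestley_dual_pair A X \<phi> B Y \<psi>"
    and a: "a \<in> jsl_hom (tensor_power A k) (tensor_power A n)"
    and \<rho>: "\<rho> \<in> priestley_relations (space_power X n) (space_power X k)"
    and ar: "operator_represents k n A X \<phi> a \<rho>"
    and b: "b \<in> jsl_hom (tensor_power B k) (tensor_power B n)"
    and \<sigma>: "\<sigma> \<in> priestley_relations (space_power Y n) (space_power Y k)"
    and br: "operator_represents k n B Y \<psi> b \<sigma>"
    and h: "h \<in> jsl_hom A B"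
  shows "h \<in> operator_hom k n (A, a) (B, b) \<longleftrightarrow>
    priestley_dual_pair.dual_relation A X \<phi> Y \<psi> h \<in> relational_morphisms n k (Y, \<sigma>) (X, \<rho>)"
proof -
  interpret priestley_dual_pair A X \<phi> B Y \<psi> by (rule pair)
  define \<beta> where "\<beta> = dual_relation h"
  have \<beta>: "\<beta> \<in> priestley_relations Y X" and \<beta>r: "represents h \<beta>"
    using dual_relation_priestley[OF h] dual_relation_represents[OF h] by (simp_all add: \<beta>_def)
  have jA: "jsl A" and jB: "jsl B" by unfold_locales
  let ?th = "\<lambda>m. tensor_map A B m h" and ?\<beta> = "\<lambda>m. power_relation m \<beta>"
  interpret P: priestley_dual_pair "tensor_power A k" "space_power X k" "A.rep_tensor k"
      "tensor_power B n" "space_power Y n" "B.rep_tensor n"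
    by (intro priestley_dual_pair.intro A.tensor_dual B.tensor_dual)
  let ?L = "compose (carrier (tensor_power A k)) (?th n) a"
    and ?R = "compose (carrier (tensor_power A k)) b (?th k)"
  \<comment> \<open>The relations of \<open>?L\<close> and \<open>?R\<close>, both from the
    \<open>n\<close>-th power of \<open>Y\<close> to the \<open>k\<close>-th power of
    \<open>X\<close>: the product relation followed by \<open>\<rho>\<close>, and
    \<open>\<sigma>\<close> followed by the product relation.\<close>
  let ?S = "\<lambda>y\<in>points (space_power Y n). \<Union>x\<in>?\<beta> n y. \<rho> x"
    and ?T = "\<lambda>y\<in>points (space_power Y n). \<Union>v\<in>\<sigma> y. ?\<beta> k v"
  note th = tensor_map_hom[OF jA jB h] and pb = power_relation_priestley[OF h \<beta> \<beta>r]
  have L: "P.represents ?L ?S" "?S \<in> P.closed_relations"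
    using represents_compose[OF A.tensor_self_pair tensor_pair a \<rho> ar pb] by simp_all
  have R: "P.represents ?R ?T" "?T \<in> P.closed_relations"
    using represents_compose[OF tensor_pair B.tensor_self_pair th pb \<sigma> br] by simp_all
  have ext: "?L \<in> carrier (tensor_power A k) \<rightarrow>\<^sub>E carrier (tensor_power B n)"
      "?R \<in> carrier (tensor_power A k) \<rightarrow>\<^sub>E carrier (tensor_power B n)"
    using jsl_hom_compose[OF a th P.A.jsl_axioms] jsl_hom_compose[OF th b P.A.jsl_axioms]
    by (simp_all add: jsl_hom_def)
  have "h \<in> operator_hom k n (A, a) (B, b) \<longleftrightarrow> ?L = ?R"
  proof
    assume "h \<in> operator_hom k n (A, a) (B, b)"
    then show "?L = ?R" using operator_homD(2) by (intro PiE_ext[OF ext]) (simp add: compose_eq)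
  next
    assume eq: "?L = ?R"
    have "?th n (a c) = b (?th k c)" if "c \<in> carrier (tensor_power A k)" for c
      using fun_cong[OF eq, of c] that by (simp add: compose_eq)
    then show "h \<in> operator_hom k n (A, a) (B, b)" using h by (simp add: operator_hom_def)
  qed
  also have "\<dots> \<longleftrightarrow> ?S = ?T"
  proof
    assume "?L = ?R"
    then have "P.represents ?L ?T" using R(1) by simp
    then show "?S = ?T" by (rule P.represents_unique_relation[OF L(2) R(2) L(1)])
  next
    assume "?S = ?T"
    then have "P.represents ?R ?S" using R(1) by simp
    then show "?L = ?R" by (rule P.represents_unique_hom[OF ext L(1)])
  qed
  also have "\<dots> \<longleftrightarrow> (\<forall>y\<in>tuples (points Y) n. ?S y = ?T y)"
  proof
    assume "\<forall>y\<in>tuples (points Y) n. ?S y = ?T y"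
    then show "?S = ?T" by (intro extensionalityI[of _ "points (space_power Y n)"]) (simp_all add: points_space_power)
  qed simp
  also have "\<dots> \<longleftrightarrow> (\<forall>y\<in>tuples (points Y) n. \<forall>x\<in>tuples (points X) k.
      (\<exists>x'\<in>tuples (points X) n. (\<forall>i<n. x' i \<in> \<beta> (y i)) \<and> x \<in> \<rho> x') \<longleftrightarrow>
      (\<exists>v\<in>tuples (points Y) k. v \<in> \<sigma> y \<and> (\<forall>i<k. x i \<in> \<beta> (v i))))"
  proof (rule ball_cong[OF HOL.refl])
    fix y assume y: "y \<in> tuples (points Y) n"
    have \<beta>p: "u \<in> \<beta> w \<Longrightarrow> w \<in> points Y \<Longrightarrow> u \<in> points X" for u w
      by (rule priestley_relation_points[OF \<beta>])
    have \<rho>p: "u \<in> \<rho> w \<Longrightarrow> w \<in> tuples (points X) n \<Longrightarrow> u \<in> tuples (points X) k" for u w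
      using priestley_relation_points[OF \<rho>] by (simp add: points_space_power)
    have \<sigma>p: "u \<in> \<sigma> w \<Longrightarrow> w \<in> tuples (points Y) n \<Longrightarrow> u \<in> tuples (points Y) k" for u w
      using priestley_relation_points[OF \<sigma>] by (simp add: points_space_power)
    have \<beta>m: "u \<in> ?\<beta> m w \<longleftrightarrow> u \<in> tuples (points X) m \<and> (\<forall>i<m. u i \<in> \<beta> (w i))"
      if w: "w \<in> tuples (points Y) m" for u w m
    proof -
      have "u i \<in> points X" if "u i \<in> \<beta> (w i)" "i < m" for i
        using \<beta>p[OF that(1)] w that(2) by (simp add: PiE_iff)
      then show ?thesis using w by (auto simp: power_relation_def PiE_iff)
    qed
    have S: "x \<in> ?S y \<longleftrightarrow> x \<in> tuples (points X) k \<and>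
        (\<exists>x'\<in>tuples (points X) n. (\<forall>i<n. x' i \<in> \<beta> (y i)) \<and> x \<in> \<rho> x')" for x
    proof -
      have "x \<in> ?S y \<longleftrightarrow> (\<exists>x'. x' \<in> ?\<beta> n y \<and> x \<in> \<rho> x')"
        using y by (simp add: points_space_power Bex_def)
      also have "\<dots> \<longleftrightarrow> (\<exists>x'. x' \<in> tuples (points X) n \<and> (\<forall>i<n. x' i \<in> \<beta> (y i)) \<and> x \<in> \<rho> x')"
        by (simp only: \<beta>m[OF y] conj_assoc)
      finally show ?thesis using \<rho>p by (simp only: Bex_def) metis
    qed
    have T: "x \<in> ?T y \<longleftrightarrow> x \<in> tuples (points X) k \<and>
        (\<exists>v\<in>tuples (points Y) k. v \<in> \<sigma> y \<and> (\<forall>i<k. x i \<in> \<beta> (v i)))" for x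
    proof -
      have "x \<in> ?T y \<longleftrightarrow> (\<exists>v. v \<in> \<sigma> y \<and> x \<in> ?\<beta> k v)"
        using y by (simp add: points_space_power Bex_def)
      also have "\<dots> \<longleftrightarrow> (\<exists>v. v \<in> \<sigma> y \<and> v \<in> tuples (points Y) k \<and> x \<in> ?\<beta> k v)"
        using \<sigma>p[OF _ y] by metis
      also have "\<dots> \<longleftrightarrow> (\<exists>v. v \<in> \<sigma> y \<and> v \<in> tuples (points Y) k \<and> x \<in> tuples (points X) k \<and> (\<forall>i<k. x i \<in> \<beta> (v i)))"
        using \<beta>m by metis
      finally show ?thesis by (simp only: Bex_def) metis
    qed
    \<comment> \<open>All values consist of tuples of points of \<open>X\<close>, so equality of the
      two sets need only be tested on such tuples.\<close>
    have conj_eq: "((p \<and> q) = (p \<and> r)) = (p \<longrightarrow> q = r)" for p q r by blast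
    have "?S y = ?T y \<longleftrightarrow> (\<forall>x. x \<in> ?S y \<longleftrightarrow> x \<in> ?T y)" by (rule set_eq_iff)
    also have "\<dots> \<longleftrightarrow> (\<forall>x\<in>tuples (points X) k.
      (\<exists>x'\<in>tuples (points X) n. (\<forall>i<n. x' i \<in> \<beta> (y i)) \<and> x \<in> \<rho> x') \<longleftrightarrow>
      (\<exists>v\<in>tuples (points Y) k. v \<in> \<sigma> y \<and> (\<forall>i<k. x i \<in> \<beta> (v i))))"
      unfolding S T by (simp only: Ball_def conj_eq)
    finally show "?S y = ?T y \<longleftrightarrow> (\<forall>x\<in>tuples (points X) k.
      (\<exists>x'\<in>tuples (points X) n. (\<forall>i<n. x' i \<in> \<beta> (y i)) \<and> x \<in> \<rho> x') \<longleftrightarrow>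
      (\<exists>v\<in>tuples (points Y) k. v \<in> \<sigma> y \<and> (\<forall>i<k. x i \<in> \<beta> (v i))))" .
  qed
  also have "\<dots> \<longleftrightarrow> \<beta> \<in> relational_morphisms n k (Y, \<sigma>) (X, \<rho>)"
    by (subst ball_relation_eq_iff) (simp add: relational_morphisms_def \<beta>)
  finally show ?thesis by (simp only: \<beta>_def)
qed

section \<open>Duality under size restrictions\<close>

lemma Rel_Priestley_simps:
  "Obj (Rel_Priestley n k) = relational_priestley_spaces n k"
  "Hom (Rel_Priestley n k) = relational_morphisms n k"
  "Ident (Rel_Priestley n k) (X, \<rho>) = (\<lambda>x\<in>points X. {y \<in> points X. (y, x) \<in> ord_rel X})"
  "Comp (Rel_Priestley n k) (X, \<rho>) Y Z \<gamma> \<beta> = (\<lambda>x\<in>points X. \<Union>y\<in>\<beta> x. \<gamma> y)"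
  by (simp_all add: Rel_Priestley_def)

text \<open>All questions of size are collected in \<open>P\<close> and \<open>Q\<close>. Since both
  subcategories are full, the treatment of morphisms does not depend on them; it remains to find,
  for each admissible object, an admissible partner.\<close>

theorem restricted_duality:
  fixes P :: "'a gorder \<Rightarrow> bool" and Q :: "'b ordered_space \<Rightarrow> bool"
  assumes dual_space: "\<And>A. bounded_distrib_lattice A \<Longrightarrow> P A \<Longrightarrow> \<exists>X \<phi>. Q X \<and> priestley_dual A X \<phi>"
    and dual_lattice: "\<And>X. priestley_space X \<Longrightarrow> Q X \<Longrightarrow>
      \<exists>A \<phi>. P A \<and> bounded_distrib_lattice A \<and> priestley_dual A X \<phi>"
  shows "dually_equivalent (full_subcategory (Op_U k n) (\<lambda>(A, a). P A))
    (full_subcategory (Rel_Priestley n k) (\<lambda>(X, \<rho>). Q X))"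
proof -
  \<comment> \<open>The representation \<open>\<phi>\<close> belongs to the index, because an
    operator and a relational space may be matched in several ways and \<open>T\<close> depends on
    the way.\<close>
  define W :: "(('a operator \<times> 'b relational_space) \<times> ('a \<Rightarrow> 'b set)) set" where
    "W = {(((A, a), (X, \<rho>)), \<phi>) |A a X \<rho> \<phi>. (A, a) \<in> U_operators k n \<and> P A \<and>
      (X, \<rho>) \<in> relational_priestley_spaces n k \<and> Q X \<and> priestley_dual A X \<phi> \<and>
      operator_represents k n A X \<phi> a \<rho>}"
  \<comment> \<open>The two indices enter in reversed order: a morphism of the opposite category
    from the first to the second is a map from the second lattice to the first.\<close>
  define T :: "(('a operator \<times> 'b relational_space) \<times> ('a \<Rightarrow> 'b set)) \<Rightarrow>
      (('a operator \<times> 'b relational_space) \<times> ('a \<Rightarrow> 'b set)) \<Rightarrow> ('a \<Rightarrow> 'a) \<Rightarrow> 'b \<Rightarrow> 'b set" where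
    "T = (\<lambda>((Aa, X\<rho>), \<phi>) ((Bb, Y\<sigma>), \<psi>).
      priestley_dual_pair.dual_relation (fst Bb) (fst Y\<sigma>) \<psi> (fst X\<rho>) \<phi>)"
  have WE: "\<exists>A a X \<rho> \<phi>. w = (((A, a), (X, \<rho>)), \<phi>) \<and> (A, a) \<in> U_operators k n \<and> P A \<and>
      (X, \<rho>) \<in> relational_priestley_spaces n k \<and> Q X \<and> priestley_dual A X \<phi> \<and>
      operator_represents k n A X \<phi> a \<rho>" if "w \<in> W" for w
    using that unfolding W_def by (rule CollectD)
  have relD: "priestley_space X" "\<rho> \<in> priestley_relations (space_power X n) (space_power X k)"
    if "(X, \<rho>) \<in> relational_priestley_spaces n k" for X :: "'b ordered_space" and \<rho>
    using that by (simp_all add: relational_priestley_spaces_def)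
  let ?C = "opposite (full_subcategory (Op_U k n) (\<lambda>(A :: 'a gorder, a). P A))"
  let ?D = "full_subcategory (Rel_Priestley n k) (\<lambda>(X :: 'b ordered_space, \<rho>). Q X)"
  have "hom_correspondence ?C ?D W (\<lambda>w. fst (fst w)) (\<lambda>w. snd (fst w)) T"
  proof
    show "is_category ?C"
      by (intro is_category_opposite is_category_full_subcategory Op_U_category)
    show "(\<lambda>w. fst (fst w)) ` W = Obj ?C"
    proof (intro equalityI subsetI)
      fix Aa assume "Aa \<in> (\<lambda>w. fst (fst w)) ` W"
      then obtain w where "w \<in> W" "Aa = fst (fst w)" by (elim imageE)
      then show "Aa \<in> Obj ?C" using WE[of w] by (auto simp: Op_U_simps)
    next
      fix Aa assume "Aa \<in> Obj ?C"
      moreover obtain A a where Aa: "Aa = (A, a)" by (metis surj_pair)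
      ultimately have A: "(A, a) \<in> U_operators k n" "P A" by (simp_all add: Op_U_simps)
      obtain X \<phi> where X: "Q X" "priestley_dual A X \<phi>"
        using dual_space[OF U_operatorD(1)[OF A(1)] A(2)] by (elim exE conjE)
      interpret priestley_dual A X \<phi> by (rule X)
      interpret S: priestley_dual_pair "tensor_power A k" "space_power X k" "rep_tensor k"
          "tensor_power A n" "space_power X n" "rep_tensor n"
        by (rule tensor_self_pair)
      let ?\<rho> = "S.dual_relation a"
      have "(X, ?\<rho>) \<in> relational_priestley_spaces n k"
        using priestley S.dual_relation_priestley[OF U_operatorD(3)[OF A(1)]]
        by (simp add: relational_priestley_spaces_def)
      then have "(((A, a), (X, ?\<rho>)), \<phi>) \<in> W"
        using A X S.dual_relation_represents[OF U_operatorD(3)[OF A(1)]] by (simp add: W_def)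
      then show "Aa \<in> (\<lambda>w. fst (fst w)) ` W" using Aa by (intro image_eqI[of _ _ "(((A, a), (X, ?\<rho>)), \<phi>)"]) simp
    qed
    show "(\<lambda>w. snd (fst w)) ` W = Obj ?D"
    proof (intro equalityI subsetI)
      fix X\<rho> assume "X\<rho> \<in> (\<lambda>w. snd (fst w)) ` W"
      then obtain w where "w \<in> W" "X\<rho> = snd (fst w)" by (elim imageE)
      then show "X\<rho> \<in> Obj ?D" using WE[of w] by (auto simp: Rel_Priestley_simps)
    next
      fix X\<rho> assume "X\<rho> \<in> Obj ?D"
      moreover obtain X \<rho> where X\<rho>: "X\<rho> = (X, \<rho>)" by (metis surj_pair)
      ultimately have X: "(X, \<rho>) \<in> relational_priestley_spaces n k" "Q X"
        by (simp_all add: Rel_Priestley_simps)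
      obtain A \<phi> where A: "P A" "bounded_distrib_lattice A" "priestley_dual A X \<phi>"
        using dual_lattice[OF relD(1)[OF X(1)] X(2)] by (elim exE conjE)
      interpret priestley_dual A X \<phi> by (rule A)
      interpret S: priestley_dual_pair "tensor_power A k" "space_power X k" "rep_tensor k"
          "tensor_power A n" "space_power X n" "rep_tensor n"
        by (rule tensor_self_pair)
      obtain a where a: "a \<in> jsl_hom (tensor_power A k) (tensor_power A n)" "S.represents a \<rho>"
        by (rule S.hom_of_relation[OF relD(2)[OF X(1)]])
      then have "(((A, a), (X, \<rho>)), \<phi>) \<in> W" using A X by (simp add: W_def U_operators_def)
      then show "X\<rho> \<in> (\<lambda>w. snd (fst w)) ` W" using X\<rho> by (intro image_eqI[of _ _ "(((A, a), (X, \<rho>)), \<phi>)"]) simp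
    qed
  next
    fix w w' assume w: "w \<in> W" "w' \<in> W"
    obtain A a X \<rho> \<phi> where 1: "w = (((A, a), (X, \<rho>)), \<phi>)" "(A, a) \<in> U_operators k n"
        "(X, \<rho>) \<in> relational_priestley_spaces n k" "priestley_dual A X \<phi>"
        "operator_represents k n A X \<phi> a \<rho>"
      using WE[OF w(1)] by (elim exE conjE)
    obtain B b Y \<sigma> \<psi> where 2: "w' = (((B, b), (Y, \<sigma>)), \<psi>)" "(B, b) \<in> U_operators k n"
        "(Y, \<sigma>) \<in> relational_priestley_spaces n k" "priestley_dual B Y \<psi>"
        "operator_represents k n B Y \<psi> b \<sigma>"
      using WE[OF w(2)] by (elim exE conjE)
    interpret S: priestley_dual_pair B Y \<psi> A X \<phi>
      by (rule priestley_dual_pair.intro[OF 2(4) 1(4)])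
    note iff = operator_hom_iff_relational_morphism[OF S.priestley_dual_pair_axioms U_operatorD(3)[OF 2(2)] relD(2)[OF 2(3)] 2(5)
      U_operatorD(3)[OF 1(2)] relD(2)[OF 1(3)] 1(5)]
    have "bij_betw S.dual_relation (operator_hom k n (B, b) (A, a)) (relational_morphisms n k (X, \<rho>) (Y, \<sigma>))"
    proof (intro bij_betw_imageI inj_onI equalityI subsetI)
      fix f g assume fg: "f \<in> operator_hom k n (B, b) (A, a)" "g \<in> operator_hom k n (B, b) (A, a)"
        "S.dual_relation f = S.dual_relation g"
      have fg': "f \<in> jsl_hom B A" "g \<in> jsl_hom B A" using fg operator_homD(1) by blast+
      have "S.represents f (S.dual_relation f)" "S.represents g (S.dual_relation f)"
        using S.dual_relation_represents[OF fg'(1)] S.dual_relation_represents[OF fg'(2)] fg(3) by simp_all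
      then show "f = g" by (intro S.represents_unique_hom) (use fg' in \<open>simp_all add: jsl_hom_def\<close>)
    next
      fix \<beta> assume "\<beta> \<in> S.dual_relation ` operator_hom k n (B, b) (A, a)"
      then obtain h where "h \<in> operator_hom k n (B, b) (A, a)" "\<beta> = S.dual_relation h" by (elim imageE)
      then show "\<beta> \<in> relational_morphisms n k (X, \<rho>) (Y, \<sigma>)"
        using iff[of h] operator_homD(1) by metis
    next
      fix \<beta> assume \<beta>: "\<beta> \<in> relational_morphisms n k (X, \<rho>) (Y, \<sigma>)"
      then have \<beta>': "\<beta> \<in> priestley_relations X Y" by (simp add: relational_morphisms_def)
      obtain h where h: "h \<in> jsl_hom B A" "S.represents h \<beta>" by (rule S.hom_of_relation[OF \<beta>'])
      then have eq: "S.dual_relation h = \<beta>"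
        by (intro S.dual_relation_eqI S.priestley_closed_relation[OF \<beta>'])
      then have "h \<in> operator_hom k n (B, b) (A, a)" using iff[OF h(1)] \<beta> by simp
      then show "\<beta> \<in> S.dual_relation ` operator_hom k n (B, b) (A, a)"
        using eq by (intro image_eqI[of _ _ h]) simp_all
    qed
    then show "bij_betw (T w w') (Hom ?C (fst (fst w)) (fst (fst w'))) (Hom ?D (snd (fst w)) (snd (fst w')))"
      by (simp add: T_def 1(1) 2(1) Op_U_simps Rel_Priestley_simps)
  next
    fix w assume w: "w \<in> W"
    obtain A a X \<rho> \<phi> where 1: "w = (((A, a), (X, \<rho>)), \<phi>)" "(A, a) \<in> U_operators k n"
        "priestley_dual A X \<phi>"
      using WE[OF w] by (elim exE conjE)
    interpret priestley_dual A X \<phi> by (rule 1)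
    interpret S: priestley_dual_pair A X \<phi> A X \<phi> by unfold_locales
    have "S.dual_relation (\<lambda>x\<in>carrier A. x) = (\<lambda>x\<in>points X. {y \<in> points X. (y, x) \<in> ord_rel X})"
      using operator_homD(1)[OF operator_hom_ident[OF 1(2)]] represents_ident(2,1)
      by (rule S.dual_relation_eqI)
    then show "T w w (Ident ?C (fst (fst w))) = Ident ?D (snd (fst w))"
      by (simp add: T_def 1(1) Op_U_simps Rel_Priestley_simps)
  next
    fix w w' w'' f g assume w: "w \<in> W" "w' \<in> W" "w'' \<in> W"
      and f: "f \<in> Hom ?C (fst (fst w)) (fst (fst w'))" and g: "g \<in> Hom ?C (fst (fst w')) (fst (fst w''))"
    obtain A a X \<rho> \<phi> where 1: "w = (((A, a), (X, \<rho>)), \<phi>)" "(A, a) \<in> U_operators k n"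
        "priestley_dual A X \<phi>"
      using WE[OF w(1)] by (elim exE conjE)
    obtain B b Y \<sigma> \<psi> where 2: "w' = (((B, b), (Y, \<sigma>)), \<psi>)" "(B, b) \<in> U_operators k n"
        "priestley_dual B Y \<psi>"
      using WE[OF w(2)] by (elim exE conjE)
    obtain D d Z \<tau> \<chi> where 3: "w'' = (((D, d), (Z, \<tau>)), \<chi>)" "(D, d) \<in> U_operators k n"
        "priestley_dual D Z \<chi>"
      using WE[OF w(3)] by (elim exE conjE)
    have f': "f \<in> jsl_hom B A" using f operator_homD(1) by (simp add: 1(1) 2(1) Op_U_simps operator_hom_def)
    have g': "g \<in> jsl_hom D B" using g operator_homD(1) by (simp add: 2(1) 3(1) Op_U_simps operator_hom_def)
    interpret BA: priestley_dual_pair B Y \<psi> A X \<phi> by (rule priestley_dual_pair.intro[OF 2(3) 1(3)])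
    interpret DB: priestley_dual_pair D Z \<chi> B Y \<psi> by (rule priestley_dual_pair.intro[OF 3(3) 2(3)])
    interpret DA: priestley_dual_pair D Z \<chi> A X \<phi> by (rule priestley_dual_pair.intro[OF 3(3) 1(3)])
    note rc = represents_compose[OF DB.priestley_dual_pair_axioms BA.priestley_dual_pair_axioms g'
      DB.dual_relation_priestley[OF g'] DB.dual_relation_represents[OF g']
      BA.dual_relation_priestley[OF f'] BA.dual_relation_represents[OF f']]
    have "DA.dual_relation (compose (carrier D) f g) =
        (\<lambda>x\<in>points X. \<Union>y\<in>BA.dual_relation f x. DB.dual_relation g y)"
      by (rule DA.dual_relation_eqI[OF jsl_hom_compose[OF g' f' U_operatorD(2)[OF 3(2)]] rc(2,1)])
    then show "T w w'' (Comp ?C (fst (fst w)) (fst (fst w')) (fst (fst w'')) g f) =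
        Comp ?D (snd (fst w)) (snd (fst w')) (snd (fst w'')) (T w' w'' g) (T w w' f)"
      by (simp add: T_def 1(1) 2(1) 3(1) Op_U_simps Rel_Priestley_simps)
  qed
  then show ?thesis unfolding dually_equivalent_def by (rule hom_correspondence.equivalent)
qed

lemma full_subcategory_True: "full_subcategory C (\<lambda>(x, y). True) = C"
  by (simp add: full_subcategory_def)

theorem theorem4p4:
  fixes k n :: nat
  shows "dually_equivalent
      (Op_U k n :: ('a operator, 'a \<Rightarrow> 'a) category)
      (full_subcategory
        (Rel_Priestley n k :: ('a set relational_space, 'a set \<Rightarrow> 'a set set) category)
        (\<lambda>(X, \<rho>). clopen_upsets X \<lesssim> (UNIV :: 'a set)))
    \<and> dually_equivalent
      (full_subcategory
        (Op_U k n :: ('a set operator, 'a set \<Rightarrow> 'a set) category)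
        (\<lambda>(A, a). prime_filters A \<lesssim> (UNIV :: 'a set)))
      (Rel_Priestley n k :: ('a relational_space, 'a \<Rightarrow> 'a set) category)
    \<and> ((\<forall>S :: 'a set. S \<prec> (UNIV :: 'a set) \<longrightarrow> Pow S \<prec> (UNIV :: 'a set)) \<longrightarrow>
      dually_equivalent
        (full_subcategory
          (Op_U k n :: ('a operator, 'a \<Rightarrow> 'a) category)
          (\<lambda>(A, a). carrier A \<prec> (UNIV :: 'a set)))
        (full_subcategory
          (Rel_Priestley n k :: ('a relational_space, 'a \<Rightarrow> 'a set) category)
          (\<lambda>(X, \<rho>). points X \<prec> (UNIV :: 'a set))))"
proof (intro conjI impI)
  have "dually_equivalent
      (full_subcategory (Op_U k n :: ('a operator, 'a \<Rightarrow> 'a) category) (\<lambda>(A, a). True))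
      (full_subcategory
        (Rel_Priestley n k :: ('a set relational_space, 'a set \<Rightarrow> 'a set set) category)
        (\<lambda>(X, \<rho>). clopen_upsets X \<lesssim> (UNIV :: 'a set)))"
  proof (rule restricted_duality)
    fix A :: "'a gorder" assume "bounded_distrib_lattice A"
    \<comment> \<open>Here the prime filters themselves serve as points.\<close>
    then obtain X :: "'a set ordered_space" and \<phi> where X: "priestley_dual A X \<phi>"
      using bounded_distrib_lattice.prime_filter_space[of A "\<lambda>F. F"] by auto
    have "clopen_upsets X \<lesssim> carrier A"
      by (rule eqpoll_imp_lepoll[OF priestley_dual.clopen_upsets_eqpoll[OF X]])
    then have "clopen_upsets X \<lesssim> (UNIV :: 'a set)"
      by (rule lepoll_trans[OF _ subset_imp_lepoll[OF subset_UNIV]])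
    then show "\<exists>X \<phi>. clopen_upsets X \<lesssim> (UNIV :: 'a set) \<and> priestley_dual A X (\<phi> :: 'a \<Rightarrow> 'a set set)"
      using X by (intro exI conjI)
  next
    fix X :: "'a set ordered_space"
    assume "priestley_space X" "clopen_upsets X \<lesssim> (UNIV :: 'a set)"
    then show "\<exists>(A :: 'a gorder) \<phi>. True \<and> bounded_distrib_lattice A \<and> priestley_dual A X \<phi>"
      using clopen_upset_lattice by simp
  qed
  then show "dually_equivalent
      (Op_U k n :: ('a operator, 'a \<Rightarrow> 'a) category)
      (full_subcategory
        (Rel_Priestley n k :: ('a set relational_space, 'a set \<Rightarrow> 'a set set) category)
        (\<lambda>(X, \<rho>). clopen_upsets X \<lesssim> (UNIV :: 'a set)))"
    by (simp only: full_subcategory_True)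
next
  have "dually_equivalent
      (full_subcategory
        (Op_U k n :: ('a set operator, 'a set \<Rightarrow> 'a set) category)
        (\<lambda>(A, a). prime_filters A \<lesssim> (UNIV :: 'a set)))
      (full_subcategory (Rel_Priestley n k :: ('a relational_space, 'a \<Rightarrow> 'a set) category) (\<lambda>(X, \<rho>). True))"
  proof (rule restricted_duality)
    fix A :: "'a set gorder" assume A: "bounded_distrib_lattice A" "prime_filters A \<lesssim> (UNIV :: 'a set)"
    obtain j :: "'a set set \<Rightarrow> 'a" where j: "inj_on j (prime_filters A)"
      using A(2) by (auto simp: lepoll_def)
    show "\<exists>(X :: 'a ordered_space) \<phi>. True \<and> priestley_dual A X \<phi>"
      using bounded_distrib_lattice.prime_filter_space[OF A(1) j] by auto
  next
    fix X :: "'a ordered_space" assume X: "priestley_space X"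
    \<comment> \<open>Clopen upsets are sets of points, so the element type \<open>'a set\<close>
      always has room for them.\<close>
    obtain A :: "'a set gorder" and \<phi> where A: "bounded_distrib_lattice A" "priestley_dual A X \<phi>"
      using clopen_upset_lattice[OF X subset_imp_lepoll[OF subset_UNIV]] by (elim exE conjE)
    have "prime_filters A \<lesssim> (UNIV :: 'a set)"
      by (rule lepoll_trans[OF priestley_dual.prime_filters_lepoll_points[OF A(2,1)]
        subset_imp_lepoll[OF subset_UNIV]])
    then show "\<exists>A \<phi>. prime_filters A \<lesssim> (UNIV :: 'a set) \<and> bounded_distrib_lattice A \<and>
        priestley_dual A X (\<phi> :: 'a set \<Rightarrow> 'a set)"
      using A by (intro exI conjI)
  qed
  then show "dually_equivalent
      (full_subcategory
        (Op_U k n :: ('a set operator, 'a set \<Rightarrow> 'a set) category)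
        (\<lambda>(A, a). prime_filters A \<lesssim> (UNIV :: 'a set)))
      (Rel_Priestley n k :: ('a relational_space, 'a \<Rightarrow> 'a set) category)"
    by (simp only: full_subcategory_True)
next
  assume limit: "\<forall>S :: 'a set. S \<prec> (UNIV :: 'a set) \<longrightarrow> Pow S \<prec> (UNIV :: 'a set)"
  show "dually_equivalent
        (full_subcategory
          (Op_U k n :: ('a operator, 'a \<Rightarrow> 'a) category)
          (\<lambda>(A, a). carrier A \<prec> (UNIV :: 'a set)))
        (full_subcategory
          (Rel_Priestley n k :: ('a relational_space, 'a \<Rightarrow> 'a set) category)
          (\<lambda>(X, \<rho>). points X \<prec> (UNIV :: 'a set)))"
  proof (rule restricted_duality)
    fix A :: "'a gorder" assume A: "bounded_distrib_lattice A" "carrier A \<prec> (UNIV :: 'a set)"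
    \<comment> \<open>Prime filters are subsets of the carrier, and clopen upsets are subsets of the
      space; the strong limit hypothesis keeps both families small.\<close>
    have "prime_filters A \<lesssim> Pow (carrier A)"
      by (rule subset_imp_lepoll) (auto simp: prime_filters_def)
    then have small: "prime_filters A \<prec> (UNIV :: 'a set)"
      using limit A(2) by (blast intro: lesspoll_trans1)
    then obtain j :: "'a set \<Rightarrow> 'a" where j: "inj_on j (prime_filters A)"
      using lesspoll_imp_lepoll[OF small] by (auto simp: lepoll_def)
    obtain X :: "'a ordered_space" and \<phi> where X: "points X = j ` prime_filters A" "priestley_dual A X \<phi>"
      using bounded_distrib_lattice.prime_filter_space[OF A(1) j] by (elim exE conjE)
    have "points X \<prec> (UNIV :: 'a set)"
      unfolding X(1) by (rule lesspoll_trans1[OF image_lepoll small])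
    then show "\<exists>X \<phi>. points X \<prec> (UNIV :: 'a set) \<and> priestley_dual A X (\<phi> :: 'a \<Rightarrow> 'a set)"
      using X(2) by (intro exI conjI)
  next
    fix X :: "'a ordered_space" assume X: "priestley_space X" "points X \<prec> (UNIV :: 'a set)"
    have "clopen_upsets X \<lesssim> Pow (points X)"
      by (rule subset_imp_lepoll) (auto dest: clopen_upsets_sub)
    then have small: "clopen_upsets X \<prec> (UNIV :: 'a set)"
      using limit X(2) by (blast intro: lesspoll_trans1)
    then obtain A :: "'a gorder" and \<phi> where A: "bounded_distrib_lattice A" "priestley_dual A X \<phi>"
      using clopen_upset_lattice[OF X(1) lesspoll_imp_lepoll[OF small]] by (elim exE conjE)
    have "carrier A \<prec> (UNIV :: 'a set)"
      by (rule eq_lesspoll_trans[OF eqpoll_sym[OF priestley_dual.clopen_upsets_eqpoll[OF A(2)]] small])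
    then show "\<exists>A \<phi>. carrier A \<prec> (UNIV :: 'a set) \<and> bounded_distrib_lattice A \<and>
        priestley_dual A X (\<phi> :: 'a \<Rightarrow> 'a set)"
      using A by (intro exI conjI)
  qed
qed

end
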